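(* Let $E=TM\oplus T^*M\oplus\mathcal G$ be a standard Courant algebroid with scalar product of neutral signature, with quadratic Lie algebra bundle $(\mathcal G,[\cdot,\cdot]_{\mathcal G},\langle\cdot,\cdot\rangle_{\mathcal G})$ and defining data $(\nabla,R,H)$, such that $\mathrm{ad}:\mathcal G\to\mathrm{Der}_{\mathrm{sk}}(\mathcal G)$ is an isomorphism onto the bundle of skew-symmetric derivations. Let $\mathcal J$ be a generalized almost complex structure on $E$ with $(1,0)$-bundle $L=L(W,\mathcal D,\sigma,\epsilon)$, where $W\subset(TM)^{\mathbb C}$ has constant rank and $\sigma,\epsilon$ are smooth. Then $\mathcal J$ is integrable if and only if the following conditions hold: A) $W$ is an involutive distribution on $M$; B) $\mathcal D$ is a Lagrangian subbundle of $\mathcal G^{\mathbb C}$ (i.e. $\mathcal D_x\subset\mathcal G_x^{\mathbb C}$ is a Lagrangian subalgebra for any $x\in M$); C) the partial connection on $\mathcal G^{\mathbb C}$ given by $(\nabla+\mathrm{ad}_\sigma)_Xr:=\nabla_Xr+[\sigma(X),r]_{\mathcal G}$, for $X\in\Gamma(W)$, $r\in\Gamma(\mathcal G^{\mathbb C})$, preserves $\mathcal D$; D) for any $X,Y\in W$, $R(X,Y)+(d^\nabla\sigma)(X,Y)+[\sigma(X),\sigma(Y)]_{\mathcal G}\in\mathcal D$; E) on $\Lambda^3W$, $$H+2d\epsilon+2\langle R\wedge\sigma\rangle_{\mathcal G}+\langle(d^\nabla\sigma)\wedge\sigma\rangle_{\mathcal G}+2\langle[\sigma,\sigma],\sigma\rangle_{\mathcal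 G}=0,$$ where $\langle[\sigma,\sigma],\sigma\rangle_{\mathcal G}(X,Y,Z):=\langle[\sigma(X),\sigma(Y)]_{\mathcal G},\sigma(Z)\rangle_{\mathcal G}$ for $X,Y,Z\in W$.
   Context: Tensors are extended complex-linearly to complexifications without change of notation. A quadratic Lie algebra bundle is a vector bundle with smooth fibrewise Lie bracket and $\mathrm{ad}$-invariant non-degenerate symmetric bilinear form (scalar product). Standard Courant algebroid over $M$: $E=TM\oplus T^*M\oplus\mathcal G$ with defining data $(\nabla,R,H)$: $\nabla$ a connection on $\mathcal G$ preserving bracket and scalar product, $R\in\Omega^2(M,\mathcal G)$, $H\in\Omega^3(M)$ with $R^\nabla(X,Y)r=[R(X,Y),r]_{\mathcal G}$ ($R^\nabla$ the curvature), $d^\nabla R=0$, $dH=\langle R\wedge R\rangle_{\mathcal G}$. The scalar product is $\langle X+\xi+r,Y+\eta+s\rangle=\frac12(\xi(Y)+\eta(X))+\langle r,s\rangle_{\mathcal G}$, and the Dorfman bracket is determined by $[X,Y]=\mathcal L_XY+i_Yi_XH+R(X,Y)$, $[X,r]=-2\langle i_XR,r\rangle_{\mathcal G}+\nabla_Xr$, $[r_1,r_2]=2\langle\nabla r_1,r_2\rangle_{\mathcal G}+[r_1,r_2]_{\mathcal G}$, $[X,\eta]=\mathcal L_X\eta$, $[\eta_1,\eta_2]=[r,\eta]=0$ and $[u,v]+[v,u]=2d\langle u,v\rangle$. A generalized almost complex structure on $E$ is a field of endomorphisms $\mathcal J$, skew-symmetric for the scalar product, with $\mathcal J^2=-\mathrm{Id}$;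 its $(1,0)$-bundle $L\subset E^{\mathbb C}$ is the $\sqrt{-1}$-eigenbundle; $\mathcal J$ is integrable if $\Gamma(L)$ is closed under the Dorfman bracket. $L$ is a maximal isotropic subbundle with $L\cap\bar L=0$ and can be written as $$L(W,\mathcal D,\sigma,\epsilon)=\{X+\xi+\sigma(X)+r\mid X\in W,\ \xi\in((TM)^{\mathbb C})^*,\ r\in\mathcal D,\ \xi(Y)=2\epsilon(X,Y)-\langle\sigma(Y),\sigma(X)+2r\rangle_{\mathcal G}\ \forall Y\in W\},$$ where $W=\pi_{(TM)^{\mathbb C}}(L)$, $\mathcal D=\pi_{\mathcal G^{\mathbb C}}(\ker\pi_{(TM)^{\mathbb C}}|_L)$ is maximal isotropic in $\mathcal G^{\mathbb C}$, $\sigma:W\to\mathcal G^{\mathbb C}$ is linear and $\epsilon\in\Gamma(\Lambda^2W^* )$. A Lagrangian subalgebra is a complex Lie subalgebra which is a maximal isotropic subspace. For $W$ involutive, $d\epsilon$ and $d^\nabla\sigma$ are the exterior derivatives along $W$ given by the usual Cartan formulas with arguments in $\Gamma(W)$, e.g. $(d^\nabla\sigma)(X,Y)=\nabla_X(\sigma(Y))-\nabla_Y(\sigma(X))-\sigma(\mathcal L_XY)$. For a $\mathcal G^{\mathbb C}$-valued 2-form $A$ and 1-form $\sigma$ on $W$, $\langle A\wedge\sigma\rangle_{\mathcal G}(X,Y,Z)=\langle A(X,Y),\sigma(Z)\rangle_{\mathcal G}+\langle A(Y,Z),\sigma(X)\rangle_{\mathcal G}+\langle A(Z,X),\sigma(Y)\rangle_{\mathcal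 G}$. *)

theory Defs
  imports "HOL-Analysis.Analysis" "HOL-Library.Function_Algebras"
begin

section \<open>Linear algebra\<close>

text \<open>Tangent vectors are functionals on functions and covectors are functionals on tangent
  vectors, so the pointwise vector space structure on functions is needed.\<close>

instantiation "fun" :: (type, real_vector) real_vector
begin

definition scaleR_fun :: "real \<Rightarrow> ('a \<Rightarrow> 'b) \<Rightarrow> 'a \<Rightarrow> 'b"
  where "scaleR_fun c f = (\<lambda>x. c *\<^sub>R f x)"

instance
  by standard (auto simp: scaleR_fun_def fun_eq_iff scaleR_add_right scaleR_add_left)

end

definition lin_on :: "'a::real_vector set \<Rightarrow> 'b::real_vector set \<Rightarrow> ('a \<Rightarrow> 'b) \<Rightarrow> bool" where
  "lin_on V W f \<longleftrightarrow> f \<in> V \<rightarrow> W \<and> (\<forall>u\<in>V. \<forall>v\<in>V. f (u + v) = f u + f v) \<and>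
     (\<forall>c. \<forall>v\<in>V. f (c *\<^sub>R v) = c *\<^sub>R f v)"

definition bilin_on :: "'a::real_vector set \<Rightarrow> 'b::real_vector set \<Rightarrow> ('a \<Rightarrow> 'a \<Rightarrow> 'b) \<Rightarrow> bool" where
  "bilin_on V W b \<longleftrightarrow> (\<forall>u\<in>V. lin_on V W (b u) \<and> lin_on V W (\<lambda>v. b v u))"

text \<open>Functionals are extended by zero off \<open>V\<close>, so that equal functionals on \<open>V\<close> are
  equal as functions and the pointwise operations make this a vector space.\<close>

definition dual_space :: "'a::real_vector set \<Rightarrow> ('a \<Rightarrow> real) set" where
  "dual_space V = {\<alpha>. lin_on V UNIV \<alpha> \<and> (\<forall>v. v \<notin> V \<longrightarrow> \<alpha> v = 0)}"

definition neutral :: "'a::real_vector set \<Rightarrow> ('a \<Rightarrow> 'a \<Rightarrow> real) \<Rightarrow> bool" where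
  "neutral V b \<longleftrightarrow> (\<exists>P N. subspace P \<and> subspace N \<and> P \<subseteq> V \<and> N \<subseteq> V \<and>
     (\<forall>v\<in>V. \<exists>p\<in>P. \<exists>n\<in>N. v = p + n) \<and>
     (\<forall>p\<in>P. p \<noteq> 0 \<longrightarrow> b p p > 0) \<and> (\<forall>n\<in>N. n \<noteq> 0 \<longrightarrow> b n n < 0) \<and>
     (\<forall>p\<in>P. \<forall>n\<in>N. b p n = 0 \<and> b n p = 0) \<and> dim P = dim N)"

section \<open>Complexification\<close>

text \<open>The pair \<open>(a, b)\<close> stands for \<open>a + \<i> b\<close>. The complexification of a space \<open>V\<close> is
  \<open>V \<times> V\<close>; complex numbers occurring as values of complexified tensors are elements of
  \<^typ>\<open>real \<times> real\<close>.\<close>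

type_synonym 'a cx = "'a \<times> 'a"

definition cscale :: "complex \<Rightarrow> 'a::real_vector cx \<Rightarrow> 'a cx" where
  "cscale c u = (Re c *\<^sub>R fst u - Im c *\<^sub>R snd u, Re c *\<^sub>R snd u + Im c *\<^sub>R fst u)"

global_interpretation cx: vector_space cscale
  by standard (auto simp: cscale_def algebra_simps)

definition clin_on :: "'a::real_vector cx set \<Rightarrow> 'b::real_vector cx set \<Rightarrow> ('a cx \<Rightarrow> 'b cx) \<Rightarrow> bool" where
  "clin_on V W f \<longleftrightarrow> f \<in> V \<rightarrow> W \<and> (\<forall>u\<in>V. \<forall>v\<in>V. f (u + v) = f u + f v) \<and>
     (\<forall>c. \<forall>v\<in>V. f (cscale c v) = cscale c (f v))"

text \<open>Complex-linear extension of linear, bilinear and trilinear maps, and of bilinear operators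
  on sections.\<close>

definition cx1 :: "('a \<Rightarrow> 'b) \<Rightarrow> 'a cx \<Rightarrow> 'b cx" where
  "cx1 f = map_prod f f"

definition cx2 :: "('a \<Rightarrow> 'b \<Rightarrow> 'c::real_vector) \<Rightarrow> 'a cx \<Rightarrow> 'b cx \<Rightarrow> 'c cx" where
  "cx2 b u v = (b (fst u) (fst v) - b (snd u) (snd v), b (fst u) (snd v) + b (snd u) (fst v))"

definition cx3 :: "('a \<Rightarrow> 'b \<Rightarrow> 'c \<Rightarrow> 'd::real_vector) \<Rightarrow> 'a cx \<Rightarrow> 'b cx \<Rightarrow> 'c cx \<Rightarrow> 'd cx" where
  "cx3 t u v w =
    (t (fst u) (fst v) (fst w) - t (fst u) (snd v) (snd w)
       - t (snd u) (fst v) (snd w) - t (snd u) (snd v) (fst w),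
     t (fst u) (fst v) (snd w) + t (fst u) (snd v) (fst w)
       + t (snd u) (fst v) (fst w) - t (snd u) (snd v) (snd w))"

definition cx2_sec :: "(('m \<Rightarrow> 'a) \<Rightarrow> ('m \<Rightarrow> 'b) \<Rightarrow> 'm \<Rightarrow> 'c::real_vector)
    \<Rightarrow> ('m \<Rightarrow> 'a cx) \<Rightarrow> ('m \<Rightarrow> 'b cx) \<Rightarrow> 'm \<Rightarrow> 'c cx" where
  "cx2_sec B s t = (\<lambda>x.
    (B (fst \<circ> s) (fst \<circ> t) x - B (snd \<circ> s) (snd \<circ> t) x,
     B (fst \<circ> s) (snd \<circ> t) x + B (snd \<circ> s) (fst \<circ> t) x))"

definition cx_sections :: "('m \<Rightarrow> 'a) set \<Rightarrow> ('m \<Rightarrow> 'a cx) set" where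
  "cx_sections \<Gamma> = {s. fst \<circ> s \<in> \<Gamma> \<and> snd \<circ> s \<in> \<Gamma>}"

text \<open>Smooth sections, out of those in \<open>\<Gamma>\<close>, of the subbundle with fibres \<open>S x\<close>.\<close>

definition sub_sections :: "('m \<Rightarrow> 'a cx) set \<Rightarrow> ('m \<Rightarrow> 'a cx set) \<Rightarrow> ('m \<Rightarrow> 'a cx) set" where
  "sub_sections \<Gamma> S = {s \<in> \<Gamma>. \<forall>x. s x \<in> S x}"

definition isotropic :: "'a::real_vector set \<Rightarrow> ('a \<Rightarrow> 'a \<Rightarrow> real) \<Rightarrow> 'a cx set \<Rightarrow> bool" where
  "isotropic V b S \<longleftrightarrow> cx.subspace S \<and> S \<subseteq> V \<times> V \<and> (\<forall>u\<in>S. \<forall>v\<in>S. cx2 b u v = 0)"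

definition max_isotropic :: "'a::real_vector set \<Rightarrow> ('a \<Rightarrow> 'a \<Rightarrow> real) \<Rightarrow> 'a cx set \<Rightarrow> bool" where
  "max_isotropic V b S \<longleftrightarrow> isotropic V b S \<and> (\<forall>S'. isotropic V b S' \<and> S \<subseteq> S' \<longrightarrow> S' = S)"

definition lagrangian_subalgebra ::
  "'a::real_vector set \<Rightarrow> ('a \<Rightarrow> 'a \<Rightarrow> 'a) \<Rightarrow> ('a \<Rightarrow> 'a \<Rightarrow> real) \<Rightarrow> 'a cx set \<Rightarrow> bool" where
  "lagrangian_subalgebra V br ip S \<longleftrightarrow>
     max_isotropic V ip S \<and> (\<forall>u\<in>S. \<forall>v\<in>S. cx2 br u v \<in> S)"

section \<open>Smooth manifolds, vector fields and forms\<close>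

primrec Ck_on :: "nat \<Rightarrow> 'a::real_normed_vector set \<Rightarrow> ('a \<Rightarrow> 'b::real_normed_vector) \<Rightarrow> bool" where
  "Ck_on 0 S f \<longleftrightarrow> continuous_on S f"
| "Ck_on (Suc k) S f \<longleftrightarrow> (\<forall>x\<in>S. f differentiable (at x)) \<and>
     (\<forall>v. Ck_on k S (\<lambda>x. frechet_derivative f (at x) v))"

definition smooth_on :: "'a::real_normed_vector set \<Rightarrow> ('a \<Rightarrow> 'b::real_normed_vector) \<Rightarrow> bool" where
  "smooth_on S f \<longleftrightarrow> (\<forall>k. Ck_on k S f)"

text \<open>A manifold is a Hausdorff second countable type with an atlas (not necessarily maximal).
  The model space is a finite-dimensional inner product space instead of a
  \<^class>\<open>euclidean_space\<close> so that dimension 0 is allowed.\<close>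

type_synonym ('m, 'e) atlas = "('m set \<times> ('m \<Rightarrow> 'e)) set"

locale smooth_manifold =
  fixes A :: "('m::{t2_space,second_countable_topology}, 'e::real_inner) atlas"
  assumes finite_dimensional: "\<exists>B::'e set. finite B \<and> span B = UNIV"
    and charts_cover: "(\<Union>(U, \<phi>)\<in>A. U) = UNIV"
    and charts: "(U, \<phi>) \<in> A \<Longrightarrow>
      open U \<and> open (\<phi> ` U) \<and> homeomorphism U (\<phi> ` U) \<phi> (inv_into U \<phi>)"
    and charts_compatible: "(U, \<phi>) \<in> A \<Longrightarrow> (V, \<psi>) \<in> A \<Longrightarrow>
      smooth_on (\<phi> ` (U \<inter> V)) (\<psi> \<circ> inv_into U \<phi>)"

definition smooth_fun_on :: "('m, 'e::real_inner) atlas \<Rightarrow> 'm set \<Rightarrow> ('m \<Rightarrow> real) \<Rightarrow> bool" where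
  "smooth_fun_on A S f \<longleftrightarrow> (\<forall>(U, \<phi>)\<in>A. smooth_on (\<phi> ` (U \<inter> S)) (f \<circ> inv_into U \<phi>))"

definition smooth_funs :: "('m, 'e::real_inner) atlas \<Rightarrow> ('m \<Rightarrow> real) set" where
  "smooth_funs A = {f. smooth_fun_on A UNIV f}"

text \<open>Tangent vectors at \<open>x\<close> are the directional derivatives of smooth functions at \<open>x\<close>;
  they are made zero on non-smooth functions.\<close>

type_synonym 'm tvec = "('m \<Rightarrow> real) \<Rightarrow> real"

definition chart_derivative ::
  "('m, 'e::real_inner) atlas \<Rightarrow> 'm set \<Rightarrow> ('m \<Rightarrow> 'e) \<Rightarrow> 'm \<Rightarrow> 'e \<Rightarrow> 'm tvec" where
  "chart_derivative A U \<phi> x e = (\<lambda>f.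
     if f \<in> smooth_funs A then frechet_derivative (f \<circ> inv_into U \<phi>) (at (\<phi> x)) e else 0)"

definition tangent_space :: "('m, 'e::real_inner) atlas \<Rightarrow> 'm \<Rightarrow> 'm tvec set" where
  "tangent_space A x = {chart_derivative A U \<phi> x e | U \<phi> e. (U, \<phi>) \<in> A \<and> x \<in> U}"

definition fderiv :: "('m \<Rightarrow> 'm tvec) \<Rightarrow> ('m \<Rightarrow> real) \<Rightarrow> 'm \<Rightarrow> real" where
  "fderiv X f = (\<lambda>x. X x f)"

definition vector_fields :: "('m, 'e::real_inner) atlas \<Rightarrow> ('m \<Rightarrow> 'm tvec) set" where
  "vector_fields A =
     {X. (\<forall>x. X x \<in> tangent_space A x) \<and> (\<forall>f\<in>smooth_funs A. fderiv X f \<in> smooth_funs A)}"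

definition lie_bracket :: "('m \<Rightarrow> 'm tvec) \<Rightarrow> ('m \<Rightarrow> 'm tvec) \<Rightarrow> 'm \<Rightarrow> 'm tvec" where
  "lie_bracket X Y = (\<lambda>x f. fderiv X (fderiv Y f) x - fderiv Y (fderiv X f) x)"

type_synonym 'm covec = "'m tvec \<Rightarrow> real"

definition one_forms :: "('m, 'e::real_inner) atlas \<Rightarrow> ('m \<Rightarrow> 'm covec) set" where
  "one_forms A = {\<xi>. (\<forall>x. \<xi> x \<in> dual_space (tangent_space A x)) \<and>
     (\<forall>X\<in>vector_fields A. (\<lambda>x. \<xi> x (X x)) \<in> smooth_funs A)}"

definition d_fun :: "('m, 'e::real_inner) atlas \<Rightarrow> ('m \<Rightarrow> real) \<Rightarrow> 'm \<Rightarrow> 'm covec" where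
  "d_fun A f = (\<lambda>x v. if v \<in> tangent_space A x then v f else 0)"

definition lie_derivative ::
  "('m, 'e::real_inner) atlas \<Rightarrow> ('m \<Rightarrow> 'm tvec) \<Rightarrow> ('m \<Rightarrow> 'm covec) \<Rightarrow> 'm \<Rightarrow> 'm covec" where
  "lie_derivative A X \<eta> = (THE \<omega>. \<omega> \<in> one_forms A \<and> (\<forall>Y\<in>vector_fields A. \<forall>x.
     \<omega> x (Y x) = fderiv X (\<lambda>y. \<eta> y (Y y)) x - \<eta> x (lie_bracket X Y x)))"

section \<open>Vector bundles and quadratic Lie algebra bundles\<close>

text \<open>Fibres are subspaces of an ambient real vector space \<^typ>\<open>'v\<close> without topology; every vector
  bundle has this form (take the direct sum of all the fibres). The smooth structure comes from
  local trivialisations \<open>(U, k, \<tau>)\<close>, where \<open>\<tau> x\<close> identifies the fibre over \<open>x \<in> U\<close> with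
  \<open>coords k\<close>, a copy of k-dimensional real space. The rank may differ between components of
  the base.\<close>

type_synonym ('m, 'v) trivs = "('m set \<times> nat \<times> ('m \<Rightarrow> 'v \<Rightarrow> nat \<Rightarrow> real)) set"

definition coords :: "nat \<Rightarrow> (nat \<Rightarrow> real) set" where
  "coords k = {c. \<forall>i\<ge>k. c i = 0}"

locale smooth_vector_bundle = smooth_manifold A
  for A :: "('m::{t2_space,second_countable_topology}, 'e::real_inner) atlas" +
  fixes G :: "'m \<Rightarrow> 'v::real_vector set"
    and F :: "('m, 'v) trivs"
  assumes fibre_subspace: "subspace (G x)"
    and triv_cover: "(\<Union>(U, k, \<tau>)\<in>F. U) = UNIV"
    and triv: "(U, k, \<tau>) \<in> F \<Longrightarrow> open U \<and>
      (\<forall>x\<in>U. lin_on (G x) (coords k) (\<tau> x) \<and> bij_betw (\<tau> x) (G x) (coords k))"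
    and triv_compatible: "(U, k, \<tau>) \<in> F \<Longrightarrow> (U', k', \<tau>') \<in> F \<Longrightarrow> i < k' \<Longrightarrow> j < k \<Longrightarrow>
      smooth_fun_on A (U \<inter> U')
        (\<lambda>x. \<tau>' x (inv_into (G x) (\<tau> x) (\<lambda>l. if l = j then 1 else 0)) i)"

definition sections ::
  "('m, 'e::real_inner) atlas \<Rightarrow> ('m \<Rightarrow> 'v set) \<Rightarrow> ('m, 'v) trivs \<Rightarrow> ('m \<Rightarrow> 'v) set" where
  "sections A G F = {s. (\<forall>x. s x \<in> G x) \<and>
     (\<forall>(U, k, \<tau>)\<in>F. \<forall>i<k. smooth_fun_on A U (\<lambda>x. \<tau> x (s x) i))}"

locale quadratic_lie_algebra_bundle = smooth_vector_bundle A G F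
  for A :: "('m::{t2_space,second_countable_topology}, 'e::real_inner) atlas"
    and G :: "'m \<Rightarrow> 'v::real_vector set"
    and F :: "('m, 'v) trivs" +
  fixes br :: "'m \<Rightarrow> 'v \<Rightarrow> 'v \<Rightarrow> 'v"
    and ip :: "'m \<Rightarrow> 'v \<Rightarrow> 'v \<Rightarrow> real"
  assumes br_bilinear: "bilin_on (G x) (G x) (br x)"
    and br_alternating: "a \<in> G x \<Longrightarrow> br x a a = 0"
    and br_jacobi: "a \<in> G x \<Longrightarrow> b \<in> G x \<Longrightarrow> c \<in> G x \<Longrightarrow>
      br x a (br x b c) + br x b (br x c a) + br x c (br x a b) = 0"
    and br_smooth: "r \<in> sections A G F \<Longrightarrow> s \<in> sections A G F \<Longrightarrow>
      (\<lambda>x. br x (r x) (s x)) \<in> sections A G F"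
    and ip_bilinear: "bilin_on (G x) UNIV (ip x)"
    and ip_symmetric: "a \<in> G x \<Longrightarrow> b \<in> G x \<Longrightarrow> ip x a b = ip x b a"
    and ip_nondegenerate: "a \<in> G x \<Longrightarrow> (\<And>b. b \<in> G x \<Longrightarrow> ip x a b = 0) \<Longrightarrow> a = 0"
    and ip_invariant: "a \<in> G x \<Longrightarrow> b \<in> G x \<Longrightarrow> c \<in> G x \<Longrightarrow>
      ip x (br x a b) c + ip x b (br x a c) = 0"
    and ip_smooth: "r \<in> sections A G F \<Longrightarrow> s \<in> sections A G F \<Longrightarrow>
      (\<lambda>x. ip x (r x) (s x)) \<in> smooth_funs A"

definition skew_derivations ::
  "'v::real_vector set \<Rightarrow> ('v \<Rightarrow> 'v \<Rightarrow> 'v) \<Rightarrow> ('v \<Rightarrow> 'v \<Rightarrow> real) \<Rightarrow> ('v \<Rightarrow> 'v) set" where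
  "skew_derivations V br ip = {D \<in> extensional V. lin_on V V D \<and>
     (\<forall>r\<in>V. \<forall>s\<in>V. D (br r s) = br (D r) s + br r (D s)) \<and>
     (\<forall>r\<in>V. \<forall>s\<in>V. ip (D r) s + ip r (D s) = 0)}"

section \<open>Standard Courant algebroids\<close>

text \<open>A connection is given by its pointwise values: \<open>nabla x v s\<close> is the covariant derivative
  of the section \<open>s\<close> in the direction of the tangent vector \<open>v\<close> at \<open>x\<close>.\<close>

definition cov :: "('m \<Rightarrow> 'm tvec \<Rightarrow> ('m \<Rightarrow> 'v) \<Rightarrow> 'v) \<Rightarrow> ('m \<Rightarrow> 'm tvec) \<Rightarrow> ('m \<Rightarrow> 'v) \<Rightarrow> 'm \<Rightarrow> 'v" where
  "cov nabla X s = (\<lambda>x. nabla x (X x) s)"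

text \<open>In the axiom \<open>d_H\<close>, the left-hand side is the Cartan formula for the exterior derivative
  of \<open>H\<close>, and the right-hand side is the wedge product (sum over (2,2)-shuffles) of \<open>R\<close> with
  itself, paired by the scalar product.\<close>

locale standard_courant_algebroid = quadratic_lie_algebra_bundle A G F br ip
  for A :: "('m::{t2_space,second_countable_topology}, 'e::real_inner) atlas"
    and G :: "'m \<Rightarrow> 'v::real_vector set"
    and F :: "('m, 'v) trivs"
    and br :: "'m \<Rightarrow> 'v \<Rightarrow> 'v \<Rightarrow> 'v"
    and ip :: "'m \<Rightarrow> 'v \<Rightarrow> 'v \<Rightarrow> real" +
  fixes nabla :: "'m \<Rightarrow> 'm tvec \<Rightarrow> ('m \<Rightarrow> 'v) \<Rightarrow> 'v"
    and R :: "'m \<Rightarrow> 'm tvec \<Rightarrow> 'm tvec \<Rightarrow> 'v"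
    and H :: "'m \<Rightarrow> 'm tvec \<Rightarrow> 'm tvec \<Rightarrow> 'm tvec \<Rightarrow> real"
  assumes nabla_tensorial: "s \<in> sections A G F \<Longrightarrow>
      lin_on (tangent_space A x) (G x) (\<lambda>v. nabla x v s)"
    and nabla_add: "v \<in> tangent_space A x \<Longrightarrow> s \<in> sections A G F \<Longrightarrow> t \<in> sections A G F \<Longrightarrow>
      nabla x v (\<lambda>y. s y + t y) = nabla x v s + nabla x v t"
    and nabla_leibniz: "v \<in> tangent_space A x \<Longrightarrow> f \<in> smooth_funs A \<Longrightarrow> s \<in> sections A G F \<Longrightarrow>
      nabla x v (\<lambda>y. f y *\<^sub>R s y) = v f *\<^sub>R s x + f x *\<^sub>R nabla x v s"
    and nabla_smooth: "X \<in> vector_fields A \<Longrightarrow> s \<in> sections A G F \<Longrightarrow>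
      cov nabla X s \<in> sections A G F"
    and nabla_br: "v \<in> tangent_space A x \<Longrightarrow> s \<in> sections A G F \<Longrightarrow> t \<in> sections A G F \<Longrightarrow>
      nabla x v (\<lambda>y. br y (s y) (t y)) = br x (nabla x v s) (t x) + br x (s x) (nabla x v t)"
    and nabla_ip: "v \<in> tangent_space A x \<Longrightarrow> s \<in> sections A G F \<Longrightarrow> t \<in> sections A G F \<Longrightarrow>
      v (\<lambda>y. ip y (s y) (t y)) = ip x (nabla x v s) (t x) + ip x (s x) (nabla x v t)"
    and R_bilinear: "bilin_on (tangent_space A x) (G x) (R x)"
    and R_skew: "v \<in> tangent_space A x \<Longrightarrow> w \<in> tangent_space A x \<Longrightarrow> R x v w = - R x w v"
    and R_smooth: "X \<in> vector_fields A \<Longrightarrow> Y \<in> vector_fields A \<Longrightarrow>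
      (\<lambda>x. R x (X x) (Y x)) \<in> sections A G F"
    and H_linear: "u \<in> tangent_space A x \<Longrightarrow> bilin_on (tangent_space A x) UNIV (H x u)"
    and H_skew: "u \<in> tangent_space A x \<Longrightarrow> v \<in> tangent_space A x \<Longrightarrow> w \<in> tangent_space A x \<Longrightarrow>
      H x u v w = - H x v u w \<and> H x u v w = - H x u w v"
    and H_smooth: "X \<in> vector_fields A \<Longrightarrow> Y \<in> vector_fields A \<Longrightarrow> Z \<in> vector_fields A \<Longrightarrow>
      (\<lambda>x. H x (X x) (Y x) (Z x)) \<in> smooth_funs A"
    and curvature: "X \<in> vector_fields A \<Longrightarrow> Y \<in> vector_fields A \<Longrightarrow> s \<in> sections A G F \<Longrightarrow>
      cov nabla X (cov nabla Y s) x - cov nabla Y (cov nabla X s) x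
        - cov nabla (lie_bracket X Y) s x = br x (R x (X x) (Y x)) (s x)"
    and d_R: "X \<in> vector_fields A \<Longrightarrow> Y \<in> vector_fields A \<Longrightarrow> Z \<in> vector_fields A \<Longrightarrow>
      cov nabla X (\<lambda>y. R y (Y y) (Z y)) x - cov nabla Y (\<lambda>y. R y (X y) (Z y)) x
        + cov nabla Z (\<lambda>y. R y (X y) (Y y)) x
        - R x (lie_bracket X Y x) (Z x) + R x (lie_bracket X Z x) (Y x)
        - R x (lie_bracket Y Z x) (X x) = 0"
    and d_H: "X \<in> vector_fields A \<Longrightarrow> Y \<in> vector_fields A \<Longrightarrow> Z \<in> vector_fields A \<Longrightarrow>
      V \<in> vector_fields A \<Longrightarrow>
      fderiv X (\<lambda>y. H y (Y y) (Z y) (V y)) x - fderiv Y (\<lambda>y. H y (X y) (Z y) (V y)) x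
        + fderiv Z (\<lambda>y. H y (X y) (Y y) (V y)) x - fderiv V (\<lambda>y. H y (X y) (Y y) (Z y)) x
        - H x (lie_bracket X Y x) (Z x) (V x) + H x (lie_bracket X Z x) (Y x) (V x)
        - H x (lie_bracket X V x) (Y x) (Z x) - H x (lie_bracket Y Z x) (X x) (V x)
        + H x (lie_bracket Y V x) (X x) (Z x) - H x (lie_bracket Z V x) (X x) (Y x)
      = 2 * (ip x (R x (X x) (Y x)) (R x (Z x) (V x)) - ip x (R x (X x) (Z x)) (R x (Y x) (V x))
             + ip x (R x (X x) (V x)) (R x (Y x) (Z x)))"

type_synonym ('m, 'v) courant = "'m tvec \<times> 'm covec \<times> 'v"

abbreviation prT :: "('m, 'v) courant \<Rightarrow> 'm tvec" where "prT u \<equiv> fst u"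
abbreviation prF :: "('m, 'v) courant \<Rightarrow> 'm covec" where "prF u \<equiv> fst (snd u)"
abbreviation prG :: "('m, 'v) courant \<Rightarrow> 'v" where "prG u \<equiv> snd (snd u)"

definition courant_fibre ::
  "('m, 'e::real_inner) atlas \<Rightarrow> ('m \<Rightarrow> 'v set) \<Rightarrow> 'm \<Rightarrow> ('m, 'v) courant set" where
  "courant_fibre A G x = tangent_space A x \<times> dual_space (tangent_space A x) \<times> G x"

definition courant_sections ::
  "('m, 'e::real_inner) atlas \<Rightarrow> ('m \<Rightarrow> 'v set) \<Rightarrow> ('m, 'v) trivs \<Rightarrow> ('m \<Rightarrow> ('m, 'v) courant) set" where
  "courant_sections A G F = {u. (\<lambda>x. prT (u x)) \<in> vector_fields A \<and>
     (\<lambda>x. prF (u x)) \<in> one_forms A \<and> (\<lambda>x. prG (u x)) \<in> sections A G F}"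

definition courant_ip ::
  "('m \<Rightarrow> 'v \<Rightarrow> 'v \<Rightarrow> real) \<Rightarrow> 'm \<Rightarrow> ('m, 'v) courant \<Rightarrow> ('m, 'v) courant \<Rightarrow> real" where
  "courant_ip ip x u v = (prF u (prT v) + prF v (prT u)) / 2 + ip x (prG u) (prG v)"

text \<open>For \<open>u = X + \<xi> + r\<close> and \<open>v = Y + \<eta> + s\<close>. The brackets that are not listed among the defining
  ones follow from \<open>[a,b] + [b,a] = 2 d\<langle>a,b\<rangle>\<close>: it gives \<open>[\<xi>,Y] = d(\<xi>(Y)) - L_Y \<xi>\<close> and
  \<open>[r,Y] = - [Y,r] = 2 \<langle>i_Y R, r\<rangle> - \<nabla>_Y r\<close>, while \<open>[\<eta>,r] = - [r,\<eta>] = 0\<close>.\<close>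

definition dorfman ::
  "('m, 'e::real_inner) atlas \<Rightarrow> ('m \<Rightarrow> 'v::real_vector \<Rightarrow> 'v \<Rightarrow> 'v) \<Rightarrow> ('m \<Rightarrow> 'v \<Rightarrow> 'v \<Rightarrow> real) \<Rightarrow>
   ('m \<Rightarrow> 'm tvec \<Rightarrow> ('m \<Rightarrow> 'v) \<Rightarrow> 'v) \<Rightarrow> ('m \<Rightarrow> 'm tvec \<Rightarrow> 'm tvec \<Rightarrow> 'v) \<Rightarrow>
   ('m \<Rightarrow> 'm tvec \<Rightarrow> 'm tvec \<Rightarrow> 'm tvec \<Rightarrow> real) \<Rightarrow>
   ('m \<Rightarrow> ('m, 'v) courant) \<Rightarrow> ('m \<Rightarrow> ('m, 'v) courant) \<Rightarrow> 'm \<Rightarrow> ('m, 'v) courant" where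
  "dorfman A br ip nabla R H u v =
     (let X = (\<lambda>x. prT (u x)); \<xi> = (\<lambda>x. prF (u x)); r = (\<lambda>x. prG (u x));
          Y = (\<lambda>x. prT (v x)); \<eta> = (\<lambda>x. prF (v x)); s = (\<lambda>x. prG (v x))
      in (\<lambda>x.
        (lie_bracket X Y x,
         lie_derivative A X \<eta> x + (d_fun A (\<lambda>y. \<xi> y (Y y)) x - lie_derivative A Y \<xi> x)
           + (\<lambda>w. if w \<in> tangent_space A x
                  then H x (X x) (Y x) w - 2 * ip x (R x (X x) w) (s x)
                       + 2 * ip x (R x (Y x) w) (r x) + 2 * ip x (nabla x w r) (s x)
                  else 0),
         R x (X x) (Y x) + cov nabla X s x - cov nabla Y r x + br x (r x) (s x))))"

section \<open>Generalized almost complex structures\<close>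

definition generalized_almost_complex ::
  "('m, 'e::real_inner) atlas \<Rightarrow> ('m \<Rightarrow> 'v::real_vector set) \<Rightarrow> ('m, 'v) trivs \<Rightarrow>
   ('m \<Rightarrow> 'v \<Rightarrow> 'v \<Rightarrow> real) \<Rightarrow> ('m \<Rightarrow> ('m, 'v) courant \<Rightarrow> ('m, 'v) courant) \<Rightarrow> bool" where
  "generalized_almost_complex A G F ip J \<longleftrightarrow>
     (\<forall>x. lin_on (courant_fibre A G x) (courant_fibre A G x) (J x) \<and>
        (\<forall>u\<in>courant_fibre A G x. J x (J x u) = - u) \<and>
        (\<forall>u\<in>courant_fibre A G x. \<forall>v\<in>courant_fibre A G x.
           courant_ip ip x (J x u) v + courant_ip ip x u (J x v) = 0)) \<and>
     (\<forall>u\<in>courant_sections A G F. (\<lambda>x. J x (u x)) \<in> courant_sections A G F)"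

definition holo_bundle ::
  "('m, 'e::real_inner) atlas \<Rightarrow> ('m \<Rightarrow> 'v::real_vector set) \<Rightarrow>
   ('m \<Rightarrow> ('m, 'v) courant \<Rightarrow> ('m, 'v) courant) \<Rightarrow> 'm \<Rightarrow> ('m, 'v) courant cx set" where
  "holo_bundle A G J x =
     {u \<in> courant_fibre A G x \<times> courant_fibre A G x. cx1 (J x) u = cscale \<i> u}"

definition courant_integrable ::
  "('m, 'e::real_inner) atlas \<Rightarrow> ('m \<Rightarrow> 'v::real_vector set) \<Rightarrow> ('m, 'v) trivs \<Rightarrow>
   ('m \<Rightarrow> 'v \<Rightarrow> 'v \<Rightarrow> 'v) \<Rightarrow> ('m \<Rightarrow> 'v \<Rightarrow> 'v \<Rightarrow> real) \<Rightarrow>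
   ('m \<Rightarrow> 'm tvec \<Rightarrow> ('m \<Rightarrow> 'v) \<Rightarrow> 'v) \<Rightarrow> ('m \<Rightarrow> 'm tvec \<Rightarrow> 'm tvec \<Rightarrow> 'v) \<Rightarrow>
   ('m \<Rightarrow> 'm tvec \<Rightarrow> 'm tvec \<Rightarrow> 'm tvec \<Rightarrow> real) \<Rightarrow>
   ('m \<Rightarrow> ('m, 'v) courant \<Rightarrow> ('m, 'v) courant) \<Rightarrow> bool" where
  "courant_integrable A G F br ip nabla R H J \<longleftrightarrow>
     (let \<Gamma>L = sub_sections (cx_sections (courant_sections A G F)) (holo_bundle A G J)
      in \<forall>u\<in>\<Gamma>L. \<forall>v\<in>\<Gamma>L. cx2_sec (dorfman A br ip nabla R H) u v \<in> \<Gamma>L)"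

definition L_bundle ::
  "('m, 'e::real_inner) atlas \<Rightarrow> ('m \<Rightarrow> 'v::real_vector set) \<Rightarrow> ('m \<Rightarrow> 'v \<Rightarrow> 'v \<Rightarrow> real) \<Rightarrow>
   ('m \<Rightarrow> 'm tvec cx set) \<Rightarrow> ('m \<Rightarrow> 'v cx set) \<Rightarrow> ('m \<Rightarrow> 'm tvec cx \<Rightarrow> 'v cx) \<Rightarrow>
   ('m \<Rightarrow> 'm tvec cx \<Rightarrow> 'm tvec cx \<Rightarrow> real cx) \<Rightarrow> 'm \<Rightarrow> ('m, 'v) courant cx set" where
  "L_bundle A G ip W D \<sigma> \<epsilon> x =
     {u \<in> courant_fibre A G x \<times> courant_fibre A G x.
        cx1 prT u \<in> W x \<and>
        (\<exists>r\<in>D x. cx1 prG u = \<sigma> x (cx1 prT u) + r \<and>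
           (\<forall>Y\<in>W x. cx2 (\<lambda>\<xi> v. \<xi> v) (cx1 prF u) Y =
              2 *\<^sub>R \<epsilon> x (cx1 prT u) Y - cx2 (ip x) (\<sigma> x Y) (\<sigma> x (cx1 prT u) + 2 *\<^sub>R r)))}"

section \<open>Exterior derivatives along \<open>W\<close>\<close>

definition d_sigma ::
  "('m \<Rightarrow> 'm tvec \<Rightarrow> ('m \<Rightarrow> 'v::real_vector) \<Rightarrow> 'v) \<Rightarrow> ('m \<Rightarrow> 'm tvec cx \<Rightarrow> 'v cx) \<Rightarrow>
   ('m \<Rightarrow> 'm tvec cx) \<Rightarrow> ('m \<Rightarrow> 'm tvec cx) \<Rightarrow> 'm \<Rightarrow> 'v cx" where
  "d_sigma nabla \<sigma> X Y = (\<lambda>x.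
     cx2_sec (cov nabla) X (\<lambda>y. \<sigma> y (Y y)) x - cx2_sec (cov nabla) Y (\<lambda>y. \<sigma> y (X y)) x
       - \<sigma> x (cx2_sec lie_bracket X Y x))"

definition d_epsilon ::
  "('m \<Rightarrow> 'm tvec cx \<Rightarrow> 'm tvec cx \<Rightarrow> real cx) \<Rightarrow>
   ('m \<Rightarrow> 'm tvec cx) \<Rightarrow> ('m \<Rightarrow> 'm tvec cx) \<Rightarrow> ('m \<Rightarrow> 'm tvec cx) \<Rightarrow> 'm \<Rightarrow> real cx" where
  "d_epsilon \<epsilon> X Y Z = (\<lambda>x.
     cx2_sec fderiv X (\<lambda>y. \<epsilon> y (Y y) (Z y)) x - cx2_sec fderiv Y (\<lambda>y. \<epsilon> y (X y) (Z y)) x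
       + cx2_sec fderiv Z (\<lambda>y. \<epsilon> y (X y) (Y y)) x
       - \<epsilon> x (cx2_sec lie_bracket X Y x) (Z x) + \<epsilon> x (cx2_sec lie_bracket X Z x) (Y x)
       - \<epsilon> x (cx2_sec lie_bracket Y Z x) (X x))"

definition wedge_ip ::
  "('m \<Rightarrow> 'v \<Rightarrow> 'v \<Rightarrow> real) \<Rightarrow> (('m \<Rightarrow> 'm tvec cx) \<Rightarrow> ('m \<Rightarrow> 'm tvec cx) \<Rightarrow> 'm \<Rightarrow> 'v cx) \<Rightarrow>
   ('m \<Rightarrow> 'm tvec cx \<Rightarrow> 'v cx) \<Rightarrow>
   ('m \<Rightarrow> 'm tvec cx) \<Rightarrow> ('m \<Rightarrow> 'm tvec cx) \<Rightarrow> ('m \<Rightarrow> 'm tvec cx) \<Rightarrow> 'm \<Rightarrow> real cx" where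
  "wedge_ip ip \<alpha> \<sigma> X Y Z = (\<lambda>x.
     cx2 (ip x) (\<alpha> X Y x) (\<sigma> x (Z x)) + cx2 (ip x) (\<alpha> Y Z x) (\<sigma> x (X x))
       + cx2 (ip x) (\<alpha> Z X x) (\<sigma> x (Y x)))"

end

theory Submission
  imports Defs
begin

text \<open>The bundle \<open>L\<close> is closed under the Dorfman bracket iff, for \<open>u, v \<in> \<Gamma>(L)\<close>, the three parts of
  \<open>[u, v]\<close> satisfy the equations that cut out \<open>L(W, D, \<sigma>, \<epsilon>)\<close>. Write \<open>u = X + \<xi> + \<sigma>(X) + r\<close> and
  \<open>v = Y + \<eta> + \<sigma>(Y) + s\<close>. The tangent part gives A; the \<open>G\<close>-part gives that
  \<open>C(X, Y) + (\<nabla> + ad \<sigma>)\<^bsub>X\<^esub> s - (\<nabla> + ad \<sigma>)\<^bsub>Y\<^esub> r + [r, s]\<close> lies in \<open>D\<close>, where \<open>C\<close> is the expression in D;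
  and the defect of the cotangent part, evaluated on \<open>Z \<in> \<Gamma>(W)\<close>, equals the left-hand side of E plus
  \<open>- 2\<langle>C(X, Z), s\<rangle> + 2\<langle>C(Y, Z), r\<rangle> + 2\<langle>(\<nabla> + ad \<sigma>)\<^bsub>Z\<^esub> r, s\<rangle>\<close>.

  To separate the conditions one needs sections of \<open>L\<close> with prescribed tangent part. Instead of
  localising, a section \<open>X\<close> of \<open>W\<close> is multiplied by a smooth function \<open>\<theta>\<close> with \<open>\<theta>(p) \<noteq> 0\<close> such that
  \<open>\<theta> X\<close> lifts to a global section of \<open>L\<close>; the constant rank of \<open>W\<close> enters here, through a division-free
  Gauss-Jordan elimination. All conditions are tensorial, so \<open>\<theta>\<close> can be cancelled at \<open>p\<close>.\<close>

section \<open>Smooth functions on inner product spaces\<close>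

text \<open>Integrability is tested on global sections only, so the proof needs a supply of global
  objects. Bump functions extend single tangent vectors, covectors and fibre elements, and
  \<open>a - \<i> J a\<close> turns sections of \<open>E\<close> into sections of \<open>L\<close>.
  But \<open>W\<close> and \<open>D\<close> are only the fibrewise image and kernel data of
  \<open>L\<close>, with no frames given, so a section of \<open>W\<close> has no evident lift; that
  is the obstacle behind the multiplier. The five conditions cannot be read off independently, since
  the \<open>G\<close>-part of one bracket mixes them. If both sections lie in the kernel of the
  projection to \<open>W\<close>, only \<open>[r, s]\<close> survives, which gives B; if one does, B
  isolates C; with B and C known, the \<open>G\<close>-part leaves D. E comes last: every other term
  of the cotangent defect is then a pairing of two elements of the isotropic \<open>D\<close>. The
  maximal isotropy contained in B is independent of integrability: \<open>L\<close> equals its own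
  orthogonal complement, and \<open>D\<close> inherits this through elements of \<open>L\<close>
  with zero tangent part.\<close>

lemma Ck_on_cong:
  assumes "open S" "\<And>x. x \<in> S \<Longrightarrow> f x = g x" "Ck_on k S f"
  shows "Ck_on k S g"
  using assms(2,3)
proof (induction k arbitrary: f g)
  case 0
  then show ?case using continuous_on_cong[of S S f g] by simp
next
  case (Suc k)
  have "g differentiable at x" if "x \<in> S" for x
    using Suc.prems that has_derivative_transform_within_open[OF _ assms(1) that]
    by (metis Ck_on.simps(2) differentiable_def)
  moreover have "frechet_derivative f (at x) v = frechet_derivative g (at x) v" if "x \<in> S" for x v
    using frechet_derivative_transform_within_open[of f x S g] Suc.prems that assms(1) by auto
  then have "Ck_on k S (\<lambda>x. frechet_derivative g (at x) v)" for v
    using Suc.IH[of "\<lambda>x. frechet_derivative f (at x) v" "\<lambda>x. frechet_derivative g (at x) v"] Suc.prems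
    by auto
  ultimately show ?case by simp
qed

lemma Ck_on_subset: "Ck_on k S f \<Longrightarrow> T \<subseteq> S \<Longrightarrow> Ck_on k T f"
  by (induction k arbitrary: f) (auto intro: continuous_on_subset)

text \<open>Each clause of \<open>Ck_on\<close> concerns a point and its neighbourhood; this is what
  lets smoothness be glued from open pieces.\<close>

lemma Ck_on_local:
  assumes "\<And>x. x \<in> S \<Longrightarrow> \<exists>T. open T \<and> x \<in> T \<and> Ck_on k T f"
  shows "Ck_on k S f"
  using assms
proof (induction k arbitrary: f)
  case 0
  then show ?case
    by (metis Ck_on.simps(1) continuous_at_imp_continuous_on continuous_on_eq_continuous_at)
next
  case (Suc k)
  have "f differentiable at x" if "x \<in> S" for x
    using Suc.prems[OF that] by auto
  moreover have "Ck_on k S (\<lambda>x. frechet_derivative f (at x) v)" for v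
  proof (rule Suc.IH)
    fix x assume "x \<in> S"
    then show "\<exists>T. open T \<and> x \<in> T \<and> Ck_on k T (\<lambda>x. frechet_derivative f (at x) v)"
      using Suc.prems[of x] by (metis Ck_on.simps(2))
  qed
  ultimately show ?case by simp
qed

lemma Ck_on_SucD: "Ck_on (Suc k) S f \<Longrightarrow> Ck_on k S f"
proof (induction k arbitrary: f)
  case 0
  then show ?case
    by (simp add: continuous_at_imp_continuous_on differentiable_imp_continuous_within)
next
  case (Suc k)
  then show ?case by (metis Ck_on.simps(2))
qed

lemma Ck_on_const [simp]: "Ck_on k S (\<lambda>x. c)"
  by (induction k arbitrary: c) auto

lemma Ck_on_linear: "bounded_linear f \<Longrightarrow> Ck_on k S f"
proof (cases k)
  case 0
  then show "bounded_linear f \<Longrightarrow> Ck_on k S f"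
    by (simp add: linear_continuous_on)
next
  case (Suc j)
  assume f: "bounded_linear f"
  then have "f differentiable at x" "frechet_derivative f (at x) = f" for x
    using bounded_linear_imp_has_derivative[OF f, of "at x"] frechet_derivative_at[of f f x]
    by (auto simp: differentiable_def)
  then show ?thesis using Suc by simp
qed

lemma Ck_on_linear_compose:
  assumes "bounded_linear h" "Ck_on k S g" "open S"
  shows "Ck_on k S (\<lambda>x. h (g x))"
  using assms(2)
proof (induction k arbitrary: g)
  case 0
  then show ?case
    using bounded_linear.continuous_on[OF assms(1)] by simp
next
  case (Suc k)
  have g: "(g has_derivative frechet_derivative g (at x)) (at x)" if "x \<in> S" for x
    using Suc.prems that by (simp add: frechet_derivative_works)
  have D: "((\<lambda>x. h (g x)) has_derivative (\<lambda>v. h (frechet_derivative g (at x) v))) (at x)"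
    if "x \<in> S" for x
    using bounded_linear.has_derivative[OF assms(1) g[OF that]] .
  have "Ck_on k S (\<lambda>x. frechet_derivative (\<lambda>x. h (g x)) (at x) v)" for v
    by (rule Ck_on_cong[OF assms(3) _ Suc.IH[of "\<lambda>x. frechet_derivative g (at x) v"]])
      (use Suc.prems in \<open>simp_all add: frechet_derivative_at[OF D, symmetric]\<close>)
  with D show ?case by (auto simp: differentiable_def)
qed

lemma Ck_on_add:
  assumes "open S" "Ck_on k S f" "Ck_on k S g"
  shows "Ck_on k S (\<lambda>x. f x + g x)"
  using assms(2,3)
proof (induction k arbitrary: f g)
  case 0
  then show ?case by (simp add: continuous_on_add continuous_on_mult)
next
  case (Suc k)
  have D: "((\<lambda>x. f x + g x) has_derivative
      (\<lambda>v. frechet_derivative f (at x) v + frechet_derivative g (at x) v)) (at x)"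
    if "x \<in> S" for x
    using Suc.prems that
    by (intro has_derivative_add) (simp_all add: frechet_derivative_works[symmetric])
  have "Ck_on k S (\<lambda>x. frechet_derivative (\<lambda>x. f x + g x) (at x) v)" for v
    by (rule Ck_on_cong[OF assms(1) _ Suc.IH[of "\<lambda>x. frechet_derivative f (at x) v"
            "\<lambda>x. frechet_derivative g (at x) v"]])
      (use Suc.prems in \<open>simp_all add: frechet_derivative_at[OF D, symmetric]\<close>)
  with D show ?case by (auto simp: differentiable_def)
qed

lemma Ck_on_mult:
  fixes f g :: "'a::real_normed_vector \<Rightarrow> real"
  assumes "open S" "Ck_on k S f" "Ck_on k S g"
  shows "Ck_on k S (\<lambda>x. f x * g x)"
  using assms(2,3)
proof (induction k arbitrary: f g)
  case 0
  then show ?case by (simp add: continuous_on_add continuous_on_mult)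
next
  case (Suc k)
  have D: "((\<lambda>x. f x * g x) has_derivative
      (\<lambda>v. f x * frechet_derivative g (at x) v + frechet_derivative f (at x) v * g x)) (at x)"
    if "x \<in> S" for x
    using Suc.prems that
    by (intro has_derivative_mult) (simp_all add: frechet_derivative_works[symmetric])
  \<comment> \<open>The product rule leaves one factor undifferentiated, and the induction
    hypothesis wants that factor at level \<open>k\<close>.\<close>
  have f: "Ck_on k S f" "Ck_on k S g" using Suc.prems Ck_on_SucD by blast+
  have df: "Ck_on k S (\<lambda>x. frechet_derivative f (at x) v)"
     "Ck_on k S (\<lambda>x. frechet_derivative g (at x) v)" for v
    using Suc.prems by auto
  have "Ck_on k S (\<lambda>x. frechet_derivative (\<lambda>x. f x * g x) (at x) v)" for v
    apply (rule Ck_on_cong[OF assms(1) _ Ck_on_add[OF assms(1) Suc.IH[OF f(1) df(2)[of v]] 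
            Suc.IH[OF df(1)[of v] f(2)]]])
    by (simp add: frechet_derivative_at[OF D, symmetric])
  with D show ?case by (auto simp: differentiable_def)
qed

lemma Ck_on_sum:
  assumes "open S" "finite I" "\<And>i. i \<in> I \<Longrightarrow> Ck_on k S (f i)"
  shows "Ck_on k S (\<lambda>x. \<Sum>i\<in>I. f i x)"
  using assms(2,3) by (induction I) (auto intro: Ck_on_add[OF assms(1)])

text \<open>The vectors are not normalised, whence the quotients by \<open>c \<bullet> c\<close>
  below. In dimension 0 the empty set qualifies.\<close>

definition orthogonal_basis :: "'a::real_inner set \<Rightarrow> bool" where
  "orthogonal_basis C \<longleftrightarrow> finite C \<and> 0 \<notin> C \<and> pairwise orthogonal C \<and> span C = UNIV"

lemma orthogonal_basis_exists:
  assumes "\<exists>B::'a::real_inner set. finite B \<and> span B = UNIV"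
  shows "\<exists>C::'a set. orthogonal_basis C"
proof -
  obtain B :: "'a set" where B: "finite B" "span B = UNIV" using assms by blast
  obtain C :: "'a set" where C: "finite C" "span C = UNIV" "pairwise orthogonal C"
    using basis_orthogonal[OF B(1)] B(2) by metis
  have "orthogonal_basis (C - {0})"
    using C span_delete_0[of C] by (auto simp: orthogonal_basis_def pairwise_def)
  then show ?thesis by blast
qed

lemma orthogonal_basis_expansion:
  assumes "orthogonal_basis C"
  shows "v = (\<Sum>c\<in>C. ((v \<bullet> c) / (c \<bullet> c)) *\<^sub>R c)"
proof -
  have C: "finite C" "0 \<notin> C" "pairwise orthogonal C" "v \<in> span C"
    using assms by (auto simp: orthogonal_basis_def)
  then obtain a where a: "v = (\<Sum>c\<in>C. a c *\<^sub>R c)" by (auto simp: span_finite[OF C(1)])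
  have "v \<bullet> c = a c * (c \<bullet> c)" if "c \<in> C" for c
  proof -
    have "v \<bullet> c = (\<Sum>d\<in>C. a d * (d \<bullet> c))" by (simp add: a inner_sum_left)
    also have "\<dots> = (\<Sum>d\<in>C. if d = c then a c * (c \<bullet> c) else 0)"
      using C(3) that by (intro sum.cong) (auto simp: pairwise_def orthogonal_def)
    finally show ?thesis using that C(1) by simp
  qed
  then have "a c = (v \<bullet> c) / (c \<bullet> c)" if "c \<in> C" for c
    using that C(2) by (metis inner_eq_zero_iff nonzero_mult_div_cancel_right)
  then have "(\<Sum>c\<in>C. a c *\<^sub>R c) = (\<Sum>c\<in>C. ((v \<bullet> c) / (c \<bullet> c)) *\<^sub>R c)"
    by (intro sum.cong) auto
  then show ?thesis using a by metis
qed

text \<open>The chain rule applies the derivative of \<open>f\<close> to a direction that varies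
  with \<open>x\<close>, while the induction hypothesis covers fixed directions only. Expanding the
  varying direction in \<open>C\<close> leaves finitely many fixed ones.\<close>

lemma Ck_on_compose:
  fixes f :: "'b::real_inner \<Rightarrow> real" and g :: "'a::real_normed_vector \<Rightarrow> 'b"
  assumes C: "orthogonal_basis (C::'b set)"
    and "open S" "open T" "g ` S \<subseteq> T" "Ck_on k T f" "Ck_on k S g"
  shows "Ck_on k S (\<lambda>x. f (g x))"
  using assms(5,6)
proof (induction k arbitrary: f)
  case 0
  then show ?case using assms(4) by (auto intro: continuous_on_compose2)
next
  case (Suc k)
  have gT: "g x \<in> T" if "x \<in> S" for x using assms(4) that by auto
  have f: "(f has_derivative frechet_derivative f (at (g x))) (at (g x))" if "x \<in> S" for x
    using Suc.prems gT[OF that] by (simp add: frechet_derivative_works)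
  have g: "(g has_derivative frechet_derivative g (at x)) (at x)" if "x \<in> S" for x
    using Suc.prems that by (simp add: frechet_derivative_works)
  have D: "((\<lambda>x. f (g x)) has_derivative
      (\<lambda>v. frechet_derivative f (at (g x)) (frechet_derivative g (at x) v))) (at x)" if "x \<in> S" for x
    using diff_chain_at[OF g[OF that] f[OF that]] by (simp add: o_def)
  have E: "frechet_derivative (\<lambda>x. f (g x)) (at x) v =
     (\<Sum>c\<in>C. ((frechet_derivative g (at x) v \<bullet> c) * (1 / (c \<bullet> c))) * frechet_derivative f (at (g x)) c)"
    if "x \<in> S" for x v
  proof -
    have lin: "linear (frechet_derivative f (at (g x)))"
      using f[OF that] has_derivative_linear by blast
    have "frechet_derivative (\<lambda>x. f (g x)) (at x) v
       = frechet_derivative f (at (g x)) (frechet_derivative g (at x) v)"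
      using frechet_derivative_at[OF D[OF that]] by metis
    also have "frechet_derivative g (at x) v
       = (\<Sum>c\<in>C. ((frechet_derivative g (at x) v \<bullet> c) / (c \<bullet> c)) *\<^sub>R c)"
      by (rule orthogonal_basis_expansion[OF C])
    finally show ?thesis using lin by (simp add: linear_sum linear_scale)
  qed
  have "Ck_on k S (\<lambda>x. frechet_derivative (\<lambda>x. f (g x)) (at x) v)" for v
  proof (rule Ck_on_cong[OF \<open>open S\<close> E[symmetric]], assumption, rule Ck_on_sum[OF \<open>open S\<close>])
    show "finite C" using C by (simp add: orthogonal_basis_def)
    fix c assume "c \<in> C"
    have "Ck_on k S (\<lambda>x. frechet_derivative g (at x) v \<bullet> c)"
      by (rule Ck_on_linear_compose[OF bounded_linear_inner_left _ \<open>open S\<close>]) (use Suc.prems in auto)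
    moreover have "Ck_on k S (\<lambda>x. frechet_derivative f (at (g x)) c)"
      using Suc.IH[of "\<lambda>y. frechet_derivative f (at y) c"] Suc.prems Ck_on_SucD by auto
    ultimately show "Ck_on k S (\<lambda>x. frechet_derivative g (at x) v \<bullet> c * (1 / (c \<bullet> c)) *
                frechet_derivative f (at (g x)) c)"
      by (intro Ck_on_mult \<open>open S\<close>) auto
  qed
  with D show ?case by (auto simp: differentiable_def)
qed

section \<open>Smooth functions and the symmetry of second derivatives\<close>

lemma smooth_onD: "smooth_on S f \<Longrightarrow> Ck_on k S f"
  by (simp add: smooth_on_def)

lemma smooth_on_differentiable: "smooth_on S f \<Longrightarrow> x \<in> S \<Longrightarrow> f differentiable at x"
  using smooth_onD[of S f "Suc 0"] by simp

lemma smooth_on_derivative: "smooth_on S f \<Longrightarrow> smooth_on S (\<lambda>x. frechet_derivative f (at x) v)"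
  by (metis Ck_on.simps(2) smooth_on_def)

lemma smooth_on_cong:
  "open S \<Longrightarrow> smooth_on S f \<Longrightarrow> (\<And>x. x \<in> S \<Longrightarrow> f x = g x) \<Longrightarrow> smooth_on S g"
  unfolding smooth_on_def using Ck_on_cong by blast

lemma smooth_on_compose:
  fixes f :: "'b::real_inner \<Rightarrow> real" and g :: "'a::real_normed_vector \<Rightarrow> 'b"
  assumes "orthogonal_basis (C::'b set)" "open S" "open T" "g ` S \<subseteq> T" "smooth_on T f" "smooth_on S g"
  shows "smooth_on S (\<lambda>x. f (g x))"
  using Ck_on_compose[OF assms(1-4)] assms(5,6) by (simp add: smooth_on_def)

text \<open>Applying the mean value theorem twice, in either order, writes the second difference
  of \<open>f\<close> over a small parallelogram as each of the two mixed derivatives at nearby points.\<close>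

lemma mixed_difference:
  fixes f :: "'a::real_inner \<Rightarrow> real"
  assumes "open S" "Ck_on 2 S f" "h > 0"
    and S: "\<And>s t. 0 \<le> s \<Longrightarrow> s \<le> h \<Longrightarrow> 0 \<le> t \<Longrightarrow> t \<le> h \<Longrightarrow> x + s *\<^sub>R c + t *\<^sub>R d \<in> S"
  obtains s t where "0 \<le> s" "s \<le> h" "0 \<le> t" "t \<le> h"
    "f (x + h *\<^sub>R c + h *\<^sub>R d) - f (x + h *\<^sub>R c) - f (x + h *\<^sub>R d) + f x =
       h * h * frechet_derivative (\<lambda>y. frechet_derivative f (at y) c) (at (x + s *\<^sub>R c + t *\<^sub>R d)) d"
proof -
  have f: "(f has_derivative frechet_derivative f (at y)) (at y)" if "y \<in> S" for y
    using assms(2) that by (simp add: numeral_2_eq_2 frechet_derivative_works[symmetric])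
  define fc where "fc = (\<lambda>y. frechet_derivative f (at y) c)"
  have fc: "(fc has_derivative frechet_derivative fc (at y)) (at y)" if "y \<in> S" for y
    using assms(2) that by (simp add: numeral_2_eq_2 frechet_derivative_works[symmetric] fc_def)
  have line: "((\<lambda>s. y + s *\<^sub>R e) has_derivative (\<lambda>s. s *\<^sub>R e)) (at s)" for y e :: 'a and s
    by (auto intro!: derivative_eq_intros)
  have Df: "((\<lambda>s. f (y + s *\<^sub>R e)) has_real_derivative frechet_derivative f (at (y + s *\<^sub>R e)) e) (at s)"
    if "y + s *\<^sub>R e \<in> S" for y e s
    using diff_chain_at[OF line f[OF that]] unfolding o_def
    by (rule has_derivative_imp_has_field_derivative)
      (simp add: linear_scale[OF has_derivative_linear[OF f[OF that]]])
  have Dfc: "((\<lambda>s. fc (y + s *\<^sub>R e)) has_real_derivative frechet_derivative fc (at (y + s *\<^sub>R e)) e) (at s)"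
    if "y + s *\<^sub>R e \<in> S" for y e s
    using diff_chain_at[OF line fc[OF that]] unfolding o_def
    by (rule has_derivative_imp_has_field_derivative)
      (simp add: linear_scale[OF has_derivative_linear[OF fc[OF that]]])
  define g where "g = (\<lambda>s. f ((x + h *\<^sub>R d) + s *\<^sub>R c) - f (x + s *\<^sub>R c))"
  have "\<exists>s>0. s < h \<and> g h - g 0 = (h - 0) * (fc ((x + h *\<^sub>R d) + s *\<^sub>R c) - fc (x + s *\<^sub>R c))"
  proof (rule MVT2[OF \<open>h > 0\<close>])
    fix s assume s: "0 \<le> s" "s \<le> h"
    have "x + h *\<^sub>R d + s *\<^sub>R c \<in> S" "x + s *\<^sub>R c \<in> S"
      using S[OF s, of h] S[OF s, of 0] \<open>h > 0\<close> by (simp_all add: add_ac)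
    then show "(g has_real_derivative fc (x + h *\<^sub>R d + s *\<^sub>R c) - fc (x + s *\<^sub>R c)) (at s)"
      unfolding g_def fc_def by (intro DERIV_diff Df)
  qed
  then obtain s where s: "0 < s" "s < h"
    and gs: "g h - g 0 = h * (fc ((x + h *\<^sub>R d) + s *\<^sub>R c) - fc (x + s *\<^sub>R c))" by auto
  have "\<exists>t>0. t < h \<and> fc ((x + s *\<^sub>R c) + h *\<^sub>R d) - fc ((x + s *\<^sub>R c) + 0 *\<^sub>R d)
      = (h - 0) * frechet_derivative fc (at ((x + s *\<^sub>R c) + t *\<^sub>R d)) d"
    by (rule MVT2[OF \<open>h > 0\<close>], rule Dfc) (use S[of s] s in auto)
  then obtain t where t: "0 < t" "t < h"
    "fc ((x + s *\<^sub>R c) + h *\<^sub>R d) - fc (x + s *\<^sub>R c) = h * frechet_derivative fc (at ((x + s *\<^sub>R c) + t *\<^sub>R d)) d"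
    by auto
  show thesis
    by (rule that[of s t]) (use s t gs in \<open>simp_all add: g_def fc_def add_ac\<close>)
qed

text \<open>The second difference over one small parallelogram equals \<open>h * h\<close> times
  either mixed derivative at a point near \<open>x\<close>. By continuity both are close to their
  values at \<open>x\<close>, so these differ by less than any \<open>e\<close>.\<close>

lemma second_derivative_symmetric:
  fixes f :: "'a::real_inner \<Rightarrow> real"
  assumes "open S" "Ck_on 2 S f" "x \<in> S"
  shows "frechet_derivative (\<lambda>y. frechet_derivative f (at y) c) (at x) d
       = frechet_derivative (\<lambda>y. frechet_derivative f (at y) d) (at x) c"
proof -
  define P where "P = (\<lambda>x. frechet_derivative (\<lambda>y. frechet_derivative f (at y) c) (at x) d)"
  define Q where "Q = (\<lambda>x. frechet_derivative (\<lambda>y. frechet_derivative f (at y) d) (at x) c)"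
  have cont: "continuous_on S P" "continuous_on S Q"
    using assms(2) by (auto simp: P_def Q_def numeral_2_eq_2)
  obtain r where r: "r > 0" "ball x r \<subseteq> S" using assms(1,3) openE by blast
  have "\<bar>P x - Q x\<bar> \<le> 0 + e" if "e > 0" for e
  proof -
    have "isCont P x" "isCont Q x"
      using cont assms(1,3) by (auto simp: continuous_on_eq_continuous_at)
    then obtain u v where uv: "u > 0" "v > 0" "\<And>y. dist y x < u \<Longrightarrow> dist (P y) (P x) < e/2"
      "\<And>y. dist y x < v \<Longrightarrow> dist (Q y) (Q x) < e/2"
      unfolding continuous_at_eps_delta using \<open>e > 0\<close> by (metis half_gt_zero)
    define m where "m = min r (min u v)"
    \<comment> \<open>The summand 1 keeps the denominator positive when \<open>c\<close> and
      \<open>d\<close> both vanish. Every point of the parallelogram is then within \<open>m\<close>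
      of \<open>x\<close>.\<close>
    define h where "h = m / (2 * (1 + norm c + norm d))"
    have m: "m > 0" "m \<le> r" "m \<le> u" "m \<le> v" using r uv by (auto simp: m_def)
    have n: "1 + norm c + norm d > 0" by (simp add: add_pos_nonneg)
    then have h: "h > 0" using m by (simp add: h_def)
    have near: "dist (x + s *\<^sub>R c + t *\<^sub>R d) x < m" if "0 \<le> s" "s \<le> h" "0 \<le> t" "t \<le> h" for s t
    proof -
      have "dist (x + s *\<^sub>R c + t *\<^sub>R d) x = norm (s *\<^sub>R c + t *\<^sub>R d)" by (simp add: dist_norm add.assoc)
      also have "\<dots> \<le> s * norm c + t * norm d"
        using that norm_triangle_ineq[of "s *\<^sub>R c" "t *\<^sub>R d"] by simp
      also have "\<dots> \<le> h * norm c + h * norm d"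
        using that by (intro add_mono mult_right_mono) auto
      also have "\<dots> < h * (2 * (1 + norm c + norm d))"
      proof -
        have "0 \<le> h * norm c" "0 \<le> h * norm d" using h by simp_all
        moreover have "h * (2 * (1 + norm c + norm d)) = 2 * h + 2 * (h * norm c) + 2 * (h * norm d)"
          by (simp add: algebra_simps)
        ultimately show ?thesis using h by linarith
      qed
      also have "\<dots> = m" using n by (simp add: h_def)
      finally show ?thesis .
    qed
    have inS: "x + s *\<^sub>R c + t *\<^sub>R d \<in> S" if "0 \<le> s" "s \<le> h" "0 \<le> t" "t \<le> h" for s t
      using near[OF that] m(2) r(2) by (auto simp: dist_commute subset_eq)
    have inS': "x + t *\<^sub>R d + s *\<^sub>R c \<in> S" if "0 \<le> t" "t \<le> h" "0 \<le> s" "s \<le> h" for s t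
      using inS[OF that(3,4,1,2)] by (simp add: add_ac)
    obtain s t where st: "0 \<le> s" "s \<le> h" "0 \<le> t" "t \<le> h"
      "f (x + h *\<^sub>R c + h *\<^sub>R d) - f (x + h *\<^sub>R c) - f (x + h *\<^sub>R d) + f x = h * h * P (x + s *\<^sub>R c + t *\<^sub>R d)"
      unfolding P_def by (rule mixed_difference[OF assms(1,2) h inS])
    obtain t' s' where st': "0 \<le> s'" "s' \<le> h" "0 \<le> t'" "t' \<le> h"
      "f (x + h *\<^sub>R d + h *\<^sub>R c) - f (x + h *\<^sub>R d) - f (x + h *\<^sub>R c) + f x = h * h * Q (x + t' *\<^sub>R d + s' *\<^sub>R c)"
      unfolding Q_def by (rule mixed_difference[OF assms(1,2) h inS'])
    have "h * h * P (x + s *\<^sub>R c + t *\<^sub>R d) = h * h * Q (x + s' *\<^sub>R c + t' *\<^sub>R d)"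
      using st(5) st'(5) by (simp add: algebra_simps)
    then have "P (x + s *\<^sub>R c + t *\<^sub>R d) = Q (x + s' *\<^sub>R c + t' *\<^sub>R d)" using h by simp
    moreover have "dist (P (x + s *\<^sub>R c + t *\<^sub>R d)) (P x) < e/2"
      using near[OF st(1-4)] m(3) uv(3) by simp
    moreover have "dist (Q (x + s' *\<^sub>R c + t' *\<^sub>R d)) (Q x) < e/2"
      using near[OF st'(1-4)] m(4) uv(4) by simp
    ultimately show ?thesis unfolding dist_real_def by linarith
  qed
  then show ?thesis using field_le_epsilon[of "\<bar>P x - Q x\<bar>" 0] by (simp add: P_def Q_def)
qed

text \<open>The type class alone does not make balls compact; the finite orthogonal basis does. A
  box of coefficients is a finite sum of compact segments, and the ball is a closed subset of such a
  box by the Cauchy-Schwarz inequality.\<close>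

lemma compact_cball_inner:
  fixes C :: "'a::real_inner set"
  assumes C: "orthogonal_basis C"
  shows "compact (cball (x::'a) r)"
proof -
  have comp: "compact {\<Sum>c\<in>I. a c *\<^sub>R c | a. \<forall>c\<in>I. \<bar>a c\<bar> \<le> m c}" if "finite I" for I :: "'a set" and m
    using that
  proof (induction I)
    case empty
    then show ?case by simp
  next
    case (insert d I)
    have "compact ((\<lambda>t. t *\<^sub>R d) ` {-m d..m d})"
      by (intro compact_continuous_image continuous_intros) auto
    then have "compact {y + z | y z. y \<in> (\<lambda>t. t *\<^sub>R d) ` {-m d..m d} \<and>
        z \<in> {\<Sum>c\<in>I. a c *\<^sub>R c | a. \<forall>c\<in>I. \<bar>a c\<bar> \<le> m c}}"
      using insert.IH by (rule compact_sums)
    also have "{y + z | y z. y \<in> (\<lambda>t. t *\<^sub>R d) ` {-m d..m d} \<and>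
        z \<in> {\<Sum>c\<in>I. a c *\<^sub>R c | a. \<forall>c\<in>I. \<bar>a c\<bar> \<le> m c}}
      = {\<Sum>c\<in>insert d I. a c *\<^sub>R c | a. \<forall>c\<in>insert d I. \<bar>a c\<bar> \<le> m c}" (is "?A = ?B")
    proof
      show "?A \<subseteq> ?B"
      proof
        fix w assume "w \<in> ?A"
        then obtain t a where t: "t \<in> {-m d..m d}" and a: "\<forall>c\<in>I. \<bar>a c\<bar> \<le> m c"
          and w: "w = t *\<^sub>R d + (\<Sum>c\<in>I. a c *\<^sub>R c)" by blast
        have "(\<Sum>c\<in>I. a c *\<^sub>R c) = (\<Sum>c\<in>I. (a(d := t)) c *\<^sub>R c)"
          using insert.hyps(2) by (intro sum.cong) auto
        then have "w = (\<Sum>c\<in>insert d I. (a(d := t)) c *\<^sub>R c)"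
          using insert.hyps w by simp
        moreover have "\<forall>c\<in>insert d I. \<bar>(a(d := t)) c\<bar> \<le> m c" using t a by auto
        ultimately show "w \<in> ?B" by blast
      qed
      show "?B \<subseteq> ?A"
      proof
        fix w assume "w \<in> ?B"
        then obtain a where a: "\<forall>c\<in>insert d I. \<bar>a c\<bar> \<le> m c" and w: "w = (\<Sum>c\<in>insert d I. a c *\<^sub>R c)"
          by blast
        have "w = a d *\<^sub>R d + (\<Sum>c\<in>I. a c *\<^sub>R c)" using insert.hyps w by simp
        moreover have "a d *\<^sub>R d \<in> (\<lambda>t. t *\<^sub>R d) ` {-m d..m d}" using a by (auto simp: abs_le_iff)
        moreover have "(\<Sum>c\<in>I. a c *\<^sub>R c) \<in> {\<Sum>c\<in>I. a c *\<^sub>R c | a. \<forall>c\<in>I. \<bar>a c\<bar> \<le> m c}"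
          using a by blast
        ultimately show "w \<in> ?A" by blast
      qed
    qed
    finally show ?case .
  qed
  have "cball 0 r \<subseteq> {\<Sum>c\<in>C. a c *\<^sub>R c | a. \<forall>c\<in>C. \<bar>a c\<bar> \<le> \<bar>r\<bar> / norm c}"
  proof
    fix v :: 'a assume v: "v \<in> cball 0 r"
    have "\<bar>v \<bullet> c / (c \<bullet> c)\<bar> \<le> \<bar>r\<bar> / norm c" if "c \<in> C" for c
    proof -
      have "c \<noteq> 0" using that C by (auto simp: orthogonal_basis_def)
      have "\<bar>v \<bullet> c\<bar> \<le> norm v * norm c" by (rule Cauchy_Schwarz_ineq2)
      also have "\<dots> \<le> \<bar>r\<bar> * norm c" using v by (intro mult_right_mono) auto
      finally have "\<bar>v \<bullet> c\<bar> / (norm c * norm c) \<le> \<bar>r\<bar> * norm c / (norm c * norm c)"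
        by (intro divide_right_mono) auto
      then show ?thesis using \<open>c \<noteq> 0\<close>
        by (simp add: abs_divide power2_norm_eq_inner[symmetric] power2_eq_square)
    qed
    then show "v \<in> {\<Sum>c\<in>C. a c *\<^sub>R c | a. \<forall>c\<in>C. \<bar>a c\<bar> \<le> \<bar>r\<bar> / norm c}"
      using orthogonal_basis_expansion[OF C, of v]
      by (intro CollectI exI[of _ "\<lambda>c. v \<bullet> c / (c \<bullet> c)"]) auto
  qed
  then have "compact (cball (0::'a) r)"
    using comp[of C "\<lambda>c. \<bar>r\<bar> / norm c"] C closed_cball
    by (metis (no_types, lifting) compact_Int_closed inf.absorb_iff2 orthogonal_basis_def)
  then have "compact ((+) x ` cball 0 r)" by (rule compact_translation)
  then show ?thesis by (simp add: cball_translation[symmetric] image_add_cball)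
qed

lemma smooth_on_subset: "smooth_on S f \<Longrightarrow> T \<subseteq> S \<Longrightarrow> smooth_on T f"
  unfolding smooth_on_def by (rule allI, rule Ck_on_subset[of _ S f T]) auto

lemma smooth_on_add: "open S \<Longrightarrow> smooth_on S f \<Longrightarrow> smooth_on S g \<Longrightarrow> smooth_on S (\<lambda>x. f x + g x)"
  by (simp add: smooth_on_def Ck_on_add)

lemma smooth_on_mult:
  fixes f g :: "'a::real_normed_vector \<Rightarrow> real"
  shows "open S \<Longrightarrow> smooth_on S f \<Longrightarrow> smooth_on S g \<Longrightarrow> smooth_on S (\<lambda>x. f x * g x)"
  by (simp add: smooth_on_def Ck_on_mult)

subsection \<open>Bump functions\<close>

text \<open>The polynomial in \<open>1 / t\<close> is carried as a parameter so that the family is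
  closed under differentiation; \<open>flat 1\<close> is the classical function
  \<open>exp (- 1 / t)\<close> extended by 0.\<close>

definition flat :: "real poly \<Rightarrow> real \<Rightarrow> real" where
  "flat p t = (if t > 0 then poly p (1 / t) * exp (- (1 / t)) else 0)"

lemma poly_exp_tendsto_0: "((\<lambda>s::real. poly p s * exp (- s)) \<longlongrightarrow> 0) at_top"
proof -
  have "((\<lambda>s. \<Sum>i\<le>degree p. coeff p i * (s ^ i / exp s)) \<longlongrightarrow> (\<Sum>i\<le>degree p. coeff p i * 0)) at_top"
    by (intro tendsto_sum tendsto_mult tendsto_const tendsto_power_div_exp_0)
  then show ?thesis
    by (simp add: poly_altdef sum_distrib_right exp_minus divide_inverse mult.assoc)
qed

lemma flat_tendsto_0: "(flat p \<longlongrightarrow> 0) (at 0)"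
proof -
  have "((\<lambda>t. poly p (inverse t) * exp (- inverse t)) \<longlongrightarrow> 0) (at_right 0)"
    using filterlim_compose[OF poly_exp_tendsto_0 filterlim_inverse_at_top_right] .
  then have "(flat p \<longlongrightarrow> 0) (at_right 0)"
    by (rule Lim_transform_eventually)
      (auto simp: flat_def eventually_at_filter inverse_eq_divide)
  moreover have "(flat p \<longlongrightarrow> 0) (at_left 0)"
    by (rule Lim_transform_eventually[OF tendsto_const])
      (auto simp: flat_def eventually_at_filter)
  ultimately show ?thesis by (simp add: filterlim_at_split)
qed

text \<open>With \<open>s = 1 / t\<close> one has \<open>ds/dt = - s * s\<close>, and
  differentiating \<open>p(s) exp (- s)\<close> gives \<open>s * s * (p - p')(s) exp (- s)\<close>;
  the factor \<open>[:0, 0, 1:]\<close> is this \<open>s * s\<close>.\<close>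

lemma flat_derivative:
  "(flat p has_real_derivative flat ([:0, 0, 1:] * (p - pderiv p)) t) (at t)"
proof (cases t "0::real" rule: linorder_cases)
  case less
  have "((\<lambda>t. 0) has_real_derivative 0) (at t)" by simp
  then have "(flat p has_real_derivative 0) (at t)"
    by (rule has_field_derivative_transform_within_open[of _ _ _ "{..<0}"])
      (use less in \<open>auto simp: flat_def\<close>)
  then show ?thesis using less by (simp add: flat_def)
next
  case equal
  \<comment> \<open>Dividing by \<open>h\<close> turns \<open>p\<close> into
    \<open>[:0, 1:] * p\<close>, so the difference quotient at 0 is itself a \<open>flat\<close>
    function.\<close>
  have "((\<lambda>h. flat ([:0, 1:] * p) h) \<longlongrightarrow> 0) (at 0)" by (rule flat_tendsto_0)
  then have "((\<lambda>h. (flat p (0 + h) - flat p 0) / h) \<longlongrightarrow> 0) (at 0)"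
    by (rule Lim_transform_eventually)
      (auto simp: flat_def eventually_at_filter)
  then show ?thesis using equal by (simp add: DERIV_def flat_def)
next
  case greater
  have "((\<lambda>t. poly p (1 / t) * exp (- (1 / t))) has_real_derivative
      poly ([:0, 0, 1:] * (p - pderiv p)) (1 / t) * exp (- (1 / t))) (at t)"
    using greater
    by (auto intro!: derivative_eq_intros DERIV_chain'[OF _ poly_DERIV] simp: field_simps power2_eq_square)
  then have "(flat p has_real_derivative
      poly ([:0, 0, 1:] * (p - pderiv p)) (1 / t) * exp (- (1 / t))) (at t)"
    by (rule has_field_derivative_transform_within_open[of _ _ _ "{0<..}"])
      (use greater in \<open>auto simp: flat_def\<close>)
  then show ?thesis using greater by (simp add: flat_def)
qed

lemma smooth_flat: "smooth_on UNIV (flat p)"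
proof -
  have "Ck_on k UNIV (flat p)" for k
  proof (induction k arbitrary: p)
    case 0
    then show ?case
      by (auto intro!: continuous_at_imp_continuous_on DERIV_isCont[OF flat_derivative])
  next
    case (Suc k)
    have D: "(flat p has_derivative (\<lambda>v. flat ([:0, 0, 1:] * (p - pderiv p)) t * v)) (at t)" for t
      using flat_derivative[of p t] by (simp only: has_field_derivative_def)
    show ?case
      using D Ck_on_mult[OF open_UNIV Suc Ck_on_const]
      by (auto simp: differentiable_def frechet_derivative_at[OF D, symmetric] simp del: mult_pCons_left)
  qed
  then show ?thesis by (simp add: smooth_on_def)
qed

lemma smooth_bump:
  fixes x0 :: "'a::real_inner"
  assumes "r > 0"
  obtains h :: "'a \<Rightarrow> real" where "smooth_on UNIV h" "h x0 \<noteq> 0" "\<And>x. x \<notin> cball x0 r \<Longrightarrow> h x = 0"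
proof
  \<comment> \<open>The squared distance is polynomial in \<open>x\<close>, hence smooth at the
    centre too, and \<open>flat 1\<close> vanishes exactly where \<open>q\<close> is not
    positive.\<close>
  define q where "q = (\<lambda>x::'a. r\<^sup>2 - (x - x0) \<bullet> (x - x0))"
  have D: "(q has_derivative (\<lambda>v. - 2 * ((x - x0) \<bullet> v))) (at x)" for x
    unfolding q_def by (auto intro!: derivative_eq_intros simp: inner_commute)
  have "Ck_on k UNIV q" for k
  proof (cases k)
    case 0
    then show ?thesis by (auto simp: q_def intro!: continuous_intros)
  next
    case (Suc j)
    have "Ck_on j UNIV (\<lambda>x. (-2 * (x \<bullet> v)) + 2 * (x0 \<bullet> v))" for v :: 'a
      by (intro Ck_on_add open_UNIV Ck_on_const Ck_on_linear bounded_linear_const_mult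
            bounded_linear_inner_left)
    then have "Ck_on j UNIV (\<lambda>x. - 2 * ((x - x0) \<bullet> v))" for v :: 'a
      by (simp add: inner_diff_left algebra_simps)
    then show ?thesis using Suc D by (auto simp: differentiable_def frechet_derivative_at[OF D, symmetric])
  qed
  then have q: "smooth_on UNIV q" by (simp add: smooth_on_def)
  have 1: "orthogonal_basis {1::real}"
    by (auto simp: orthogonal_basis_def span_singleton surj_def)
  show "smooth_on UNIV (\<lambda>x. flat 1 (q x))"
    by (rule smooth_on_compose[OF 1 _ _ _ smooth_flat q]) auto
  show "flat 1 (q x0) \<noteq> 0" using assms by (simp add: q_def flat_def)
  fix x assume "x \<notin> cball x0 r"
  then have "r < norm (x - x0)" by (simp add: dist_norm norm_minus_commute)
  then have "r\<^sup>2 \<le> (norm (x - x0))\<^sup>2" using assms by (intro power_mono) auto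
  then show "flat 1 (q x) = 0" by (simp add: q_def flat_def power2_norm_eq_inner)
qed

section \<open>Calculus on manifolds\<close>

context smooth_manifold
begin

lemma basis: obtains C :: "'e set" where "orthogonal_basis C"
  using orthogonal_basis_exists[OF finite_dimensional] by blast

lemma chart_open: "(U, \<phi>) \<in> A \<Longrightarrow> open S \<Longrightarrow> open (\<phi> ` (U \<inter> S))"
  using charts[of U \<phi>] homeomorphism_imp_open_map[of U "\<phi> ` U" \<phi> "inv_into U \<phi>" "U \<inter> S"]
  by (metis inf.cobounded1 openin_open_eq openin_open_Int)

lemma chart_domain: "(U, \<phi>) \<in> A \<Longrightarrow> open U"
  using charts by blast

lemma chart_inv [simp]: "(U, \<phi>) \<in> A \<Longrightarrow> x \<in> U \<Longrightarrow> inv_into U \<phi> (\<phi> x) = x"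
  using charts[of U \<phi>] by (auto simp: homeomorphism_def)

lemma chart_at: obtains U \<phi> where "(U, \<phi>) \<in> A" "x \<in> U"
proof -
  have "x \<in> (\<Union>(U, \<phi>)\<in>A. U)" using charts_cover by simp
  then show thesis using that by (auto split: prod.splits)
qed

lemma smooth_fun_onD: "smooth_fun_on A S f \<Longrightarrow> (U, \<phi>) \<in> A \<Longrightarrow> smooth_on (\<phi> ` (U \<inter> S)) (f \<circ> inv_into U \<phi>)"
  by (auto simp: smooth_fun_on_def)

lemma smooth_fun_onI:
  "(\<And>U \<phi>. (U, \<phi>) \<in> A \<Longrightarrow> smooth_on (\<phi> ` (U \<inter> S)) (f \<circ> inv_into U \<phi>)) \<Longrightarrow> smooth_fun_on A S f"
  unfolding smooth_fun_on_def by auto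

lemma smooth_fun_on_cong:
  assumes "smooth_fun_on A S f" "open S" "\<And>x. x \<in> S \<Longrightarrow> f x = g x"
  shows "smooth_fun_on A S g"
proof (rule smooth_fun_onI)
  fix U \<phi> assume U: "(U, \<phi>) \<in> A"
  show "smooth_on (\<phi> ` (U \<inter> S)) (g \<circ> inv_into U \<phi>)"
    by (rule smooth_on_cong[OF chart_open[OF U assms(2)] smooth_fun_onD[OF assms(1) U]])
      (use U assms(3) in auto)
qed

lemma smooth_fun_on_subset: "smooth_fun_on A S f \<Longrightarrow> T \<subseteq> S \<Longrightarrow> smooth_fun_on A T f"
  by (rule smooth_fun_onI, rule smooth_on_subset[OF smooth_fun_onD]) auto

lemma smooth_fun_on_local:
  assumes "\<And>x. x \<in> S \<Longrightarrow> \<exists>T. open T \<and> x \<in> T \<and> smooth_fun_on A T f"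
  shows "smooth_fun_on A S f"
proof (rule smooth_fun_onI, unfold smooth_on_def, intro allI Ck_on_local)
  fix U \<phi> k y assume U: "(U, \<phi>) \<in> A" "y \<in> \<phi> ` (U \<inter> S)"
  then obtain x where x: "x \<in> U" "x \<in> S" "y = \<phi> x" by blast
  obtain T where T: "open T" "x \<in> T" "smooth_fun_on A T f" using assms x by blast
  then show "\<exists>V. open V \<and> y \<in> V \<and> Ck_on k V (f \<circ> inv_into U \<phi>)"
    using chart_open[OF U(1) T(1)] x smooth_fun_onD[OF T(3) U(1)]
    by (intro exI[of _ "\<phi> ` (U \<inter> T)"]) (auto simp: smooth_on_def)
qed

lemma smooth_fun_on_const [simp]: "smooth_fun_on A S (\<lambda>x. c)"
  by (auto intro!: smooth_fun_onI simp: smooth_on_def o_def)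

lemma smooth_fun_on_add:
  assumes "open S" "smooth_fun_on A S f" "smooth_fun_on A S g"
  shows "smooth_fun_on A S (\<lambda>x. f x + g x)"
proof (rule smooth_fun_onI)
  fix U \<phi> assume U: "(U, \<phi>) \<in> A"
  show "smooth_on (\<phi> ` (U \<inter> S)) ((\<lambda>x. f x + g x) \<circ> inv_into U \<phi>)"
    using smooth_on_add[OF chart_open[OF U assms(1)] smooth_fun_onD[OF assms(2) U] smooth_fun_onD[OF assms(3) U]]
    by (simp add: o_def)
qed

lemma smooth_fun_on_mult:
  assumes "open S" "smooth_fun_on A S f" "smooth_fun_on A S g"
  shows "smooth_fun_on A S (\<lambda>x. f x * g x)"
proof (rule smooth_fun_onI)
  fix U \<phi> assume U: "(U, \<phi>) \<in> A"
  show "smooth_on (\<phi> ` (U \<inter> S)) ((\<lambda>x. f x * g x) \<circ> inv_into U \<phi>)"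
    using smooth_on_mult[OF chart_open[OF U assms(1)] smooth_fun_onD[OF assms(2) U] smooth_fun_onD[OF assms(3) U]]
    by (simp add: o_def)
qed

lemma smooth_fun_on_sum:
  assumes "open S" "finite I" "\<And>i. i \<in> I \<Longrightarrow> smooth_fun_on A S (f i)"
  shows "smooth_fun_on A S (\<lambda>x. \<Sum>i\<in>I. f i x)"
  using assms(2,3) by (induction I) (auto intro: smooth_fun_on_add[OF assms(1)])

lemma smooth_funs_on: "f \<in> smooth_funs A \<Longrightarrow> smooth_fun_on A S f"
  using smooth_fun_on_subset[of UNIV f S] by (simp add: smooth_funs_def)

text \<open>One chart suffices, because the smooth transition maps carry the representation to every
  other chart through the chain rule.\<close>

lemma smooth_fun_on_chart:
  assumes U: "(U, \<phi>) \<in> A" and S: "open S" "S \<subseteq> U" and f: "smooth_on (\<phi> ` S) (f \<circ> inv_into U \<phi>)"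
  shows "smooth_fun_on A S f"
proof (rule smooth_fun_onI)
  fix V \<psi> assume V: "(V, \<psi>) \<in> A"
  obtain C :: "'e set" where C: "orthogonal_basis C" by (rule basis)
  have VU: "V \<inter> S \<subseteq> V \<inter> U" and US: "U \<inter> S = S" using S by auto
  have "smooth_on (\<psi> ` (V \<inter> S)) (\<phi> \<circ> inv_into V \<psi>)"
    by (rule smooth_on_subset[OF charts_compatible[OF V U] image_mono[OF VU]])
  then have "smooth_on (\<psi> ` (V \<inter> S)) (\<lambda>y. (f \<circ> inv_into U \<phi>) ((\<phi> \<circ> inv_into V \<psi>) y))"
    using chart_open[OF U S(1)] US
    by (intro smooth_on_compose[OF C chart_open[OF V S(1)] _ _ f]) (use V in \<open>auto simp: o_def\<close>)
  then show "smooth_on (\<psi> ` (V \<inter> S)) (f \<circ> inv_into V \<psi>)"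
    by (rule smooth_on_cong[OF chart_open[OF V S(1)]]) (use V U S in auto)
qed

lemma smooth_funs_extend:
  assumes "smooth_fun_on A S f" "open S" "closed K" "K \<subseteq> S" "\<And>x. x \<notin> K \<Longrightarrow> f x = 0"
  shows "f \<in> smooth_funs A"
proof -
  have "smooth_fun_on A (- K) f"
    by (rule smooth_fun_on_cong[OF smooth_fun_on_const[of _ 0]]) (use assms in auto)
  then have "smooth_fun_on A UNIV f"
    using assms by (intro smooth_fun_on_local) (metis Compl_iff open_Compl subsetD)
  then show ?thesis by (simp add: smooth_funs_def)
qed

text \<open>The support has to be closed in the manifold and not merely in the chart domain. It is
  the image of a compact ball, and compact subsets of a Hausdorff space are closed; extension by 0
  is then smooth.\<close>

lemma bump_function:
  assumes "open S" "p \<in> S"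
  obtains \<beta> K where "\<beta> \<in> smooth_funs A" "closed K" "K \<subseteq> S" "\<beta> p \<noteq> 0" "\<And>x. x \<notin> K \<Longrightarrow> \<beta> x = 0"
proof -
  obtain U \<phi> where U: "(U, \<phi>) \<in> A" "p \<in> U" by (rule chart_at)
  obtain C :: "'e set" where C: "orthogonal_basis C" by (rule basis)
  have "open (\<phi> ` (U \<inter> S))" "\<phi> p \<in> \<phi> ` (U \<inter> S)" using chart_open[OF U(1) assms(1)] U assms by auto
  then obtain r where r: "r > 0" "cball (\<phi> p) r \<subseteq> \<phi> ` (U \<inter> S)" by (meson open_contains_cball)
  obtain h :: "'e \<Rightarrow> real" where h: "smooth_on UNIV h" "h (\<phi> p) \<noteq> 0" "\<And>x. x \<notin> cball (\<phi> p) r \<Longrightarrow> h x = 0"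
    using smooth_bump[OF r(1), of "\<phi> p"] by blast
  define K where "K = inv_into U \<phi> ` cball (\<phi> p) r"
  define \<beta> where "\<beta> = (\<lambda>x. if x \<in> U then h (\<phi> x) else 0)"
  have "continuous_on (cball (\<phi> p) r) (inv_into U \<phi>)"
    using charts[OF U(1)] r(2) by (auto simp: homeomorphism_def intro: continuous_on_subset)
  then have "closed K"
    unfolding K_def by (intro compact_imp_closed compact_continuous_image compact_cball_inner[OF C])
  moreover have K: "K \<subseteq> U \<inter> S"
  proof
    fix x assume "x \<in> K"
    then obtain y where "y \<in> U \<inter> S" "x = inv_into U \<phi> (\<phi> y)" using r(2) unfolding K_def by blast
    then show "x \<in> U \<inter> S" using U(1) by simp
  qed
  moreover have zero: "\<beta> x = 0" if "x \<notin> K" for x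
  proof (cases "x \<in> U")
    case True
    then have "\<phi> x \<notin> cball (\<phi> p) r" using that U(1) by (metis K_def chart_inv image_eqI)
    then show ?thesis using h(3) by (simp add: \<beta>_def)
  qed (simp add: \<beta>_def)
  moreover have "smooth_on (\<phi> ` U) (\<beta> \<circ> inv_into U \<phi>)"
  proof (rule smooth_on_cong[of _ h])
    show "open (\<phi> ` U)" using charts[OF U(1)] by blast
    show "smooth_on (\<phi> ` U) h" by (rule smooth_on_subset[OF h(1)]) simp
  qed (use U(1) in \<open>auto simp: \<beta>_def\<close>)
  then have "smooth_fun_on A U \<beta>"
    using smooth_fun_on_chart[OF U(1) chart_domain[OF U(1)]] by auto
  then have "\<beta> \<in> smooth_funs A"
    using smooth_funs_extend[of U \<beta> K] chart_domain[OF U(1)] K zero \<open>closed K\<close> by auto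
  moreover have "\<beta> p \<noteq> 0" using h U by (simp add: \<beta>_def)
  ultimately show thesis using that by blast
qed

lemma smooth_funs_const [simp]: "(\<lambda>x. c) \<in> smooth_funs A"
  by (simp add: smooth_funs_def)

lemma smooth_funs_add: "f \<in> smooth_funs A \<Longrightarrow> g \<in> smooth_funs A \<Longrightarrow> (\<lambda>x. f x + g x) \<in> smooth_funs A"
  by (simp add: smooth_funs_def smooth_fun_on_add)

lemma smooth_funs_mult: "f \<in> smooth_funs A \<Longrightarrow> g \<in> smooth_funs A \<Longrightarrow> (\<lambda>x. f x * g x) \<in> smooth_funs A"
  by (simp add: smooth_funs_def smooth_fun_on_mult)

lemma smooth_funs_uminus: "f \<in> smooth_funs A \<Longrightarrow> (\<lambda>x. - f x) \<in> smooth_funs A"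
  using smooth_funs_mult[of "\<lambda>x. -1" f] by simp

lemma smooth_funs_diff: "f \<in> smooth_funs A \<Longrightarrow> g \<in> smooth_funs A \<Longrightarrow> (\<lambda>x. f x - g x) \<in> smooth_funs A"
  using smooth_funs_add[of f "\<lambda>x. - g x"] smooth_funs_uminus[of g] by simp

lemmas smooth_funs_intros = smooth_funs_const smooth_funs_add smooth_funs_mult smooth_funs_uminus
  smooth_funs_diff

lemma chart_differentiable:
  assumes "f \<in> smooth_funs A" "(U, \<phi>) \<in> A" "x \<in> U"
  shows "(f \<circ> inv_into U \<phi> has_derivative (\<lambda>e. chart_derivative A U \<phi> x e f)) (at (\<phi> x))"
proof -
  have "f \<circ> inv_into U \<phi> differentiable at (\<phi> x)"
    using smooth_fun_onD[OF smooth_funs_on[OF assms(1), of UNIV] assms(2)] assms(3)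
    by (intro smooth_on_differentiable) auto
  then show ?thesis using assms(1) by (simp add: chart_derivative_def frechet_derivative_works)
qed

lemma chart_derivative_nonsmooth: "f \<notin> smooth_funs A \<Longrightarrow> chart_derivative A U \<phi> x e f = 0"
  by (simp add: chart_derivative_def)

lemma chart_derivative_eqI:
  assumes "f \<in> smooth_funs A" "(U, \<phi>) \<in> A" "x \<in> U" "(f \<circ> inv_into U \<phi> has_derivative D) (at (\<phi> x))"
  shows "chart_derivative A U \<phi> x e f = D e"
  by (rule fun_cong[OF has_derivative_unique[OF chart_differentiable[OF assms(1-3)] assms(4)]])

lemma chart_derivative_linear:
  assumes "(U, \<phi>) \<in> A" "x \<in> U"
  shows "linear (chart_derivative A U \<phi> x)"
proof (rule linearI; rule ext)
  fix a b :: 'e and c and f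
  have "linear (\<lambda>e. chart_derivative A U \<phi> x e f)"
    by (cases "f \<in> smooth_funs A")
      (auto simp: chart_derivative_nonsmooth linear_zero intro: has_derivative_linear[OF chart_differentiable[OF _ assms]])
  then show "chart_derivative A U \<phi> x (a + b) f =
      (chart_derivative A U \<phi> x a + chart_derivative A U \<phi> x b) f"
    "chart_derivative A U \<phi> x (c *\<^sub>R a) f = (c *\<^sub>R chart_derivative A U \<phi> x a) f"
    using linear_add[of "\<lambda>e. chart_derivative A U \<phi> x e f" a b]
      linear_scale[of "\<lambda>e. chart_derivative A U \<phi> x e f" c a] by (simp_all add: scaleR_fun_def)
qed

text \<open>The vector \<open>e'\<close> is the image of \<open>e\<close> under the derivative of
  the transition map. Hence all charts at \<open>x\<close> yield the same tangent vectors, and these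
  form the range of one linear map.\<close>

lemma chart_derivative_change:
  assumes U: "(U, \<phi>) \<in> A" "x \<in> U" and V: "(V, \<psi>) \<in> A" "x \<in> V"
  shows "\<exists>e'. chart_derivative A V \<psi> x e = chart_derivative A U \<phi> x e'"
proof -
  have x: "\<psi> x \<in> \<psi> ` (V \<inter> U)" using U V by auto
  define D where "D = frechet_derivative (\<phi> \<circ> inv_into V \<psi>) (at (\<psi> x))"
  have D: "(\<phi> \<circ> inv_into V \<psi> has_derivative D) (at (\<psi> x))"
    unfolding D_def using smooth_on_differentiable[OF charts_compatible[OF V(1) U(1)] x]
    by (simp add: frechet_derivative_works)
  have "chart_derivative A V \<psi> x e f = chart_derivative A U \<phi> x (D e) f" for f
  proof (cases "f \<in> smooth_funs A")
    case True
    have "(f \<circ> inv_into U \<phi> has_derivative (\<lambda>e. chart_derivative A U \<phi> x e f))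
        (at ((\<phi> \<circ> inv_into V \<psi>) (\<psi> x)))"
      using chart_differentiable[OF True U] V by simp
    from diff_chain_at[OF D this]
    have "((f \<circ> inv_into U \<phi>) \<circ> (\<phi> \<circ> inv_into V \<psi>) has_derivative
        (\<lambda>e. chart_derivative A U \<phi> x e f) \<circ> D) (at (\<psi> x))" .
    then have "(f \<circ> inv_into V \<psi> has_derivative (\<lambda>e. chart_derivative A U \<phi> x e f) \<circ> D) (at (\<psi> x))"
      by (rule has_derivative_transform_within_open[OF _ chart_open[OF V(1) chart_domain[OF U(1)]] x])
        (use U V in auto)
    from chart_derivative_eqI[OF True V this] show ?thesis by simp
  qed (simp add: chart_derivative_nonsmooth)
  then show ?thesis by blast
qed

lemma tangent_space_chart:
  assumes "(U, \<phi>) \<in> A" "x \<in> U"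
  shows "tangent_space A x = range (chart_derivative A U \<phi> x)"
proof
  show "tangent_space A x \<subseteq> range (chart_derivative A U \<phi> x)"
  proof
    fix v assume "v \<in> tangent_space A x"
    then obtain V \<psi> e where V: "(V, \<psi>) \<in> A" "x \<in> V" "v = chart_derivative A V \<psi> x e"
      by (auto simp: tangent_space_def)
    then show "v \<in> range (chart_derivative A U \<phi> x)"
      using chart_derivative_change[OF assms V(1,2), of e] by auto
  qed
  show "range (chart_derivative A U \<phi> x) \<subseteq> tangent_space A x"
    using assms by (auto simp: tangent_space_def)
qed

lemma tangent_subspace: "subspace (tangent_space A x)"
proof -
  obtain U \<phi> where U: "(U, \<phi>) \<in> A" "x \<in> U" by (rule chart_at)
  show ?thesis unfolding tangent_space_chart[OF U]
    by (intro linear_subspace_image chart_derivative_linear[OF U] subspace_UNIV)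
qed

lemma tangent_nonsmooth: "v \<in> tangent_space A x \<Longrightarrow> f \<notin> smooth_funs A \<Longrightarrow> v f = 0"
  by (auto simp: tangent_space_def chart_derivative_nonsmooth)

lemma tangent_add:
  assumes "v \<in> tangent_space A x" "f \<in> smooth_funs A" "g \<in> smooth_funs A"
  shows "v (\<lambda>y. f y + g y) = v f + v g"
proof -
  obtain U \<phi> e where U: "(U, \<phi>) \<in> A" "x \<in> U" and v: "v = chart_derivative A U \<phi> x e"
    using assms(1) by (auto simp: tangent_space_def)
  show ?thesis unfolding v
    by (rule chart_derivative_eqI[OF smooth_funs_add[OF assms(2,3)] U, unfolded o_def])
      (use has_derivative_add[OF chart_differentiable[OF assms(2) U] chart_differentiable[OF assms(3) U]] in \<open>simp add: o_def\<close>)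
qed

lemma tangent_mult:
  assumes "v \<in> tangent_space A x" "f \<in> smooth_funs A" "g \<in> smooth_funs A"
  shows "v (\<lambda>y. f y * g y) = v f * g x + f x * v g"
proof -
  obtain U \<phi> e where U: "(U, \<phi>) \<in> A" "x \<in> U" and v: "v = chart_derivative A U \<phi> x e"
    using assms(1) by (auto simp: tangent_space_def)
  have "chart_derivative A U \<phi> x e (\<lambda>y. f y * g y)
     = f x * chart_derivative A U \<phi> x e g + chart_derivative A U \<phi> x e f * g x"
    by (rule chart_derivative_eqI[OF smooth_funs_mult[OF assms(2,3)] U, unfolded o_def])
      (use has_derivative_mult[OF chart_differentiable[OF assms(2) U] chart_differentiable[OF assms(3) U]] U in \<open>simp add: o_def\<close>)
  then show ?thesis by (simp add: v)
qed

lemma tangent_const [simp]: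
  assumes "v \<in> tangent_space A x" shows "v (\<lambda>y. c) = 0"
proof -
  obtain U \<phi> e where U: "(U, \<phi>) \<in> A" "x \<in> U" and v: "v = chart_derivative A U \<phi> x e"
    using assms(1) by (auto simp: tangent_space_def)
  show ?thesis unfolding v
    by (rule chart_derivative_eqI[OF smooth_funs_const U, unfolded o_def]) simp
qed

lemma tangent_scale:
  "v \<in> tangent_space A x \<Longrightarrow> f \<in> smooth_funs A \<Longrightarrow> v (\<lambda>y. c * f y) = c * v f"
  using tangent_mult[of v x "\<lambda>y. c" f] by simp

lemma tangent_uminus:
  "v \<in> tangent_space A x \<Longrightarrow> f \<in> smooth_funs A \<Longrightarrow> v (\<lambda>y. - f y) = - v f"
  using tangent_scale[of v x f "-1"] by simp

lemma tangent_diff: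
  "v \<in> tangent_space A x \<Longrightarrow> f \<in> smooth_funs A \<Longrightarrow> g \<in> smooth_funs A \<Longrightarrow> v (\<lambda>y. f y - g y) = v f - v g"
  using tangent_add[of v x f "\<lambda>y. - g y"] tangent_uminus[of v x g] by (simp add: smooth_funs_uminus)

end

section \<open>Linear maps given on a subspace only, and duals extended by zero\<close>

lemma lin_on_in: "lin_on V W f \<Longrightarrow> v \<in> V \<Longrightarrow> f v \<in> W"
  and lin_on_add: "lin_on V W f \<Longrightarrow> u \<in> V \<Longrightarrow> v \<in> V \<Longrightarrow> f (u + v) = f u + f v"
  and lin_on_scale: "lin_on V W f \<Longrightarrow> v \<in> V \<Longrightarrow> f (c *\<^sub>R v) = c *\<^sub>R f v"
  by (auto simp: lin_on_def)

lemma lin_on_0: "lin_on V W f \<Longrightarrow> v \<in> V \<Longrightarrow> f 0 = 0"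
  using lin_on_scale[of V W f v 0] by simp

lemma lin_on_uminus: "lin_on V W f \<Longrightarrow> v \<in> V \<Longrightarrow> f (- v) = - f v"
  using lin_on_scale[of V W f v "-1"] by simp

lemma lin_on_diff: "lin_on V W f \<Longrightarrow> subspace V \<Longrightarrow> u \<in> V \<Longrightarrow> v \<in> V \<Longrightarrow> f (u - v) = f u - f v"
  using lin_on_add[of V W f u "- v"] lin_on_uminus[of V W f v] by (simp add: subspace_neg)

lemma lin_on_sum:
  assumes "lin_on V W f" "subspace V" "finite I" "\<And>i. i \<in> I \<Longrightarrow> b i \<in> V"
  shows "f (\<Sum>i\<in>I. c i *\<^sub>R b i) = (\<Sum>i\<in>I. c i *\<^sub>R f (b i))"
  using assms(3,4)
proof (induction I)
  case empty
  then show ?case using lin_on_0[OF assms(1) subspace_0[OF assms(2)]] by simp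
next
  case (insert j I)
  have "(\<Sum>i\<in>I. c i *\<^sub>R b i) \<in> V" using insert by (intro subspace_sum subspace_scale assms(2)) auto
  then show ?case
    using insert lin_on_add[OF assms(1)] lin_on_scale[OF assms(1)] subspace_scale[OF assms(2)] by simp
qed

lemma sum_fun_apply: "(\<Sum>i\<in>I. f i) x = (\<Sum>i\<in>I. f i x)"
  by (induction I rule: infinite_finite_induct) auto

lemma scaleR_fun_apply [simp]: "(c *\<^sub>R f) x = c *\<^sub>R f x"
  by (simp add: scaleR_fun_def)

lemma dual_space_subspace: "subspace (dual_space V)"
  by (rule subspaceI) (auto simp: dual_space_def lin_on_def algebra_simps)

lemma dual_space_lin: "\<alpha> \<in> dual_space V \<Longrightarrow> lin_on V UNIV \<alpha>"
  by (simp add: dual_space_def)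

subsection \<open>Vector fields\<close>

context smooth_manifold
begin

lemma vector_field_tangent: "X \<in> vector_fields A \<Longrightarrow> X x \<in> tangent_space A x"
  by (simp add: vector_fields_def)

text \<open>The convention that tangent vectors vanish on non-smooth functions makes the derivative
  smooth for every \<open>f\<close>. Arbitrary functions can therefore serve as pivots in the
  elimination for \<open>W\<close>.\<close>

lemma fderiv_smooth: "X \<in> vector_fields A \<Longrightarrow> fderiv X f \<in> smooth_funs A"
proof (cases "f \<in> smooth_funs A")
  case False
  assume "X \<in> vector_fields A"
  then have "fderiv X f = (\<lambda>x. 0)"
    using False tangent_nonsmooth[OF vector_field_tangent] by (auto simp: fderiv_def)
  then show ?thesis by simp
qed (simp add: vector_fields_def)

lemma vector_fieldsI:
  "(\<And>x. X x \<in> tangent_space A x) \<Longrightarrow> (\<And>f. f \<in> smooth_funs A \<Longrightarrow> fderiv X f \<in> smooth_funs A)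
    \<Longrightarrow> X \<in> vector_fields A"
  by (simp add: vector_fields_def)

lemma vector_fields_add:
  assumes "X \<in> vector_fields A" "Y \<in> vector_fields A"
  shows "(\<lambda>x. X x + Y x) \<in> vector_fields A"
proof (rule vector_fieldsI)
  fix f show "fderiv (\<lambda>x. X x + Y x) f \<in> smooth_funs A"
    using smooth_funs_add[OF fderiv_smooth[OF assms(1), of f] fderiv_smooth[OF assms(2), of f]]
    by (simp add: fderiv_def)
qed (intro subspace_add[OF tangent_subspace] vector_field_tangent assms)

lemma vector_fields_scale:
  assumes "g \<in> smooth_funs A" "X \<in> vector_fields A"
  shows "(\<lambda>x. g x *\<^sub>R X x) \<in> vector_fields A"
proof (rule vector_fieldsI)
  fix f show "fderiv (\<lambda>x. g x *\<^sub>R X x) f \<in> smooth_funs A"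
    using smooth_funs_mult[OF assms(1) fderiv_smooth[OF assms(2), of f]]
    by (simp add: fderiv_def)
qed (intro subspace_scale[OF tangent_subspace] vector_field_tangent assms)

lemma vector_fields_uminus: "X \<in> vector_fields A \<Longrightarrow> (\<lambda>x. - X x) \<in> vector_fields A"
  using vector_fields_scale[of "\<lambda>x. -1" X] by simp

lemma vector_fields_diff:
  "X \<in> vector_fields A \<Longrightarrow> Y \<in> vector_fields A \<Longrightarrow> (\<lambda>x. X x - Y x) \<in> vector_fields A"
  using vector_fields_add[OF _ vector_fields_uminus[of Y]] by simp

lemma vector_fields_zero [simp]: "(\<lambda>x. 0) \<in> vector_fields A"
  by (rule vector_fieldsI) (auto simp: fderiv_def subspace_0[OF tangent_subspace])

lemma lie_bracket_antisym: "lie_bracket X Y x = - lie_bracket Y X x"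
  by (auto simp: lie_bracket_def)

lemma lie_bracket_add_left:
  assumes "X \<in> vector_fields A" "Y \<in> vector_fields A" "Z \<in> vector_fields A"
  shows "lie_bracket (\<lambda>x. X x + Y x) Z x = lie_bracket X Z x + lie_bracket Y Z x"
proof
  fix f
  have "Z x (\<lambda>y. fderiv X f y + fderiv Y f y) = Z x (fderiv X f) + Z x (fderiv Y f)"
    by (rule tangent_add[OF vector_field_tangent[OF assms(3)] fderiv_smooth[OF assms(1)] fderiv_smooth[OF assms(2)]])
  then show "lie_bracket (\<lambda>x. X x + Y x) Z x f = (lie_bracket X Z x + lie_bracket Y Z x) f"
    by (simp add: lie_bracket_def fderiv_def)
qed

lemma lie_bracket_scale_left:
  assumes "g \<in> smooth_funs A" "X \<in> vector_fields A" "Y \<in> vector_fields A"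
  shows "lie_bracket (\<lambda>x. g x *\<^sub>R X x) Y x = g x *\<^sub>R lie_bracket X Y x - Y x g *\<^sub>R X x"
proof
  fix f
  have "Y x (\<lambda>y. g y * fderiv X f y) = Y x g * fderiv X f x + g x * Y x (fderiv X f)"
    by (rule tangent_mult[OF vector_field_tangent[OF assms(3)] assms(1) fderiv_smooth[OF assms(2)]])
  then show "lie_bracket (\<lambda>x. g x *\<^sub>R X x) Y x f = (g x *\<^sub>R lie_bracket X Y x - Y x g *\<^sub>R X x) f"
    by (simp add: lie_bracket_def fderiv_def algebra_simps)
qed

lemma lie_bracket_add_right:
  assumes "X \<in> vector_fields A" "Y \<in> vector_fields A" "Z \<in> vector_fields A"
  shows "lie_bracket X (\<lambda>x. Y x + Z x) x = lie_bracket X Y x + lie_bracket X Z x"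
  using lie_bracket_add_left[OF assms(2,3,1), of x] lie_bracket_antisym[of X _ x] by simp

lemma lie_bracket_scale_right:
  assumes "g \<in> smooth_funs A" "X \<in> vector_fields A" "Y \<in> vector_fields A"
  shows "lie_bracket X (\<lambda>x. g x *\<^sub>R Y x) x = g x *\<^sub>R lie_bracket X Y x + X x g *\<^sub>R Y x"
  using lie_bracket_scale_left[OF assms(1,3,2), of x] lie_bracket_antisym[of X _ x] by simp

text \<open>Multiplying by a bump function \<open>b\<close> turns coordinate fields and coordinate functions of a
  chart into global objects.\<close>

definition chart_field where
  "chart_field b U \<phi> e = (\<lambda>x. if x \<in> U then b x *\<^sub>R chart_derivative A U \<phi> x e else 0)"

definition chart_function :: "('m \<Rightarrow> real) \<Rightarrow> 'm set \<Rightarrow> ('m \<Rightarrow> 'e) \<Rightarrow> 'e \<Rightarrow> 'e \<Rightarrow> 'm \<Rightarrow> real" where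
  "chart_function b U \<phi> c e = (\<lambda>x. if x \<in> U then b x * ((\<phi> x - c) \<bullet> e) else 0)"

definition bump_in :: "'m set \<Rightarrow> ('m \<Rightarrow> real) \<Rightarrow> bool" where
  "bump_in U b \<longleftrightarrow> b \<in> smooth_funs A \<and> (\<exists>K. closed K \<and> K \<subseteq> U \<and> (\<forall>x. x \<notin> K \<longrightarrow> b x = 0))"

lemma bump_in_exists:
  assumes "open S" "p \<in> S" obtains b where "bump_in S b" "b p \<noteq> 0"
  using bump_function[OF assms] unfolding bump_in_def by metis

lemma bump_in_smooth: "bump_in U b \<Longrightarrow> b \<in> smooth_funs A"
  by (simp add: bump_in_def)

lemma bump_in_extend:
  assumes b: "bump_in U b" and U: "open U" and f: "smooth_fun_on A U f"
  shows "(\<lambda>x. if x \<in> U then b x * f x else 0) \<in> smooth_funs A"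
proof -
  obtain K where K: "closed K" "K \<subseteq> U" "\<And>x. x \<notin> K \<Longrightarrow> b x = 0"
    using b unfolding bump_in_def by blast
  have "smooth_fun_on A U (\<lambda>x. if x \<in> U then b x * f x else 0)"
    by (rule smooth_fun_on_cong[OF smooth_fun_on_mult[OF U smooth_funs_on[OF bump_in_smooth[OF b]] f] U]) simp
  then show ?thesis
    by (rule smooth_funs_extend[OF _ U K(1,2)]) (simp add: K(3))
qed

lemma chart_derivative_smooth:
  assumes U: "(U, \<phi>) \<in> A" and f: "f \<in> smooth_funs A"
  shows "smooth_fun_on A U (\<lambda>x. chart_derivative A U \<phi> x e f)"
proof (rule smooth_fun_on_chart[OF U chart_domain[OF U] subset_refl])
  have "smooth_on (\<phi> ` U) (\<lambda>z. frechet_derivative (f \<circ> inv_into U \<phi>) (at z) e)"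
    using smooth_on_derivative[OF smooth_fun_onD[OF smooth_funs_on[OF f, of UNIV] U]] by simp
  moreover have "open (\<phi> ` U)" using chart_open[OF U open_UNIV] by simp
  ultimately show "smooth_on (\<phi> ` U) ((\<lambda>x. chart_derivative A U \<phi> x e f) \<circ> inv_into U \<phi>)"
    by (elim smooth_on_cong[rotated]) (use U f in \<open>auto simp: chart_derivative_def\<close>)
qed

lemma chart_field_vector_field:
  assumes U: "(U, \<phi>) \<in> A" and b: "bump_in U b"
  shows "chart_field b U \<phi> e \<in> vector_fields A"
proof (rule vector_fieldsI)
  fix x show "chart_field b U \<phi> e x \<in> tangent_space A x"
    using U subspace_scale[OF tangent_subspace, of "chart_derivative A U \<phi> x e" x "b x"]
    by (auto simp: chart_field_def subspace_0[OF tangent_subspace] tangent_space_chart[OF U])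
next
  fix f assume f: "f \<in> smooth_funs A"
  have "fderiv (chart_field b U \<phi> e) f = (\<lambda>x. if x \<in> U then b x * chart_derivative A U \<phi> x e f else 0)"
    by (auto simp: fderiv_def chart_field_def)
  then show "fderiv (chart_field b U \<phi> e) f \<in> smooth_funs A"
    using bump_in_extend[OF b chart_domain[OF U] chart_derivative_smooth[OF U f]] by simp
qed

lemma tangent_extend:
  assumes "v \<in> tangent_space A p" obtains X where "X \<in> vector_fields A" "X p = v"
proof -
  obtain U \<phi> e where U: "(U, \<phi>) \<in> A" "p \<in> U" and v: "v = chart_derivative A U \<phi> p e"
    using assms(1) by (auto simp: tangent_space_def)
  obtain b where b: "bump_in U b" "b p \<noteq> 0" by (rule bump_in_exists[OF chart_domain[OF U(1)] U(2)])
  show thesis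
  proof (rule that)
    show "(\<lambda>x. (1 / b p) *\<^sub>R chart_field b U \<phi> e x) \<in> vector_fields A"
      by (rule vector_fields_scale[OF smooth_funs_const chart_field_vector_field[OF U(1) b(1)]])
  qed (use U b v in \<open>simp add: chart_field_def\<close>)
qed

lemma chart_function_smooth:
  assumes U: "(U, \<phi>) \<in> A" and b: "bump_in U b"
  shows "chart_function b U \<phi> c e \<in> smooth_funs A"
  unfolding chart_function_def
proof (rule bump_in_extend[OF b chart_domain[OF U]], rule smooth_fun_on_chart[OF U chart_domain[OF U] subset_refl])
  have o: "open (\<phi> ` U)" using chart_open[OF U open_UNIV] by simp
  have "smooth_on (\<phi> ` U) (\<lambda>z. z \<bullet> e + - (c \<bullet> e))"
    by (intro smooth_on_add o) (auto simp: smooth_on_def intro: Ck_on_linear bounded_linear_inner_left)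
  then show "smooth_on (\<phi> ` U) ((\<lambda>x. (\<phi> x - c) \<bullet> e) \<circ> inv_into U \<phi>)"
    by (rule smooth_on_cong[OF o]) (use U in \<open>auto simp: inner_diff_left\<close>)
qed

text \<open>The base value \<open>c\<close> is a parameter because the choice
  \<open>c = \<phi> x\<close> kills the term with the derivative of \<open>b\<close>; this is how
  covectors are realised as differentials.\<close>

lemma chart_function_derivative:
  assumes U: "(U, \<phi>) \<in> A" "x \<in> U" and b: "bump_in U b"
  shows "chart_derivative A U \<phi> x a (chart_function b U \<phi> c e) =
    chart_derivative A U \<phi> x a b * ((\<phi> x - c) \<bullet> e) + b x * (a \<bullet> e)"
proof (rule chart_derivative_eqI[OF chart_function_smooth[OF U(1) b] U])
  have "((\<lambda>z. (z - c) \<bullet> e) has_derivative (\<lambda>a. a \<bullet> e)) (at (\<phi> x))"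
    by (auto intro!: derivative_eq_intros)
  from has_derivative_mult[OF chart_differentiable[OF bump_in_smooth[OF b] U] this]
  have "((\<lambda>z. (b \<circ> inv_into U \<phi>) z * ((z - c) \<bullet> e)) has_derivative
    (\<lambda>a. chart_derivative A U \<phi> x a b * ((\<phi> x - c) \<bullet> e) + b x * (a \<bullet> e))) (at (\<phi> x))"
    using U by (simp add: add.commute)
  then show "(chart_function b U \<phi> c e \<circ> inv_into U \<phi> has_derivative
    (\<lambda>a. chart_derivative A U \<phi> x a b * ((\<phi> x - c) \<bullet> e) + b x * (a \<bullet> e))) (at (\<phi> x))"
    by (rule has_derivative_transform_within_open[of _ _ _ _ "\<phi> ` U"])
      (use U chart_open[OF U(1) open_UNIV] in \<open>auto simp: chart_function_def\<close>)
qed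

text \<open>Tangent vectors are directional derivatives in charts, not abstract derivations, so a
  commutator is not tangent by definition. Here the second derivatives cancel by symmetry, and what
  remains is the directional derivative along \<open>w\<close>, coming from the derivatives of
  \<open>b\<close>.\<close>

lemma chart_field_bracket:
  assumes U: "(U, \<phi>) \<in> A" "p \<in> U" and b: "bump_in U b"
  shows "lie_bracket (chart_field b U \<phi> c) (chart_field b U \<phi> d) p \<in> tangent_space A p"
proof -
  let ?D = "\<lambda>e. chart_derivative A U \<phi> p e"
  have b': "b \<in> smooth_funs A" using b by (rule bump_in_smooth)
  define w where "w = (b p * ?D c b) *\<^sub>R d - (b p * ?D d b) *\<^sub>R c"
  have oU: "open (\<phi> ` U)" "\<phi> p \<in> \<phi> ` U" using chart_open[OF U(1) open_UNIV] U by auto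
  have "lie_bracket (chart_field b U \<phi> c) (chart_field b U \<phi> d) p f = ?D w f" for f
  proof (cases "f \<in> smooth_funs A")
    case True
    define g where "g = f \<circ> inv_into U \<phi>"
    have g: "smooth_on (\<phi> ` U) g"
      using smooth_fun_onD[OF smooth_funs_on[OF True, of UNIV] U(1)] by (simp add: g_def)
    define g2 where "g2 = (\<lambda>d e. frechet_derivative (\<lambda>z. frechet_derivative g (at z) d) (at (\<phi> p)) e)"
    have second: "fderiv (chart_field b U \<phi> c) (fderiv (chart_field b U \<phi> d) f) p
        = b p * (?D c b * ?D d f + b p * g2 d c)" for c d
    proof -
      have "((\<lambda>z. frechet_derivative g (at z) d) has_derivative g2 d) (at (\<phi> p))"
        using smooth_on_differentiable[OF smooth_on_derivative[OF g] oU(2)]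
        by (simp add: frechet_derivative_works g2_def)
      from has_derivative_mult[OF chart_differentiable[OF b' U] this]
      have D: "((\<lambda>z. (b \<circ> inv_into U \<phi>) z * frechet_derivative g (at z) d) has_derivative
          (\<lambda>c. ?D c b * ?D d f + b p * g2 d c)) (at (\<phi> p))"
        using U True by (simp add: add.commute g_def chart_derivative_def)
      have "(fderiv (chart_field b U \<phi> d) f \<circ> inv_into U \<phi> has_derivative
          (\<lambda>c. ?D c b * ?D d f + b p * g2 d c)) (at (\<phi> p))"
        by (rule has_derivative_transform_within_open[OF D oU])
          (use U True in \<open>auto simp: fderiv_def chart_field_def chart_derivative_def g_def\<close>)
      from chart_derivative_eqI[OF fderiv_smooth[OF chart_field_vector_field[OF U(1) b]] U this]
      moreover have "fderiv (chart_field b U \<phi> c) h p = b p * ?D c h" for h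
        using U by (simp add: fderiv_def chart_field_def)
      ultimately show ?thesis by (simp only:)
    qed
    have sym: "g2 c d = g2 d c"
      using second_derivative_symmetric[OF oU(1) smooth_onD[OF g] oU(2)] by (simp add: g2_def)
    have "?D w f = b p * ?D c b * ?D d f - b p * ?D d b * ?D c f"
      using chart_derivative_linear[OF U] by (simp add: w_def linear_diff linear_scale)
    then show ?thesis
      by (simp add: lie_bracket_def second sym algebra_simps)
  next
    \<comment> \<open>Tangent vectors vanish on non-smooth functions by convention, so both sides
      are 0.\<close>
    case False
    have "fderiv (chart_field b U \<phi> c) f = (\<lambda>x. 0)" for c
      using False by (auto simp: fderiv_def chart_field_def chart_derivative_nonsmooth)
    then show ?thesis
      using False tangent_const[OF vector_field_tangent[OF chart_field_vector_field[OF U(1) b]]]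
      by (simp add: lie_bracket_def chart_derivative_nonsmooth) (simp add: fderiv_def)
  qed
  then have "lie_bracket (chart_field b U \<phi> c) (chart_field b U \<phi> d) p = ?D w" by (rule ext)
  then show ?thesis using U by (simp add: tangent_space_chart[OF U])
qed

text \<open>Instead of localising, multiply by a function \<open>\<theta>\<close> which does not vanish at \<open>p\<close>: then every
  vector field becomes a global combination of finitely many fixed ones.\<close>

lemma local_frame:
  obtains C :: "'e set" and E \<theta> where "finite C" "\<And>c. E c \<in> vector_fields A"
    "\<theta> \<in> smooth_funs A" "\<theta> p \<noteq> 0"
    "\<And>X. X \<in> vector_fields A \<Longrightarrow> \<exists>a. (\<forall>c. a c \<in> smooth_funs A) \<and>
       (\<forall>x. \<theta> x *\<^sub>R X x = (\<Sum>c\<in>C. a c x *\<^sub>R E c x)) \<and> (X p = 0 \<longrightarrow> (\<forall>c. a c p = 0))"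
    "\<And>c d. lie_bracket (E c) (E d) p \<in> tangent_space A p"
proof -
  obtain U \<phi> where U: "(U, \<phi>) \<in> A" "p \<in> U" by (rule chart_at)
  obtain b where b: "bump_in U b" "b p \<noteq> 0" by (rule bump_in_exists[OF chart_domain[OF U(1)] U(2)])
  obtain C :: "'e set" where C: "orthogonal_basis C" by (rule basis)
  have b': "b \<in> smooth_funs A" using b(1) by (rule bump_in_smooth)
  let ?E = "\<lambda>c. chart_field b U \<phi> c" and ?x = "\<lambda>c. chart_function b U \<phi> 0 c"
  have off: "b x = 0" if "x \<notin> U" for x using b(1) that by (auto simp: bump_in_def)
  show thesis
  proof (rule that[of C ?E "\<lambda>x. b x * (b x * b x)"])
    show "finite C" using C by (simp add: orthogonal_basis_def)
    show "?E c \<in> vector_fields A" for c by (rule chart_field_vector_field[OF U(1) b(1)])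
    show "(\<lambda>x. b x * (b x * b x)) \<in> smooth_funs A" by (intro smooth_funs_mult b')
    show "b p * (b p * b p) \<noteq> 0" using b(2) by simp
    show "lie_bracket (?E c) (?E d) p \<in> tangent_space A p" for c d
      by (rule chart_field_bracket[OF U b(1)])
    fix X assume X: "X \<in> vector_fields A"
    \<comment> \<open>Only the cut-off coordinate, \<open>b\<close> times the coordinate along
      \<open>c\<close>, is a global function. By the product rule the difference equals
      \<open>b * b\<close> times the derivative along \<open>X\<close> of the coordinate itself; the
      third factor \<open>b\<close> of the multiplier is the one in \<open>?E c\<close>.\<close>
    define a where "a = (\<lambda>c x. (b x * fderiv X (?x c) x - ?x c x * fderiv X b x) * (1 / (c \<bullet> c)))"
    have "a c \<in> smooth_funs A" for c
      unfolding a_def by (intro smooth_funs_intros b' fderiv_smooth[OF X] chart_function_smooth[OF U(1) b(1)])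
    moreover have "(b x * (b x * b x)) *\<^sub>R X x = (\<Sum>c\<in>C. a c x *\<^sub>R ?E c x)" for x
    proof (cases "x \<in> U")
      case True
      obtain e where e: "X x = chart_derivative A U \<phi> x e"
        using vector_field_tangent[OF X, of x] tangent_space_chart[OF U(1) True] by auto
      have a: "a c x = (b x * b x) * ((e \<bullet> c) / (c \<bullet> c))" for c
        unfolding a_def fderiv_def e chart_function_derivative[OF U(1) True b(1)]
        using True by (simp add: chart_function_def algebra_simps)
      have "X x = (\<Sum>c\<in>C. ((e \<bullet> c) / (c \<bullet> c)) *\<^sub>R chart_derivative A U \<phi> x c)"
        using arg_cong[OF orthogonal_basis_expansion[OF C, of e], of "chart_derivative A U \<phi> x"]
        by (simp add: e linear_sum[OF chart_derivative_linear[OF U(1) True]]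
            linear_scale[OF chart_derivative_linear[OF U(1) True]])
      then show ?thesis
        using True by (simp add: a chart_field_def scaleR_sum_right mult.assoc)
          (simp add: mult_ac)
    next
      case False
      then show ?thesis by (simp add: off chart_field_def)
    qed
    moreover have "a c p = 0" if "X p = 0" for c
      using that by (simp add: a_def fderiv_def)
    ultimately show "\<exists>a. (\<forall>c. a c \<in> smooth_funs A) \<and>
       (\<forall>x. (b x * (b x * b x)) *\<^sub>R X x = (\<Sum>c\<in>C. a c x *\<^sub>R ?E c x)) \<and> (X p = 0 \<longrightarrow> (\<forall>c. a c p = 0))"
      by blast
  qed
qed

lemma vector_fields_sum:
  assumes "finite I" "\<And>i. i \<in> I \<Longrightarrow> X i \<in> vector_fields A"
  shows "(\<lambda>x. \<Sum>i\<in>I. X i x) \<in> vector_fields A"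
  using assms by (induction I) (auto intro: vector_fields_add)

lemma lie_bracket_sum_tangent:
  assumes "finite I" "\<And>i. X i \<in> vector_fields A" "\<And>i. a i \<in> smooth_funs A"
    "Y \<in> vector_fields A" "\<And>i. lie_bracket (X i) Y p \<in> tangent_space A p"
  shows "lie_bracket (\<lambda>x. \<Sum>i\<in>I. a i x *\<^sub>R X i x) Y p \<in> tangent_space A p"
  using assms(1)
proof (induction I)
  case empty
  have "lie_bracket (\<lambda>x. 0 *\<^sub>R Y x) Y p \<in> tangent_space A p"
    unfolding lie_bracket_scale_left[OF smooth_funs_const assms(4,4)]
    using tangent_const[OF vector_field_tangent[OF assms(4)]] subspace_0[OF tangent_subspace] by simp
  then show ?case by (simp only: sum.empty scaleR_zero_left)
next
  case (insert j I)
  have "lie_bracket (\<lambda>x. a j x *\<^sub>R X j x) Y p \<in> tangent_space A p"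
    unfolding lie_bracket_scale_left[OF assms(3,2,4)]
    by (intro subspace_diff subspace_scale tangent_subspace assms vector_field_tangent)
  moreover have "lie_bracket (\<lambda>x. a j x *\<^sub>R X j x + (\<Sum>i\<in>I. a i x *\<^sub>R X i x)) Y p
      = lie_bracket (\<lambda>x. a j x *\<^sub>R X j x) Y p + lie_bracket (\<lambda>x. \<Sum>i\<in>I. a i x *\<^sub>R X i x) Y p"
    by (intro lie_bracket_add_left vector_fields_sum vector_fields_scale assms insert)
  ultimately show ?case
    using insert subspace_add[OF tangent_subspace] by (simp only: sum.insert[OF insert(1,2)])
qed

text \<open>By the Leibniz rule the brackets of \<open>\<theta> X\<close> and \<open>X\<close> with
  \<open>Y\<close> differ, up to the factor \<open>\<theta>\<close>, by a multiple of
  \<open>X\<close>. So tangency passes from the frame to \<open>X\<close> in the left slot, and by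
  antisymmetry in the right one.\<close>

lemma lie_bracket_tangent:
  assumes "X \<in> vector_fields A" "Y \<in> vector_fields A"
  shows "lie_bracket X Y p \<in> tangent_space A p"
proof -
  obtain C :: "'e set" and E \<theta> where F: "finite C" "\<And>c. E c \<in> vector_fields A"
    "\<theta> \<in> smooth_funs A" "\<theta> p \<noteq> 0"
    and frame: "\<And>X. X \<in> vector_fields A \<Longrightarrow> \<exists>a. (\<forall>c. a c \<in> smooth_funs A) \<and>
       (\<forall>x. \<theta> x *\<^sub>R X x = (\<Sum>c\<in>C. a c x *\<^sub>R E c x)) \<and> (X p = 0 \<longrightarrow> (\<forall>c. a c p = 0))"
    and E: "\<And>c d. lie_bracket (E c) (E d) p \<in> tangent_space A p"
    by (rule local_frame[where p = p]) blast
  have reduce: "lie_bracket X Y p \<in> tangent_space A p"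
    if X: "X \<in> vector_fields A" and Y: "Y \<in> vector_fields A"
      and EY: "\<And>c. lie_bracket (E c) Y p \<in> tangent_space A p" for X Y
  proof -
    obtain a where a: "\<And>c. a c \<in> smooth_funs A" "\<And>x. \<theta> x *\<^sub>R X x = (\<Sum>c\<in>C. a c x *\<^sub>R E c x)"
      using frame[OF X] by blast
    have "lie_bracket (\<lambda>x. \<theta> x *\<^sub>R X x) Y p \<in> tangent_space A p"
      unfolding a(2) by (rule lie_bracket_sum_tangent[OF F(1,2) a(1) Y EY])
    then have "\<theta> p *\<^sub>R lie_bracket X Y p - Y p \<theta> *\<^sub>R X p \<in> tangent_space A p"
      by (simp only: lie_bracket_scale_left[OF F(3) X Y])
    then have "(\<theta> p *\<^sub>R lie_bracket X Y p - Y p \<theta> *\<^sub>R X p) + Y p \<theta> *\<^sub>R X p \<in> tangent_space A p"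
      using subspace_add[OF tangent_subspace _ subspace_scale[OF tangent_subspace vector_field_tangent[OF X]]]
      by blast
    then have "(1 / \<theta> p) *\<^sub>R (\<theta> p *\<^sub>R lie_bracket X Y p) \<in> tangent_space A p"
      by (intro subspace_scale[OF tangent_subspace, where c = "1 / \<theta> p"]) simp
    then show ?thesis using F(4) by simp
  qed
  have "lie_bracket (E c) Y p \<in> tangent_space A p" for c
    using reduce[OF assms(2) F(2) E] lie_bracket_antisym[of "E c" Y p]
    by (simp add: subspace_neg[OF tangent_subspace])
  then show ?thesis by (rule reduce[OF assms])
qed

lemma lie_bracket_vector_field:
  assumes "X \<in> vector_fields A" "Y \<in> vector_fields A"
  shows "lie_bracket X Y \<in> vector_fields A"
proof (rule vector_fieldsI[OF lie_bracket_tangent[OF assms]])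
  fix f
  have "fderiv (lie_bracket X Y) f = (\<lambda>x. fderiv X (fderiv Y f) x - fderiv Y (fderiv X f) x)"
    by (simp add: fderiv_def lie_bracket_def)
  then show "fderiv (lie_bracket X Y) f \<in> smooth_funs A"
    using smooth_funs_diff[OF fderiv_smooth[OF assms(1)] fderiv_smooth[OF assms(2)]] by simp
qed

subsection \<open>One-forms\<close>

lemma one_form_dual: "\<xi> \<in> one_forms A \<Longrightarrow> \<xi> x \<in> dual_space (tangent_space A x)"
  and one_form_smooth: "\<xi> \<in> one_forms A \<Longrightarrow> X \<in> vector_fields A \<Longrightarrow> (\<lambda>x. \<xi> x (X x)) \<in> smooth_funs A"
  by (auto simp: one_forms_def)

lemma one_form_lin: "\<xi> \<in> one_forms A \<Longrightarrow> lin_on (tangent_space A x) UNIV (\<xi> x)"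
  using one_form_dual dual_space_lin by blast

lemma one_forms_add:
  "\<xi> \<in> one_forms A \<Longrightarrow> \<eta> \<in> one_forms A \<Longrightarrow> (\<lambda>x. \<xi> x + \<eta> x) \<in> one_forms A"
  unfolding one_forms_def by (auto intro: subspace_add[OF dual_space_subspace] smooth_funs_add)

lemma one_forms_scale:
  "f \<in> smooth_funs A \<Longrightarrow> \<xi> \<in> one_forms A \<Longrightarrow> (\<lambda>x. f x *\<^sub>R \<xi> x) \<in> one_forms A"
  unfolding one_forms_def
  by (auto intro: subspace_scale[OF dual_space_subspace, simplified] smooth_funs_mult)

lemma one_forms_uminus: "\<xi> \<in> one_forms A \<Longrightarrow> (\<lambda>x. - \<xi> x) \<in> one_forms A"
  using one_forms_scale[of "\<lambda>x. -1" \<xi>] by simp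

lemma one_forms_diff:
  "\<xi> \<in> one_forms A \<Longrightarrow> \<eta> \<in> one_forms A \<Longrightarrow> (\<lambda>x. \<xi> x - \<eta> x) \<in> one_forms A"
  using one_forms_add[OF _ one_forms_uminus[of \<eta>]] by simp

lemma d_fun_one_form: "f \<in> smooth_funs A \<Longrightarrow> d_fun A f \<in> one_forms A"
  using subspace_add[OF tangent_subspace] subspace_scale[OF tangent_subspace] vector_field_tangent
    fderiv_smooth[of _ f]
  by (auto simp: one_forms_def d_fun_def dual_space_def lin_on_def fderiv_def)

text \<open>In a chart the covector is the inner product with a vector \<open>w\<close>, hence the
  differential at \<open>p\<close> of a linear coordinate function. Cut off by a bump function, this
  gives an extension that is even exact.\<close>

lemma covector_extend:
  assumes "\<alpha> \<in> dual_space (tangent_space A p)" obtains \<xi> where "\<xi> \<in> one_forms A" "\<xi> p = \<alpha>"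
proof -
  obtain U \<phi> where U: "(U, \<phi>) \<in> A" "p \<in> U" by (rule chart_at)
  obtain b where b: "bump_in U b" "b p \<noteq> 0" by (rule bump_in_exists[OF chart_domain[OF U(1)] U(2)])
  obtain C :: "'e set" where C: "orthogonal_basis C" by (rule basis)
  let ?D = "chart_derivative A U \<phi> p"
  have T: "tangent_space A p = range ?D" by (rule tangent_space_chart[OF U])
  have lin: "linear (\<lambda>e. \<alpha> (?D e))"
    using assms chart_derivative_linear[OF U] unfolding T
    by (intro linearI) (auto simp: dual_space_def lin_on_def linear_add linear_scale)
  define w where "w = (\<Sum>c\<in>C. (\<alpha> (?D c) / (c \<bullet> c)) *\<^sub>R c)"
  have w: "\<alpha> (?D e) = e \<bullet> w" for e
  proof -
    have "\<alpha> (?D e) = \<alpha> (?D (\<Sum>c\<in>C. ((e \<bullet> c) / (c \<bullet> c)) *\<^sub>R c))"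
      using orthogonal_basis_expansion[OF C, of e] by simp
    also have "\<dots> = (\<Sum>c\<in>C. ((e \<bullet> c) / (c \<bullet> c)) *\<^sub>R \<alpha> (?D c))"
      using linear_sum[OF lin, of "\<lambda>c. ((e \<bullet> c) / (c \<bullet> c)) *\<^sub>R c" C] linear_scale[OF lin] by simp
    also have "\<dots> = e \<bullet> w" by (simp add: w_def inner_sum_right mult.commute)
    finally show ?thesis .
  qed
  define f where "f = (\<lambda>x. (1 / b p) * chart_function b U \<phi> (\<phi> p) w x)"
  have f: "f \<in> smooth_funs A" unfolding f_def
    by (intro smooth_funs_mult smooth_funs_const chart_function_smooth[OF U(1) b(1)])
  have "d_fun A f p v = \<alpha> v" for v
  proof (cases "v \<in> tangent_space A p")
    case True
    then obtain e where v: "v = ?D e" using T by blast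
    have "v f = (1 / b p) * v (chart_function b U \<phi> (\<phi> p) w)" unfolding f_def
      by (rule tangent_scale[OF True chart_function_smooth[OF U(1) b(1)]])
    also have "\<dots> = e \<bullet> w"
      using b(2) by (simp add: v chart_function_derivative[OF U b(1)])
    finally show ?thesis using True w v by (simp add: d_fun_def)
  next
    case False
    then show ?thesis using assms by (simp add: d_fun_def dual_space_def)
  qed
  then show thesis using that[OF d_fun_one_form[OF f]] by blast
qed

text \<open>Linearity over functions forces dependence on the value at one point: if
  \<open>Y p = 0\<close>, the frame coefficients of \<open>\<theta> Y\<close> vanish at
  \<open>p\<close>. Uniqueness is included because \<open>lie_derivative\<close> is defined by a
  definite description.\<close>

lemma tensorial_one_form:
  assumes smooth: "\<And>Y. Y \<in> vector_fields A \<Longrightarrow> \<Phi> Y \<in> smooth_funs A"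
    and add: "\<And>Y Z x. Y \<in> vector_fields A \<Longrightarrow> Z \<in> vector_fields A \<Longrightarrow> \<Phi> (\<lambda>x. Y x + Z x) x = \<Phi> Y x + \<Phi> Z x"
    and scale: "\<And>f Y x. f \<in> smooth_funs A \<Longrightarrow> Y \<in> vector_fields A \<Longrightarrow> \<Phi> (\<lambda>x. f x *\<^sub>R Y x) x = f x * \<Phi> Y x"
  shows "\<exists>!\<omega>. \<omega> \<in> one_forms A \<and> (\<forall>Y\<in>vector_fields A. \<forall>x. \<omega> x (Y x) = \<Phi> Y x)"
proof -
  have sum: "\<Phi> (\<lambda>x. \<Sum>c\<in>C. a c x *\<^sub>R E c x) x = (\<Sum>c\<in>C. a c x * \<Phi> (E c) x)"
    if "finite C" "\<And>c. E c \<in> vector_fields A" "\<And>c. a c \<in> smooth_funs A" for C :: "'e set" and E a x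
    using that(1)
  proof (induction C)
    case empty
    show ?case using scale[OF smooth_funs_const vector_fields_zero, of 0 x]
      by (simp only: sum.empty scaleR_zero_right mult_zero_left)
  next
    case (insert d C)
    have "\<Phi> (\<lambda>x. a d x *\<^sub>R E d x + (\<Sum>c\<in>C. a c x *\<^sub>R E c x)) x
      = \<Phi> (\<lambda>x. a d x *\<^sub>R E d x) x + \<Phi> (\<lambda>x. \<Sum>c\<in>C. a c x *\<^sub>R E c x) x"
      by (rule add[OF vector_fields_scale[OF that(3,2)] vector_fields_sum[OF insert(1) vector_fields_scale[OF that(3,2)]]])
    then show ?case
      by (simp only: sum.insert[OF insert(1,2)] scale[OF that(3,2)] insert.IH)
  qed
  have zero: "\<Phi> Y p = 0" if Y: "Y \<in> vector_fields A" "Y p = 0" for Y p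
  proof -
    obtain C :: "'e set" and E \<theta> where F: "finite C" "\<And>c. E c \<in> vector_fields A"
      "\<theta> \<in> smooth_funs A" "\<theta> p \<noteq> 0"
      and frame: "\<And>X. X \<in> vector_fields A \<Longrightarrow> \<exists>a. (\<forall>c. a c \<in> smooth_funs A) \<and>
         (\<forall>x. \<theta> x *\<^sub>R X x = (\<Sum>c\<in>C. a c x *\<^sub>R E c x)) \<and> (X p = 0 \<longrightarrow> (\<forall>c. a c p = 0))"
      by (rule local_frame[where p = p]) blast
    obtain a where a: "\<And>c. a c \<in> smooth_funs A" "\<And>x. \<theta> x *\<^sub>R Y x = (\<Sum>c\<in>C. a c x *\<^sub>R E c x)"
      "\<And>c. a c p = 0" using frame[OF Y(1)] Y(2) by blast
    have "\<theta> p * \<Phi> Y p = (\<Sum>c\<in>C. a c p * \<Phi> (E c) p)"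
      using scale[OF F(3) Y(1), of p] sum[OF F(1,2) a(1), where x = p] by (simp add: a(2))
    then show ?thesis using F(4) a(3) by simp
  qed
  have well: "\<Phi> Y p = \<Phi> Z p" if "Y \<in> vector_fields A" "Z \<in> vector_fields A" "Y p = Z p" for Y Z p
  proof -
    have m: "(\<lambda>x. (-1) *\<^sub>R Z x) \<in> vector_fields A" using that(2) by (intro vector_fields_scale smooth_funs_const)
    have "\<Phi> (\<lambda>x. Y x + (-1) *\<^sub>R Z x) p = 0"
      by (rule zero[OF vector_fields_add[OF that(1) m]]) (use that in simp)
    then show ?thesis
      using add[OF that(1) m, of p] scale[OF smooth_funs_const that(2), of "-1" p] by simp
  qed
  \<comment> \<open>A tangent vector is extended by an arbitrary field; \<open>well\<close> makes
    the choice immaterial.\<close>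
  define \<omega> where "\<omega> = (\<lambda>x v. if v \<in> tangent_space A x then \<Phi> (SOME Y. Y \<in> vector_fields A \<and> Y x = v) x else 0)"
  have \<omega>: "\<omega> x (Y x) = \<Phi> Y x" if Y: "Y \<in> vector_fields A" for Y x
  proof -
    define Z where "Z = (SOME Z. Z \<in> vector_fields A \<and> Z x = Y x)"
    have "Z \<in> vector_fields A \<and> Z x = Y x"
      unfolding Z_def by (rule someI[of _ Y]) (simp add: Y)
    moreover have "\<omega> x (Y x) = \<Phi> Z x" using vector_field_tangent[OF Y] by (simp add: \<omega>_def Z_def)
    ultimately show ?thesis using well[of Z Y x] Y by simp
  qed
  have "\<omega> \<in> one_forms A"
    unfolding one_forms_def dual_space_def lin_on_def
  proof (intro CollectI conjI allI ballI impI)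
    fix x u v c assume u: "u \<in> tangent_space A x"
    then obtain Y where Y: "Y \<in> vector_fields A" "Y x = u" by (rule tangent_extend)
    show "\<omega> x (c *\<^sub>R u) = c *\<^sub>R \<omega> x u"
      using \<omega>[OF vector_fields_scale[OF smooth_funs_const Y(1)], of x c] scale[OF smooth_funs_const Y(1), of c x]
        \<omega>[OF Y(1), of x] Y(2) by simp
    assume v: "v \<in> tangent_space A x"
    then obtain Z where Z: "Z \<in> vector_fields A" "Z x = v" by (rule tangent_extend)
    show "\<omega> x (u + v) = \<omega> x u + \<omega> x v"
      using \<omega>[OF vector_fields_add[OF Y(1) Z(1)], of x] add[OF Y(1) Z(1), of x] \<omega>[OF Y(1), of x] \<omega>[OF Z(1), of x]
        Y(2) Z(2) by simp
  next
    fix Y assume "Y \<in> vector_fields A"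
    then show "(\<lambda>x. \<omega> x (Y x)) \<in> smooth_funs A" using \<omega> smooth by simp
  qed (auto simp: \<omega>_def)
  moreover have "\<omega>' = \<omega>" if "\<omega>' \<in> one_forms A" "\<forall>Y\<in>vector_fields A. \<forall>x. \<omega>' x (Y x) = \<Phi> Y x" for \<omega>'
  proof (intro ext)
    fix x v show "\<omega>' x v = \<omega> x v"
    proof (cases "v \<in> tangent_space A x")
      case True
      then obtain Y where "Y \<in> vector_fields A" "Y x = v" by (rule tangent_extend)
      then show ?thesis using that \<omega> by metis
    next
      case False
      then show ?thesis using one_form_dual[OF that(1), of x] by (simp add: \<omega>_def dual_space_def)
    qed
  qed
  ultimately show ?thesis
  proof (intro ex1I[of _ \<omega>] conjI ballI allI)
    show "\<omega> x (Y x) = \<Phi> Y x" if "Y \<in> vector_fields A" for Y x using \<omega>[OF that] .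
  qed (blast, blast)
qed

text \<open>The Cartan-type expression is linear over functions in \<open>Y\<close>: the terms with
  the derivative of \<open>f\<close> along \<open>X\<close> from its two summands cancel. So it
  defines a one-form, and the definite description denotes it.\<close>

lemma lie_derivative_spec:
  assumes X: "X \<in> vector_fields A" and \<eta>: "\<eta> \<in> one_forms A"
  shows "lie_derivative A X \<eta> \<in> one_forms A \<and> (\<forall>Y\<in>vector_fields A. \<forall>x.
     lie_derivative A X \<eta> x (Y x) = fderiv X (\<lambda>y. \<eta> y (Y y)) x - \<eta> x (lie_bracket X Y x))"
proof -
  let ?\<Phi> = "\<lambda>Y x. fderiv X (\<lambda>y. \<eta> y (Y y)) x - \<eta> x (lie_bracket X Y x)"
  have "\<exists>!\<omega>. \<omega> \<in> one_forms A \<and> (\<forall>Y\<in>vector_fields A. \<forall>x. \<omega> x (Y x) = ?\<Phi> Y x)"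
  proof (rule tensorial_one_form[where \<Phi> = ?\<Phi>])
    fix Y assume Y: "Y \<in> vector_fields A"
    show "(\<lambda>x. fderiv X (\<lambda>y. \<eta> y (Y y)) x - \<eta> x (lie_bracket X Y x)) \<in> smooth_funs A"
      by (intro smooth_funs_diff fderiv_smooth[OF X] one_form_smooth[OF \<eta>] lie_bracket_vector_field X Y)
    fix f x assume f: "f \<in> smooth_funs A"
    have "\<eta> y (f y *\<^sub>R Y y) = f y * \<eta> y (Y y)" for y
      using lin_on_scale[OF one_form_lin[OF \<eta>] vector_field_tangent[OF Y]] by simp
    moreover have "\<eta> x (f x *\<^sub>R lie_bracket X Y x + X x f *\<^sub>R Y x) = f x * \<eta> x (lie_bracket X Y x) + X x f * \<eta> x (Y x)"
      using lin_on_add[OF one_form_lin[OF \<eta>]] lin_on_scale[OF one_form_lin[OF \<eta>]]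
        subspace_scale[OF tangent_subspace] vector_field_tangent[OF Y] lie_bracket_tangent[OF X Y] by simp
    ultimately show "fderiv X (\<lambda>y. \<eta> y (f y *\<^sub>R Y y)) x - \<eta> x (lie_bracket X (\<lambda>x. f x *\<^sub>R Y x) x) =
        f x * (fderiv X (\<lambda>y. \<eta> y (Y y)) x - \<eta> x (lie_bracket X Y x))"
      using tangent_mult[OF vector_field_tangent[OF X] f one_form_smooth[OF \<eta> Y], of x]
      by (simp add: lie_bracket_scale_right[OF f X Y] fderiv_def algebra_simps)
  next
    fix Y Z x assume Y: "Y \<in> vector_fields A" and Z: "Z \<in> vector_fields A"
    have "\<eta> y (Y y + Z y) = \<eta> y (Y y) + \<eta> y (Z y)" for y
      using lin_on_add[OF one_form_lin[OF \<eta>] vector_field_tangent[OF Y] vector_field_tangent[OF Z]] .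
    moreover have "\<eta> x (lie_bracket X Y x + lie_bracket X Z x) = \<eta> x (lie_bracket X Y x) + \<eta> x (lie_bracket X Z x)"
      using lin_on_add[OF one_form_lin[OF \<eta>] lie_bracket_tangent[OF X Y] lie_bracket_tangent[OF X Z]] .
    ultimately show "fderiv X (\<lambda>y. \<eta> y (Y y + Z y)) x - \<eta> x (lie_bracket X (\<lambda>x. Y x + Z x) x) =
        fderiv X (\<lambda>y. \<eta> y (Y y)) x - \<eta> x (lie_bracket X Y x) + (fderiv X (\<lambda>y. \<eta> y (Z y)) x - \<eta> x (lie_bracket X Z x))"
      using tangent_add[OF vector_field_tangent[OF X] one_form_smooth[OF \<eta> Y] one_form_smooth[OF \<eta> Z], of x]
      by (simp add: lie_bracket_add_right[OF X Y Z] fderiv_def)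
  qed
  from theI'[OF this] show ?thesis unfolding lie_derivative_def .
qed

end

subsection \<open>Sections of vector bundles\<close>

context smooth_vector_bundle
begin

lemma section_fibre: "s \<in> sections A G F \<Longrightarrow> s x \<in> G x"
  by (simp add: sections_def)

lemma section_coordinate:
  "s \<in> sections A G F \<Longrightarrow> (U, k, \<tau>) \<in> F \<Longrightarrow> i < k \<Longrightarrow> smooth_fun_on A U (\<lambda>x. \<tau> x (s x) i)"
  by (auto simp: sections_def)

lemma sectionsI:
  "(\<And>x. s x \<in> G x) \<Longrightarrow> (\<And>U k \<tau> i. (U, k, \<tau>) \<in> F \<Longrightarrow> i < k \<Longrightarrow> smooth_fun_on A U (\<lambda>x. \<tau> x (s x) i))
    \<Longrightarrow> s \<in> sections A G F"
  by (auto simp: sections_def)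

lemma triv_open: "(U, k, \<tau>) \<in> F \<Longrightarrow> open U"
  and triv_lin: "(U, k, \<tau>) \<in> F \<Longrightarrow> x \<in> U \<Longrightarrow> lin_on (G x) (coords k) (\<tau> x)"
  and triv_bij: "(U, k, \<tau>) \<in> F \<Longrightarrow> x \<in> U \<Longrightarrow> bij_betw (\<tau> x) (G x) (coords k)"
  using triv by blast+

lemma sections_add:
  assumes "s \<in> sections A G F" "t \<in> sections A G F"
  shows "(\<lambda>x. s x + t x) \<in> sections A G F"
proof (rule sectionsI)
  fix U k \<tau> i assume U: "(U, k, \<tau>) \<in> F" "i < k"
  show "smooth_fun_on A U (\<lambda>x. \<tau> x (s x + t x) i)"
    by (rule smooth_fun_on_cong[OF smooth_fun_on_add[OF triv_open[OF U(1)] section_coordinate[OF assms(1) U]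
            section_coordinate[OF assms(2) U]] triv_open[OF U(1)]])
      (simp add: lin_on_add[OF triv_lin[OF U(1)]] section_fibre assms)
qed (intro subspace_add[OF fibre_subspace] section_fibre assms)

lemma sections_scale:
  assumes "f \<in> smooth_funs A" "s \<in> sections A G F"
  shows "(\<lambda>x. f x *\<^sub>R s x) \<in> sections A G F"
proof (rule sectionsI)
  fix U k \<tau> i assume U: "(U, k, \<tau>) \<in> F" "i < k"
  show "smooth_fun_on A U (\<lambda>x. \<tau> x (f x *\<^sub>R s x) i)"
    by (rule smooth_fun_on_cong[OF smooth_fun_on_mult[OF triv_open[OF U(1)] smooth_funs_on[OF assms(1)]
            section_coordinate[OF assms(2) U]] triv_open[OF U(1)]])
      (simp add: lin_on_scale[OF triv_lin[OF U(1)]] section_fibre assms)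
qed (intro subspace_scale[OF fibre_subspace] section_fibre assms)

lemma sections_uminus: "s \<in> sections A G F \<Longrightarrow> (\<lambda>x. - s x) \<in> sections A G F"
  using sections_scale[of "\<lambda>x. -1" s] by simp

lemma sections_diff:
  "s \<in> sections A G F \<Longrightarrow> t \<in> sections A G F \<Longrightarrow> (\<lambda>x. s x - t x) \<in> sections A G F"
  using sections_add[OF _ sections_uminus[of t]] by simp

text \<open>The section has constant coordinates in one trivialisation, multiplied by a bump
  function. Near points of that domain compatibility of trivialisations gives smoothness; elsewhere
  the section is 0 off the closed support.\<close>

lemma section_extend:
  assumes "r \<in> G p" obtains s where "s \<in> sections A G F" "s p = r"
proof -
  have "p \<in> (\<Union>(U, k, \<tau>)\<in>F. U)" using triv_cover by simp
  then obtain U k \<tau> where U: "(U, k, \<tau>) \<in> F" "p \<in> U" by (auto split: prod.splits)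
  obtain b where b: "bump_in U b" "b p \<noteq> 0" by (rule bump_in_exists[OF triv_open[OF U(1)] U(2)])
  obtain K where K: "closed K" "K \<subseteq> U" "\<And>x. x \<notin> K \<Longrightarrow> b x = 0"
    using b(1) unfolding bump_in_def by blast
  define c where "c = \<tau> p r"
  have c: "c \<in> coords k" using lin_on_in[OF triv_lin[OF U] assms] by (simp add: c_def)
  let ?\<delta> = "\<lambda>j l. if l = j then 1 else (0::real)"
  \<comment> \<open>The local frame of standard coordinate vectors, in the form in which
    \<open>triv_compatible\<close> asserts its smoothness.\<close>
  define e where "e = (\<lambda>j x. inv_into (G x) (\<tau> x) (?\<delta> j))"
  have e: "e j x \<in> G x" "\<tau> x (e j x) = ?\<delta> j" if "x \<in> U" "j < k" for x j
  proof -
    have "?\<delta> j \<in> \<tau> x ` G x"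
      using triv_bij[OF U(1) that(1)] that(2) by (auto simp: bij_betw_def coords_def)
    then show "e j x \<in> G x" "\<tau> x (e j x) = ?\<delta> j"
      unfolding e_def by (rule inv_into_into, rule f_inv_into_f)
  qed
  define s where "s = (\<lambda>x. if x \<in> U then (b x / b p) *\<^sub>R (\<Sum>j<k. c j *\<^sub>R e j x) else 0)"
  have sG: "s x \<in> G x" for x
    using e by (auto simp: s_def intro!: subspace_scale subspace_sum subspace_0 fibre_subspace)
  show thesis
  proof (rule that)
    have "\<tau> p (\<Sum>j<k. c j *\<^sub>R e j p) = (\<Sum>j<k. c j *\<^sub>R ?\<delta> j)"
      using lin_on_sum[OF triv_lin[OF U] fibre_subspace, of "{..<k}" "\<lambda>j. e j p" c] e[OF U(2)] by simp
    also have "\<dots> = c"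
      using c by (auto simp: fun_eq_iff sum_fun_apply coords_def if_distrib[of "(*) _"] cong: if_cong)
    finally have "\<tau> p (\<Sum>j<k. c j *\<^sub>R e j p) = \<tau> p r" by (simp add: c_def)
    moreover have "(\<Sum>j<k. c j *\<^sub>R e j p) \<in> G p"
      using e[OF U(2)] by (intro subspace_sum subspace_scale fibre_subspace) auto
    ultimately have "(\<Sum>j<k. c j *\<^sub>R e j p) = r"
      using inj_onD[OF bij_betw_imp_inj_on[OF triv_bij[OF U]]] assms by blast
    then show "s p = r" using U b by (simp add: s_def)
    show "s \<in> sections A G F"
    proof (rule sectionsI[OF sG], rule smooth_fun_on_local)
      fix U' k' \<tau>' i x assume U': "(U', k', \<tau>') \<in> F" "i < k'" "x \<in> U'"
      show "\<exists>T. open T \<and> x \<in> T \<and> smooth_fun_on A T (\<lambda>x. \<tau>' x (s x) i)"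
      proof (cases "x \<in> U")
        case True
        have o: "open (U \<inter> U')" using triv_open U U' by blast
        have "smooth_fun_on A (U \<inter> U') (\<lambda>x. (b x * (1 / b p)) * (\<Sum>j<k. c j * \<tau>' x (e j x) i))"
          using triv_compatible[OF U(1) U'(1,2)]
          by (intro smooth_fun_on_mult smooth_fun_on_sum o smooth_funs_on[OF bump_in_smooth[OF b(1)]] smooth_fun_on_const)
            (auto simp: e_def)
        then have "smooth_fun_on A (U \<inter> U') (\<lambda>x. \<tau>' x (s x) i)"
        proof (rule smooth_fun_on_cong[OF _ o])
          fix x assume x: "x \<in> U \<inter> U'"
          have "(\<Sum>j<k. c j *\<^sub>R e j x) \<in> G x"
            using x e by (intro subspace_sum subspace_scale fibre_subspace) auto
          moreover have "\<tau>' x (\<Sum>j<k. c j *\<^sub>R e j x) = (\<Sum>j<k. c j *\<^sub>R \<tau>' x (e j x))"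
            by (rule lin_on_sum[OF triv_lin[OF U'(1)] fibre_subspace]) (use x e in auto)
          ultimately show "(b x * (1 / b p)) * (\<Sum>j<k. c j * \<tau>' x (e j x) i) = \<tau>' x (s x) i"
            using x lin_on_scale[OF triv_lin[OF U'(1)], of x] by (simp add: s_def sum_fun_apply)
        qed
        then show ?thesis using True U' o by (intro exI[of _ "U \<inter> U'"]) auto
      next
        case False
        have o: "open (U' - K)" using triv_open[OF U'(1)] K(1) by blast
        have "smooth_fun_on A (U' - K) (\<lambda>x. \<tau>' x (s x) i)"
          by (rule smooth_fun_on_cong[OF smooth_fun_on_const[of _ 0] o])
            (use K(3) lin_on_0[OF triv_lin[OF U'(1)] sG] in \<open>auto simp: s_def\<close>)
        then show ?thesis using False U' K(2) o by (intro exI[of _ "U' - K"]) auto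
      qed
    qed
  qed
qed

end

section \<open>Complexification\<close>

lemma cx_sections_iff:
  "s \<in> cx_sections \<Gamma> \<longleftrightarrow> (\<lambda>x. fst (s x)) \<in> \<Gamma> \<and> (\<lambda>x. snd (s x)) \<in> \<Gamma>"
  by (simp add: cx_sections_def o_def)

lemma bilin_lin_right: "bilin_on V W b \<Longrightarrow> u \<in> V \<Longrightarrow> lin_on V W (b u)"
  and bilin_lin_left: "bilin_on V W b \<Longrightarrow> u \<in> V \<Longrightarrow> lin_on V W (\<lambda>v. b v u)"
  by (auto simp: bilin_on_def)

context
  fixes V :: "'a::real_vector set" and W :: "'b::real_vector set" and b
  assumes b: "bilin_on V W b" and V: "subspace V" and W: "subspace W"
begin

lemma bilin_in: "u \<in> V \<Longrightarrow> v \<in> V \<Longrightarrow> b u v \<in> W"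
  using bilin_lin_right[OF b] lin_on_in by blast

lemma bilin_simps:
  assumes "u \<in> V" "v \<in> V" "w \<in> V"
  shows "b (u + v) w = b u w + b v w" "b w (u + v) = b w u + b w v"
    "b (u - v) w = b u w - b v w" "b w (u - v) = b w u - b w v"
  using lin_on_add[OF bilin_lin_left[OF b assms(3)] assms(1,2)]
    lin_on_add[OF bilin_lin_right[OF b assms(3)] assms(1,2)]
    lin_on_diff[OF bilin_lin_left[OF b assms(3)] V assms(1,2)]
    lin_on_diff[OF bilin_lin_right[OF b assms(3)] V assms(1,2)] by auto

lemma bilin_scale:
  assumes "u \<in> V" "w \<in> V"
  shows "b (c *\<^sub>R u) w = c *\<^sub>R b u w" "b w (c *\<^sub>R u) = c *\<^sub>R b w u"
  using lin_on_scale[OF bilin_lin_left[OF b assms(2)] assms(1)]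
    lin_on_scale[OF bilin_lin_right[OF b assms(2)] assms(1)] by auto

lemma cx2_in: "u \<in> V \<times> V \<Longrightarrow> v \<in> V \<times> V \<Longrightarrow> cx2 b u v \<in> W \<times> W"
  by (auto simp: cx2_def intro!: subspace_diff[OF W] subspace_add[OF W] bilin_in)

lemma cx2_linear:
  assumes "u \<in> V \<times> V" "v \<in> V \<times> V" "w \<in> V \<times> V"
  shows "cx2 b (u + v) w = cx2 b u w + cx2 b v w" "cx2 b w (u + v) = cx2 b w u + cx2 b w v"
    "cx2 b (u - v) w = cx2 b u w - cx2 b v w" "cx2 b w (u - v) = cx2 b w u - cx2 b w v"
  using assms by (auto simp: cx2_def bilin_simps prod_eq_iff)

lemma cx2_scale:
  assumes "u \<in> V \<times> V" "w \<in> V \<times> V"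
  shows "cx2 b (r *\<^sub>R u) w = r *\<^sub>R cx2 b u w" "cx2 b w (r *\<^sub>R u) = r *\<^sub>R cx2 b w u"
    "cx2 b (cscale c u) w = cscale c (cx2 b u w)" "cx2 b w (cscale c u) = cscale c (cx2 b w u)"
  using assms
  by (auto simp: cx2_def cscale_def bilin_simps bilin_scale subspace_scale[OF V] prod_eq_iff
      scaleR_add_right scaleR_diff_right)

lemma cx2_sym: "(\<And>u v. u \<in> V \<Longrightarrow> v \<in> V \<Longrightarrow> b u v = b v u) \<Longrightarrow> u \<in> V \<times> V \<Longrightarrow> v \<in> V \<times> V
    \<Longrightarrow> cx2 b u v = cx2 b v u"
  by (auto simp: cx2_def)

lemma cx2_skew: "(\<And>u v. u \<in> V \<Longrightarrow> v \<in> V \<Longrightarrow> b u v = - b v u) \<Longrightarrow> u \<in> V \<times> V \<Longrightarrow> v \<in> V \<times> V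
    \<Longrightarrow> cx2 b u v = - cx2 b v u"
proof -
  assume skew: "\<And>u v. u \<in> V \<Longrightarrow> v \<in> V \<Longrightarrow> b u v = - b v u" and uv: "u \<in> V \<times> V" "v \<in> V \<times> V"
  have m: "fst u \<in> V" "snd u \<in> V" "fst v \<in> V" "snd v \<in> V" using uv by (auto simp: mem_Times_iff)
  show ?thesis
    using skew[OF m(1,3)] skew[OF m(2,4)] skew[OF m(1,4)] skew[OF m(2,3)] by (simp add: cx2_def)
qed

end

lemma cscale_of_real: "cscale (complex_of_real c) u = c *\<^sub>R u"
  by (simp add: cscale_def prod_eq_iff)

lemma cx_subspace_scaleR: "cx.subspace S \<Longrightarrow> u \<in> S \<Longrightarrow> c *\<^sub>R u \<in> S"
  using cx.subspace_scale[of S u "complex_of_real c"] by (simp add: cscale_of_real)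

lemma cx_subspace_Times: "subspace V \<Longrightarrow> cx.subspace (V \<times> V)"
  by (rule cx.subspaceI)
    (auto simp: cscale_def zero_prod_def subspace_0 subspace_add subspace_diff subspace_scale)

section \<open>Complexified evaluation, Lie bracket and derivative\<close>

abbreviation evC :: "('a \<Rightarrow> real) cx \<Rightarrow> 'a cx \<Rightarrow> real cx" where
  "evC \<equiv> cx2 (\<lambda>\<xi> v. \<xi> v)"

abbreviation lieC :: "('m \<Rightarrow> 'm tvec cx) \<Rightarrow> ('m \<Rightarrow> 'm tvec cx) \<Rightarrow> 'm \<Rightarrow> 'm tvec cx" where
  "lieC \<equiv> cx2_sec lie_bracket"

abbreviation derC :: "('m \<Rightarrow> 'm tvec cx) \<Rightarrow> ('m \<Rightarrow> real cx) \<Rightarrow> 'm \<Rightarrow> real cx" where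
  "derC \<equiv> cx2_sec fderiv"

text \<open>The value is a genuine \<open>complex\<close>, so that it can act as a scalar through
  \<open>cscale\<close>. Real test functions are enough, since they see the real and imaginary parts
  of a complex vector separately.\<close>

definition dC :: "'m tvec cx \<Rightarrow> ('m \<Rightarrow> real) \<Rightarrow> complex" where
  "dC w f = Complex (fst w f) (snd w f)"

lemma dC_add: "dC (v + w) f = dC v f + dC w f"
  and dC_diff: "dC (v - w) f = dC v f - dC w f"
  and dC_zero: "dC 0 f = 0"
  and dC_cscale: "dC (cscale c w) f = c * dC w f"
  by (simp_all add: dC_def cscale_def complex_eq_iff)

lemma dC_sum: "dC (\<Sum>i\<in>I. w i) f = (\<Sum>i\<in>I. dC (w i) f)"
  by (induction I rule: infinite_finite_induct) (auto simp: dC_add dC_zero)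

lemma dC_eqI: "(\<And>f. dC v f = dC w f) \<Longrightarrow> v = w"
  by (auto simp: dC_def prod_eq_iff)

lemma lieC_antisym: "lieC X Y x = - lieC Y X x"
  by (simp add: cx2_sec_def prod_eq_iff)
    (auto simp: lie_bracket_def fun_eq_iff)

context smooth_manifold
begin

abbreviation "CF \<equiv> cx_sections (smooth_funs A)"
abbreviation "CV \<equiv> cx_sections (vector_fields A)"
abbreviation "CO \<equiv> cx_sections (one_forms A)"
abbreviation "TC x \<equiv> tangent_space A x \<times> tangent_space A x"

lemma CV_tangent: "X \<in> CV \<Longrightarrow> X x \<in> TC x"
  using vector_field_tangent[of "\<lambda>x. fst (X x)"] vector_field_tangent[of "\<lambda>x. snd (X x)"]
  by (auto simp: cx_sections_iff mem_Times_iff)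

lemma CV_parts:
  assumes "X \<in> CV"
  shows "fst \<circ> X \<in> vector_fields A" "snd \<circ> X \<in> vector_fields A"
    "fst (X x) \<in> tangent_space A x" "snd (X x) \<in> tangent_space A x"
  using assms CV_tangent[OF assms, of x] by (auto simp: cx_sections_def mem_Times_iff)

lemma CF_parts:
  assumes "f \<in> CF" shows "(\<lambda>x. fst (f x)) \<in> smooth_funs A" "(\<lambda>x. snd (f x)) \<in> smooth_funs A"
  using assms by (auto simp: cx_sections_iff)

lemma lieC_in: "X \<in> CV \<Longrightarrow> Y \<in> CV \<Longrightarrow> lieC X Y \<in> CV"
  unfolding cx_sections_def[of "vector_fields A"] cx2_sec_def
  by (auto simp: o_def intro!: vector_fields_add vector_fields_diff lie_bracket_vector_field)

lemma CV_scale: "f \<in> smooth_funs A \<Longrightarrow> X \<in> CV \<Longrightarrow> (\<lambda>x. f x *\<^sub>R X x) \<in> CV"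
  by (simp add: cx_sections_iff vector_fields_scale)

lemma CF_scale: "f \<in> smooth_funs A \<Longrightarrow> g \<in> CF \<Longrightarrow> (\<lambda>x. f x *\<^sub>R g x) \<in> CF"
  by (simp add: cx_sections_iff smooth_funs_mult)

lemma CF_add: "f \<in> CF \<Longrightarrow> g \<in> CF \<Longrightarrow> (\<lambda>x. f x + g x) \<in> CF"
  by (simp add: cx_sections_iff smooth_funs_add)

lemma derC_add:
  assumes "X \<in> CV" "f \<in> CF" "g \<in> CF"
  shows "derC X (\<lambda>y. f y + g y) x = derC X f x + derC X g x"
  by (simp add: cx2_sec_def fderiv_def o_def tangent_add[OF CV_parts(3)[OF assms(1)]] tangent_add[OF CV_parts(4)[OF assms(1)]]
      CF_parts[OF assms(2)] CF_parts[OF assms(3)])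

lemma derC_diff:
  assumes "X \<in> CV" "f \<in> CF" "g \<in> CF"
  shows "derC X (\<lambda>y. f y - g y) x = derC X f x - derC X g x"
  by (simp add: cx2_sec_def fderiv_def o_def tangent_diff[OF CV_parts(3)[OF assms(1)]] tangent_diff[OF CV_parts(4)[OF assms(1)]]
      CF_parts[OF assms(2)] CF_parts[OF assms(3)])

lemma derC_uminus:
  assumes "X \<in> CV" "f \<in> CF"
  shows "derC X (\<lambda>y. - f y) x = - derC X f x"
  by (simp add: cx2_sec_def fderiv_def o_def tangent_uminus[OF CV_parts(3)[OF assms(1)]] tangent_uminus[OF CV_parts(4)[OF assms(1)]]
      CF_parts[OF assms(2)] )

lemma derC_mult:
  assumes "X \<in> CV" "g \<in> CF" "f \<in> smooth_funs A"
  shows "derC X (\<lambda>y. f y *\<^sub>R g y) x = cscale (dC (X x) f) (g x) + f x *\<^sub>R derC X g x"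
  by (simp add: cx2_sec_def fderiv_def o_def tangent_mult[OF CV_parts(3)[OF assms(1)]] tangent_mult[OF CV_parts(4)[OF assms(1)]]
      CF_parts[OF assms(2)] assms(3) cscale_def dC_def algebra_simps)

lemma derC_const_scale:
  assumes "X \<in> CV" "g \<in> CF"
  shows "derC X (\<lambda>y. c *\<^sub>R g y) x = c *\<^sub>R derC X g x"
  by (simp add: cx2_sec_def fderiv_def o_def tangent_scale[OF CV_parts(3)[OF assms(1)]] tangent_scale[OF CV_parts(4)[OF assms(1)]]
      CF_parts[OF assms(2)] algebra_simps)

lemma derC_scale_field: "derC (\<lambda>x. f x *\<^sub>R X x) g x = f x *\<^sub>R derC X g x"
  by (simp add: cx2_sec_def fderiv_def o_def algebra_simps)

lemma lieC_scale_left: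
  assumes "f \<in> smooth_funs A" "X \<in> CV" "Y \<in> CV"
  shows "lieC (\<lambda>x. f x *\<^sub>R X x) Y x = f x *\<^sub>R lieC X Y x - cscale (dC (Y x) f) (X x)"
proof -
  have *: "fst \<circ> (\<lambda>x. f x *\<^sub>R X x) = (\<lambda>x. f x *\<^sub>R (fst \<circ> X) x)"
    "snd \<circ> (\<lambda>x. f x *\<^sub>R X x) = (\<lambda>x. f x *\<^sub>R (snd \<circ> X) x)" by auto
  show ?thesis
    unfolding cx2_sec_def * lie_bracket_scale_left[OF assms(1) CV_parts(1)[OF assms(2)] CV_parts(1)[OF assms(3)]]
      lie_bracket_scale_left[OF assms(1) CV_parts(2)[OF assms(2)] CV_parts(1)[OF assms(3)]]
      lie_bracket_scale_left[OF assms(1) CV_parts(1)[OF assms(2)] CV_parts(2)[OF assms(3)]]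
      lie_bracket_scale_left[OF assms(1) CV_parts(2)[OF assms(2)] CV_parts(2)[OF assms(3)]]
    by (simp add: cscale_def dC_def prod_eq_iff scaleR_diff_right scaleR_add_right)
qed

end

subsection \<open>The Dorfman bracket\<close>

context standard_courant_algebroid
begin

abbreviation "CS \<equiv> cx_sections (sections A G F)"
abbreviation "CE \<equiv> cx_sections (courant_sections A G F)"
abbreviation "GC x \<equiv> G x \<times> G x"
abbreviation "ipC x \<equiv> cx2 (ip x)"
abbreviation "brC x \<equiv> cx2 (br x)"
abbreviation "nabC \<equiv> cx2_sec (cov nabla)"
abbreviation "RC x \<equiv> cx2 (R x)"

lemmas ip_simps = bilin_simps[OF ip_bilinear fibre_subspace subspace_UNIV]
lemmas ip_scale = bilin_scale[OF ip_bilinear fibre_subspace subspace_UNIV]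
lemmas R_scale = bilin_scale[OF R_bilinear tangent_subspace fibre_subspace]
lemmas R_simps = bilin_simps[OF R_bilinear tangent_subspace fibre_subspace]
lemmas br_in = bilin_in[OF br_bilinear fibre_subspace fibre_subspace]
lemmas R_in = bilin_in[OF R_bilinear tangent_subspace fibre_subspace]
lemmas ipC_linear = cx2_linear[OF ip_bilinear fibre_subspace subspace_UNIV]
lemmas ipC_scale = cx2_scale[OF ip_bilinear fibre_subspace subspace_UNIV]
lemmas brC_scale = cx2_scale[OF br_bilinear fibre_subspace fibre_subspace]
lemmas RC_scale = cx2_scale[OF R_bilinear tangent_subspace fibre_subspace]
lemmas brC_linear = cx2_linear[OF br_bilinear fibre_subspace fibre_subspace]
lemmas brC_in = cx2_in[OF br_bilinear fibre_subspace fibre_subspace]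
lemmas RC_in = cx2_in[OF R_bilinear tangent_subspace fibre_subspace]
lemma ipC_sym: "u \<in> GC x \<Longrightarrow> v \<in> GC x \<Longrightarrow> ipC x u v = ipC x v u"
  by (rule cx2_sym[OF ip_bilinear fibre_subspace subspace_UNIV]) (rule ip_symmetric)
lemma RC_skew: "u \<in> TC x \<Longrightarrow> v \<in> TC x \<Longrightarrow> RC x u v = - RC x v u"
  by (rule cx2_skew[OF R_bilinear tangent_subspace fibre_subspace]) (rule R_skew)

lemma br_skew: assumes "a \<in> G x" "b \<in> G x" shows "br x a b = - br x b a"
proof -
  have "br x (a + b) (a + b) = 0" "br x a a = 0" "br x b b = 0"
    using assms br_alternating subspace_add[OF fibre_subspace] by blast+
  then have "br x a b + br x b a = 0"
    using assms by (simp add: bilin_simps[OF br_bilinear fibre_subspace fibre_subspace] subspace_add[OF fibre_subspace] add.commute)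
  then show ?thesis by (rule eq_neg_iff_add_eq_0[THEN iffD2])
qed

lemma brC_skew: "u \<in> GC x \<Longrightarrow> v \<in> GC x \<Longrightarrow> brC x u v = - brC x v u"
  by (rule cx2_skew[OF br_bilinear fibre_subspace fibre_subspace]) (rule br_skew)

lemma ipC_invariant:
  assumes "a \<in> GC x" "b \<in> GC x" "c \<in> GC x"
  shows "ipC x (brC x a b) c = - ipC x b (brC x a c)"
proof -
  have *: "ip x (br x a b) c = - ip x b (br x a c)" if "a \<in> G x" "b \<in> G x" "c \<in> G x" for a b c
    using ip_invariant[OF that] by simp
  show ?thesis
    using assms by (auto simp: cx2_def ip_simps br_in subspace_add[OF fibre_subspace] subspace_diff[OF fibre_subspace] *)
qed

lemma CS_fibre: "s \<in> CS \<Longrightarrow> s x \<in> GC x"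
  using section_fibre[of "\<lambda>x. fst (s x)"] section_fibre[of "\<lambda>x. snd (s x)"]
  by (auto simp: cx_sections_iff mem_Times_iff)

lemma CS_parts:
  assumes "s \<in> CS"
  shows "fst \<circ> s \<in> sections A G F" "snd \<circ> s \<in> sections A G F" "fst (s x) \<in> G x" "snd (s x) \<in> G x"
    "(\<lambda>x. fst (s x)) \<in> sections A G F" "(\<lambda>x. snd (s x)) \<in> sections A G F"
  using assms CS_fibre[OF assms, of x] by (auto simp: cx_sections_def o_def mem_Times_iff)

lemma CS_add: "s \<in> CS \<Longrightarrow> t \<in> CS \<Longrightarrow> (\<lambda>x. s x + t x) \<in> CS"
  and CS_diff: "s \<in> CS \<Longrightarrow> t \<in> CS \<Longrightarrow> (\<lambda>x. s x - t x) \<in> CS"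
  by (simp_all add: cx_sections_iff sections_add sections_diff)

lemma ipC_smooth: "s \<in> CS \<Longrightarrow> t \<in> CS \<Longrightarrow> (\<lambda>x. ipC x (s x) (t x)) \<in> CF"
  by (auto simp: cx_sections_iff cx2_def intro!: smooth_funs_add smooth_funs_diff ip_smooth)

lemma brC_smooth: "s \<in> CS \<Longrightarrow> t \<in> CS \<Longrightarrow> (\<lambda>x. brC x (s x) (t x)) \<in> CS"
  by (auto simp: cx_sections_iff cx2_def intro!: sections_add sections_diff br_smooth)

lemma nabC_smooth:
  assumes "X \<in> CV" "s \<in> CS" shows "nabC X s \<in> CS"
proof -
  note X = CV_parts(1,2)[OF assms(1)] and s = CS_parts(1,2)[OF assms(2)]
  show ?thesis
    using sections_diff[OF nabla_smooth[OF X(1) s(1)] nabla_smooth[OF X(2) s(2)]]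
      sections_add[OF nabla_smooth[OF X(1) s(2)] nabla_smooth[OF X(2) s(1)]]
    by (simp add: cx_sections_iff cx2_sec_def)
qed

lemma nabla_in: "s \<in> sections A G F \<Longrightarrow> v \<in> tangent_space A x \<Longrightarrow> nabla x v s \<in> G x"
  using lin_on_in[OF nabla_tensorial] .

lemma nabC_add:
  assumes "X \<in> CV" "s \<in> CS" "t \<in> CS"
  shows "nabC X (\<lambda>y. s y + t y) x = nabC X s x + nabC X t x"
  by (simp add: cx2_sec_def cov_def o_def nabla_add[OF CV_parts(3)[OF assms(1)]] nabla_add[OF CV_parts(4)[OF assms(1)]]
      CS_parts[OF assms(2)] CS_parts[OF assms(3)])

lemma nabC_mult:
  assumes "X \<in> CV" "s \<in> CS" "f \<in> smooth_funs A"
  shows "nabC X (\<lambda>y. f y *\<^sub>R s y) x = cscale (dC (X x) f) (s x) + f x *\<^sub>R nabC X s x"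
  by (simp add: cx2_sec_def cov_def o_def nabla_leibniz[OF CV_parts(3)[OF assms(1)]] nabla_leibniz[OF CV_parts(4)[OF assms(1)]]
      CS_parts[OF assms(2)] assms(3) cscale_def dC_def scaleR_add_right scaleR_diff_right)

lemma nabC_scale_field:
  assumes "X \<in> CV" "s \<in> CS"
  shows "nabC (\<lambda>x. f x *\<^sub>R X x) s x = f x *\<^sub>R nabC X s x"
  by (simp add: cx2_sec_def cov_def o_def lin_on_scale[OF nabla_tensorial] CS_parts[OF assms(2)]
      CV_parts[OF assms(1)] scaleR_add_right scaleR_diff_right)

lemma derC_ipC:
  assumes "X \<in> CV" "s \<in> CS" "t \<in> CS"
  shows "derC X (\<lambda>y. ipC y (s y) (t y)) x = ipC x (nabC X s x) (t x) + ipC x (s x) (nabC X t x)"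
proof -
  have sm: "(\<lambda>y. ip y (f y) (g y)) \<in> smooth_funs A" if "f \<in> sections A G F" "g \<in> sections A G F" for f g
    using that by (rule ip_smooth)
  note [simp] = tangent_add[OF CV_parts(3)[OF assms(1)] ip_smooth ip_smooth]
    tangent_add[OF CV_parts(4)[OF assms(1)] ip_smooth ip_smooth]
    tangent_diff[OF CV_parts(3)[OF assms(1)] ip_smooth ip_smooth]
    tangent_diff[OF CV_parts(4)[OF assms(1)] ip_smooth ip_smooth]
    nabla_ip[OF CV_parts(3)[OF assms(1)]] nabla_ip[OF CV_parts(4)[OF assms(1)]]
    CS_parts[OF assms(2)] CS_parts[OF assms(3)] ip_simps nabla_in
    CV_parts[OF assms(1)] subspace_add[OF fibre_subspace] subspace_diff[OF fibre_subspace]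
  show ?thesis
    by (simp add: cx2_def cx2_sec_def cov_def fderiv_def o_def)
qed

text \<open>The summand of the cotangent part of the bracket that is not made of Lie derivatives and
  differentials. It is linear in \<open>w\<close> pointwise, so its smoothness can be checked by
  evaluation.\<close>

definition dorfman_tensor where
  "dorfman_tensor X r Y s x = (\<lambda>w. if w \<in> tangent_space A x
     then H x (X x) (Y x) w - 2 * ip x (R x (X x) w) (s x)
       + 2 * ip x (R x (Y x) w) (r x) + 2 * ip x (nabla x w r) (s x) else 0)"

lemma dorfman_tensor_one_form:
  assumes X: "X \<in> vector_fields A" and Y: "Y \<in> vector_fields A"
    and r: "r \<in> sections A G F" and s: "s \<in> sections A G F"
  shows "dorfman_tensor X r Y s \<in> one_forms A"
  unfolding one_forms_def dual_space_def
proof (intro CollectI conjI allI ballI impI)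
  fix x
  have XY: "X x \<in> tangent_space A x" "Y x \<in> tangent_space A x" using X Y vector_field_tangent by blast+
  have rs: "r x \<in> G x" "s x \<in> G x" using r s section_fibre by blast+
  note lin = lin_on_add[OF bilin_lin_right[OF H_linear]] lin_on_scale[OF bilin_lin_right[OF H_linear]]
    R_simps ip_simps R_scale ip_scale R_in nabla_in lin_on_add[OF nabla_tensorial] lin_on_scale[OF nabla_tensorial]
    subspace_add[OF tangent_subspace] subspace_scale[OF tangent_subspace]
  show "lin_on (tangent_space A x) UNIV (dorfman_tensor X r Y s x)"
    unfolding lin_on_def dorfman_tensor_def by (auto simp: lin XY rs r s algebra_simps)
next
  fix Z assume Z: "Z \<in> vector_fields A"
  have "(\<lambda>x. H x (X x) (Y x) (Z x) - 2 * ip x (R x (X x) (Z x)) (s x)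
       + 2 * ip x (R x (Y x) (Z x)) (r x) + 2 * ip x (cov nabla Z r x) (s x)) \<in> smooth_funs A"
    by (intro smooth_funs_intros H_smooth ip_smooth R_smooth nabla_smooth X Y Z r s)
  then show "(\<lambda>x. dorfman_tensor X r Y s x (Z x)) \<in> smooth_funs A"
    using vector_field_tangent[OF Z] by (simp add: dorfman_tensor_def cov_def)
qed (simp add: dorfman_tensor_def)

lemma courant_section_parts:
  assumes "u \<in> courant_sections A G F"
  shows "(\<lambda>x. prT (u x)) \<in> vector_fields A" "(\<lambda>x. prF (u x)) \<in> one_forms A"
    "(\<lambda>x. prG (u x)) \<in> sections A G F"
  using assms by (auto simp: courant_sections_def)

lemma dorfman_section:
  assumes u: "u \<in> courant_sections A G F" and v: "v \<in> courant_sections A G F"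
  shows "dorfman A br ip nabla R H u v \<in> courant_sections A G F"
proof -
  note U = courant_section_parts[OF u] and V = courant_section_parts[OF v]
  have "(\<lambda>x. lie_derivative A (\<lambda>x. prT (u x)) (\<lambda>x. prF (v x)) x
      + (d_fun A (\<lambda>y. prF (u y) (prT (v y))) x - lie_derivative A (\<lambda>x. prT (v x)) (\<lambda>x. prF (u x)) x)
      + dorfman_tensor (\<lambda>x. prT (u x)) (\<lambda>x. prG (u x)) (\<lambda>x. prT (v x)) (\<lambda>x. prG (v x)) x) \<in> one_forms A"
    using lie_derivative_spec[OF U(1) V(2)] lie_derivative_spec[OF V(1) U(2)]
    by (intro one_forms_add one_forms_diff d_fun_one_form[OF one_form_smooth[OF U(2) V(1)]] dorfman_tensor_one_form U V) auto
  moreover have "(\<lambda>x. R x (prT (u x)) (prT (v x)) + cov nabla (\<lambda>x. prT (u x)) (\<lambda>x. prG (v x)) x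
      - cov nabla (\<lambda>x. prT (v x)) (\<lambda>x. prG (u x)) x + br x (prG (u x)) (prG (v x))) \<in> sections A G F"
    by (rule sections_add[OF sections_diff[OF sections_add[OF R_smooth[OF U(1) V(1)] nabla_smooth[OF U(1) V(3)]]
          nabla_smooth[OF V(1) U(3)]] br_smooth[OF U(3) V(3)]])
  moreover have "(\<lambda>x. lie_bracket (\<lambda>x. prT (u x)) (\<lambda>x. prT (v x)) x) \<in> vector_fields A"
    using lie_bracket_vector_field[OF U(1) V(1)] .
  ultimately show ?thesis
    by (simp add: courant_sections_def dorfman_def dorfman_tensor_def[abs_def] Let_def)
qed

lemma dorfman_form:
  assumes u: "u \<in> courant_sections A G F" and v: "v \<in> courant_sections A G F" and Z: "Z \<in> vector_fields A"
  shows "prF (dorfman A br ip nabla R H u v x) (Z x) =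
    fderiv (\<lambda>x. prT (u x)) (\<lambda>y. prF (v y) (Z y)) x - prF (v x) (lie_bracket (\<lambda>x. prT (u x)) Z x)
    + fderiv Z (\<lambda>y. prF (u y) (prT (v y))) x
    - fderiv (\<lambda>x. prT (v x)) (\<lambda>y. prF (u y) (Z y)) x + prF (u x) (lie_bracket (\<lambda>x. prT (v x)) Z x)
    + H x (prT (u x)) (prT (v x)) (Z x) - 2 * ip x (R x (prT (u x)) (Z x)) (prG (v x))
    + 2 * ip x (R x (prT (v x)) (Z x)) (prG (u x)) + 2 * ip x (cov nabla Z (\<lambda>x. prG (u x)) x) (prG (v x))"
proof -
  note U = courant_section_parts[OF u] and V = courant_section_parts[OF v]
  show ?thesis
    using lie_derivative_spec[OF U(1) V(2)] lie_derivative_spec[OF V(1) U(2)] Z vector_field_tangent[OF Z]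
    by (simp add: dorfman_def Let_def d_fun_def fderiv_def cov_def)
qed

lemma CE_iff:
  "u \<in> CE \<longleftrightarrow> (\<lambda>x. cx1 prT (u x)) \<in> CV \<and> (\<lambda>x. cx1 prF (u x)) \<in> CO \<and> (\<lambda>x. cx1 prG (u x)) \<in> CS"
  by (auto simp: cx_sections_iff courant_sections_def cx1_def)

lemma courant_sections_add:
  assumes "u \<in> courant_sections A G F" "v \<in> courant_sections A G F"
  shows "(\<lambda>x. u x + v x) \<in> courant_sections A G F"
  using vector_fields_add[OF courant_section_parts(1)[OF assms(1)] courant_section_parts(1)[OF assms(2)]]
    one_forms_add[OF courant_section_parts(2)[OF assms(1)] courant_section_parts(2)[OF assms(2)]]
    sections_add[OF courant_section_parts(3)[OF assms(1)] courant_section_parts(3)[OF assms(2)]]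
  unfolding courant_sections_def by simp

lemma courant_sections_diff:
  assumes "u \<in> courant_sections A G F" "v \<in> courant_sections A G F"
  shows "(\<lambda>x. u x - v x) \<in> courant_sections A G F"
  using vector_fields_diff[OF courant_section_parts(1)[OF assms(1)] courant_section_parts(1)[OF assms(2)]]
    one_forms_diff[OF courant_section_parts(2)[OF assms(1)] courant_section_parts(2)[OF assms(2)]]
    sections_diff[OF courant_section_parts(3)[OF assms(1)] courant_section_parts(3)[OF assms(2)]]
  unfolding courant_sections_def by simp

lemma courant_sections_scale:
  assumes "f \<in> smooth_funs A" "u \<in> courant_sections A G F"
  shows "(\<lambda>x. f x *\<^sub>R u x) \<in> courant_sections A G F"
  using vector_fields_scale[OF assms(1) courant_section_parts(1)[OF assms(2)]]
    one_forms_scale[OF assms(1) courant_section_parts(2)[OF assms(2)]]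
    sections_scale[OF assms(1) courant_section_parts(3)[OF assms(2)]]
  unfolding courant_sections_def by simp

abbreviation "dorfmanC \<equiv> cx2_sec (dorfman A br ip nabla R H)"

lemma dorfmanC_in:
  assumes "u \<in> CE" "v \<in> CE" shows "dorfmanC u v \<in> CE"
proof -
  have *: "fst \<circ> u \<in> courant_sections A G F" "snd \<circ> u \<in> courant_sections A G F"
    "fst \<circ> v \<in> courant_sections A G F" "snd \<circ> v \<in> courant_sections A G F"
    using assms by (auto simp: cx_sections_def)
  show ?thesis
    using courant_sections_diff[OF dorfman_section[OF *(1,3)] dorfman_section[OF *(2,4)]]
      courant_sections_add[OF dorfman_section[OF *(1,4)] dorfman_section[OF *(2,3)]]
    by (simp add: cx_sections_iff cx2_sec_def)
qed

lemma dorfmanC_T: "cx1 prT (dorfmanC u v x) = lieC (\<lambda>x. cx1 prT (u x)) (\<lambda>x. cx1 prT (v x)) x"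
  by (simp add: cx1_def cx2_sec_def dorfman_def Let_def o_def)

lemma dorfmanC_G:
  "cx1 prG (dorfmanC u v x) = RC x (cx1 prT (u x)) (cx1 prT (v x))
    + nabC (\<lambda>x. cx1 prT (u x)) (\<lambda>x. cx1 prG (v x)) x - nabC (\<lambda>x. cx1 prT (v x)) (\<lambda>x. cx1 prG (u x)) x
    + brC x (cx1 prG (u x)) (cx1 prG (v x))"
  by (simp add: cx1_def cx2_sec_def cx2_def dorfman_def Let_def o_def)

text \<open>Evaluation on a field replaces Lie derivatives of forms by derivatives of functions, the
  shape in which the bracket can be compared with the Cartan formulas for \<open>\<sigma>\<close>
  and \<open>\<epsilon>\<close>.\<close>

lemma dorfmanC_F:
  assumes u: "u \<in> CE" and v: "v \<in> CE" and Z: "Z \<in> CV"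
  defines "X \<equiv> \<lambda>x. cx1 prT (u x)" and "Y \<equiv> \<lambda>x. cx1 prT (v x)"
    and "\<xi> \<equiv> \<lambda>x. cx1 prF (u x)" and "\<eta> \<equiv> \<lambda>x. cx1 prF (v x)"
    and "a \<equiv> \<lambda>x. cx1 prG (u x)" and "b \<equiv> \<lambda>x. cx1 prG (v x)"
  shows "evC (cx1 prF (dorfmanC u v x)) (Z x) =
    derC X (\<lambda>y. evC (\<eta> y) (Z y)) x - evC (\<eta> x) (lieC X Z x)
    + derC Z (\<lambda>y. evC (\<xi> y) (Y y)) x
    - derC Y (\<lambda>y. evC (\<xi> y) (Z y)) x + evC (\<xi> x) (lieC Y Z x)
    + cx3 (H x) (X x) (Y x) (Z x) - 2 *\<^sub>R ipC x (RC x (X x) (Z x)) (b x)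
    + 2 *\<^sub>R ipC x (RC x (Y x) (Z x)) (a x) + 2 *\<^sub>R ipC x (nabC Z a x) (b x)"
proof -
  obtain u1 u2 where u': "u = (\<lambda>x. (u1 x, u2 x))" "u1 \<in> courant_sections A G F" "u2 \<in> courant_sections A G F"
    using u by (intro that[of "fst \<circ> u" "snd \<circ> u"]) (auto simp: cx_sections_def)
  obtain v1 v2 where v': "v = (\<lambda>x. (v1 x, v2 x))" "v1 \<in> courant_sections A G F" "v2 \<in> courant_sections A G F"
    using v by (intro that[of "fst \<circ> v" "snd \<circ> v"]) (auto simp: cx_sections_def)
  obtain Z1 Z2 where Z': "Z = (\<lambda>x. (Z1 x, Z2 x))" "Z1 \<in> vector_fields A" "Z2 \<in> vector_fields A"
    using Z by (intro that[of "fst \<circ> Z" "snd \<circ> Z"]) (auto simp: cx_sections_def)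
  note uu = courant_section_parts[OF u'(2)] courant_section_parts[OF u'(3)]
  note vv = courant_section_parts[OF v'(2)] courant_section_parts[OF v'(3)]
  note lin = lin_on_add[OF one_form_lin] lin_on_diff[OF one_form_lin tangent_subspace]
  note [simp] = tangent_add[OF vector_field_tangent[OF uu(1)] one_form_smooth[OF vv(2) Z'(3)] one_form_smooth[OF vv(5) Z'(2)]]
    tangent_diff[OF vector_field_tangent[OF uu(1)] one_form_smooth[OF vv(2) Z'(2)] one_form_smooth[OF vv(5) Z'(3)]]
    tangent_add[OF vector_field_tangent[OF uu(4)] one_form_smooth[OF vv(2) Z'(3)] one_form_smooth[OF vv(5) Z'(2)]]
    tangent_diff[OF vector_field_tangent[OF uu(4)] one_form_smooth[OF vv(2) Z'(2)] one_form_smooth[OF vv(5) Z'(3)]]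
    tangent_add[OF vector_field_tangent[OF vv(1)] one_form_smooth[OF uu(2) Z'(3)] one_form_smooth[OF uu(5) Z'(2)]]
    tangent_diff[OF vector_field_tangent[OF vv(1)] one_form_smooth[OF uu(2) Z'(2)] one_form_smooth[OF uu(5) Z'(3)]]
    tangent_add[OF vector_field_tangent[OF vv(4)] one_form_smooth[OF uu(2) Z'(3)] one_form_smooth[OF uu(5) Z'(2)]]
    tangent_diff[OF vector_field_tangent[OF vv(4)] one_form_smooth[OF uu(2) Z'(2)] one_form_smooth[OF uu(5) Z'(3)]]
    tangent_add[OF vector_field_tangent[OF Z'(2)] one_form_smooth[OF uu(2) vv(4)] one_form_smooth[OF uu(5) vv(1)]]
    tangent_diff[OF vector_field_tangent[OF Z'(2)] one_form_smooth[OF uu(2) vv(1)] one_form_smooth[OF uu(5) vv(4)]]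
    tangent_add[OF vector_field_tangent[OF Z'(3)] one_form_smooth[OF uu(2) vv(4)] one_form_smooth[OF uu(5) vv(1)]]
    tangent_diff[OF vector_field_tangent[OF Z'(3)] one_form_smooth[OF uu(2) vv(1)] one_form_smooth[OF uu(5) vv(4)]]
    uu vv Z'(2,3) lie_bracket_tangent
    lin[OF uu(2)] lin[OF uu(5)] lin[OF vv(2)] lin[OF vv(5)]
    vector_field_tangent[OF uu(1)] vector_field_tangent[OF uu(4)]
    vector_field_tangent[OF vv(1)] vector_field_tangent[OF vv(4)]
    vector_field_tangent[OF Z'(2)] vector_field_tangent[OF Z'(3)]
    ip_simps R_in section_fibre[OF uu(3)] section_fibre[OF uu(6)] section_fibre[OF vv(3)] section_fibre[OF vv(6)]
    nabla_in subspace_add[OF fibre_subspace] subspace_diff[OF fibre_subspace]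
  show ?thesis
    unfolding X_def Y_def \<xi>_def \<eta>_def a_def b_def u'(1) v'(1) Z'(1)
    by (simp add: cx1_def cx2_sec_def cx2_def cx3_def o_def dorfman_form[OF _ _ Z'(2)] dorfman_form[OF _ _ Z'(3)] u' v'
        fderiv_def cov_def algebra_simps)
qed

end

lemma cx1_fst_linear:
  "cx1 fst (u + v) = cx1 fst u + cx1 fst v" "cx1 fst (u - v) = cx1 fst u - cx1 fst v"
  "cx1 fst (cscale c u) = cscale c (cx1 fst u)" "cx1 fst (r *\<^sub>R u) = r *\<^sub>R cx1 fst u" "cx1 fst 0 = 0"
  by (simp_all add: cx1_def cscale_def prod_eq_iff)

lemma cx1_fst_sum:
  fixes u :: "'i \<Rightarrow> ('a::real_vector \<times> 'b::real_vector) cx"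
  shows "cx1 fst (\<Sum>i\<in>I. u i) = (\<Sum>i\<in>I. cx1 fst (u i))"
  by (induction I rule: infinite_finite_induct) (auto simp: cx1_fst_linear)

lemma cx1_snd_snd_linear:
  "cx1 prG (u + v) = cx1 prG u + cx1 prG v" "cx1 prG (u - v) = cx1 prG u - cx1 prG v"
  "cx1 prG (cscale c u) = cscale c (cx1 prG u)" "cx1 prG (r *\<^sub>R u) = r *\<^sub>R cx1 prG u" "cx1 prG 0 = 0"
  by (simp_all add: cx1_def cscale_def prod_eq_iff)

section \<open>Complex multipliers and finiteness of tangent spaces\<close>

context smooth_manifold
begin

abbreviation smoothC :: "('m \<Rightarrow> complex) \<Rightarrow> bool" where
  "smoothC \<theta> \<equiv> (\<lambda>x. Re (\<theta> x)) \<in> smooth_funs A \<and> (\<lambda>x. Im (\<theta> x)) \<in> smooth_funs A"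

lemma smoothC_mult: "smoothC \<theta> \<Longrightarrow> smoothC \<rho> \<Longrightarrow> smoothC (\<lambda>x. \<theta> x * \<rho> x)"
  by (simp add: smooth_funs_diff smooth_funs_add smooth_funs_mult)

lemma smoothC_cnj: "smoothC \<theta> \<Longrightarrow> smoothC (\<lambda>x. cnj (\<theta> x))"
  by (simp add: smooth_funs_uminus)

lemma smoothC_dC:
  assumes "X \<in> CV" shows "smoothC (\<lambda>x. dC (X x) f)"
  using fderiv_smooth[OF CV_parts(1)[OF assms], of f] fderiv_smooth[OF CV_parts(2)[OF assms], of f]
  by (simp add: dC_def fderiv_def)

text \<open>The ambient space of functionals is infinite-dimensional in general, so a finite
  spanning set is needed before independent vectors can be counted against
  \<open>cx.dim\<close>.\<close>

lemma tangent_finite_span: "\<exists>B. finite B \<and> TC x \<subseteq> cx.span B"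
proof -
  obtain U \<phi> where U: "(U, \<phi>) \<in> A" "x \<in> U" by (rule chart_at)
  obtain C :: "'e set" where C: "orthogonal_basis C" by (rule basis)
  let ?D = "chart_derivative A U \<phi> x"
  define B where "B = (\<lambda>c. (?D c, 0::'m tvec)) ` C"
  have real: "(v, 0) \<in> cx.span B" if v: "v \<in> tangent_space A x" for v
  proof -
    obtain e where e: "v = ?D e" using v tangent_space_chart[OF U] by auto
    have "(v, 0) = (\<Sum>c\<in>C. cscale (complex_of_real ((e \<bullet> c) / (c \<bullet> c))) (?D c, 0::'m tvec))"
    proof -
      have "v = (\<Sum>c\<in>C. ((e \<bullet> c) / (c \<bullet> c)) *\<^sub>R ?D c)"
        using arg_cong[OF orthogonal_basis_expansion[OF C, of e], of ?D]
        by (simp only: e linear_sum[OF chart_derivative_linear[OF U]] linear_scale[OF chart_derivative_linear[OF U]])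
      then show ?thesis by (simp add: cscale_def prod_eq_iff fst_sum snd_sum del: of_real_divide)
    qed
    also have "\<dots> \<in> cx.span B"
      by (intro cx.span_sum cx.span_scale cx.span_base) (auto simp: B_def)
    finally show ?thesis .
  qed
  have "(v, w) \<in> cx.span B" if "v \<in> tangent_space A x" "w \<in> tangent_space A x" for v w
  proof -
    have "(v, w) = (v, 0) + cscale \<i> (w, 0)" by (simp add: cscale_def)
    then show ?thesis using real that by (metis cx.span_add cx.span_scale)
  qed
  moreover have "finite B" using C by (simp add: B_def orthogonal_basis_def)
  ultimately show ?thesis by blast
qed

lemma tangent_separated:
  assumes "v \<in> tangent_space A x" "\<And>f. f \<in> smooth_funs A \<Longrightarrow> v f = 0" shows "v = 0"
  using assms tangent_nonsmooth[OF assms(1)] by (metis ext zero_fun_apply)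

end

section \<open>The bundles \<open>L\<close>, \<open>W\<close> and \<open>D\<close> of a generalized
  almost complex structure\<close>

locale courant_almost_complex = standard_courant_algebroid A G F br ip nabla R H
  for A :: "('m::{t2_space,second_countable_topology}, 'e::real_inner) atlas"
    and G :: "'m \<Rightarrow> 'v::real_vector set"
    and F :: "('m, 'v) trivs"
    and br :: "'m \<Rightarrow> 'v \<Rightarrow> 'v \<Rightarrow> 'v"
    and ip :: "'m \<Rightarrow> 'v \<Rightarrow> 'v \<Rightarrow> real"
    and nabla :: "'m \<Rightarrow> 'm tvec \<Rightarrow> ('m \<Rightarrow> 'v) \<Rightarrow> 'v"
    and R :: "'m \<Rightarrow> 'm tvec \<Rightarrow> 'm tvec \<Rightarrow> 'v"
    and H :: "'m \<Rightarrow> 'm tvec \<Rightarrow> 'm tvec \<Rightarrow> 'm tvec \<Rightarrow> real" +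
  fixes J :: "'m \<Rightarrow> ('m, 'v) courant \<Rightarrow> ('m, 'v) courant"
    and W :: "'m \<Rightarrow> 'm tvec cx set"
    and D :: "'m \<Rightarrow> 'v cx set"
    and \<sigma> :: "'m \<Rightarrow> 'm tvec cx \<Rightarrow> 'v cx"
    and \<epsilon> :: "'m \<Rightarrow> 'm tvec cx \<Rightarrow> 'm tvec cx \<Rightarrow> real cx"
  assumes almost_complex: "generalized_almost_complex A G F ip J"
    and W_eq: "W x = cx1 prT ` holo_bundle A G J x"
    and D_eq: "D x = cx1 prG ` {u \<in> holo_bundle A G J x. cx1 prT u = 0}"
    and W_rank: "\<exists>k. \<forall>x. cx.dim (W x) = k"
    and \<sigma>_linear: "clin_on (W x) (G x \<times> G x) (\<sigma> x)"
    and \<sigma>_smooth: "X \<in> sub_sections (cx_sections (vector_fields A)) W \<Longrightarrow>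
      (\<lambda>x. \<sigma> x (X x)) \<in> cx_sections (sections A G F)"
    and \<epsilon>_linear: "w \<in> W x \<Longrightarrow> clin_on (W x) UNIV (\<epsilon> x w)"
    and \<epsilon>_skew: "v \<in> W x \<Longrightarrow> w \<in> W x \<Longrightarrow> \<epsilon> x v w = - \<epsilon> x w v"
    and \<epsilon>_smooth: "X \<in> sub_sections (cx_sections (vector_fields A)) W \<Longrightarrow>
      Y \<in> sub_sections (cx_sections (vector_fields A)) W \<Longrightarrow>
      (\<lambda>x. \<epsilon> x (X x) (Y x)) \<in> cx_sections (smooth_funs A)"
    and L_eq: "holo_bundle A G J x = L_bundle A G ip W D \<sigma> \<epsilon> x"
begin

abbreviation "E x \<equiv> courant_fibre A G x"
abbreviation "L x \<equiv> holo_bundle A G J x"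
abbreviation "\<Gamma>L \<equiv> sub_sections CE L"
abbreviation "\<Gamma>W \<equiv> sub_sections CV W"
abbreviation "\<Gamma>D \<equiv> sub_sections CS D"
abbreviation "ipE x \<equiv> courant_ip ip x"

subsection \<open>The bundle L\<close>

lemma E_subspace: "subspace (E x)"
  unfolding courant_fibre_def
  by (intro subspace_Times tangent_subspace dual_space_subspace fibre_subspace)

lemma J_lin: "lin_on (E x) (E x) (J x)"
  and J_J: "u \<in> E x \<Longrightarrow> J x (J x u) = - u"
  and J_skew: "u \<in> E x \<Longrightarrow> v \<in> E x \<Longrightarrow> ipE x (J x u) v + ipE x u (J x v) = 0"
  and J_smooth: "s \<in> courant_sections A G F \<Longrightarrow> (\<lambda>x. J x (s x)) \<in> courant_sections A G F"
  using almost_complex unfolding generalized_almost_complex_def by blast+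

lemmas J_in = lin_on_in[OF J_lin]

text \<open>The eigenvectors of \<open>J\<close> for \<i> are exactly the vectors
  \<open>a - \<i> J a\<close>. So \<open>L x\<close> is parametrised by the real fibre, and
  extending the real part of an element extends the element.\<close>

lemma L_iff: "u \<in> L x \<longleftrightarrow> fst u \<in> E x \<and> snd u = - J x (fst u)"
proof -
  have "u \<in> L x \<longleftrightarrow> fst u \<in> E x \<and> snd u \<in> E x \<and> J x (fst u) = - snd u \<and> J x (snd u) = fst u"
    by (auto simp: holo_bundle_def cx1_def cscale_def mem_Times_iff prod_eq_iff)
  also have "\<dots> \<longleftrightarrow> fst u \<in> E x \<and> snd u = - J x (fst u)"
  proof
    assume *: "fst u \<in> E x \<and> snd u = - J x (fst u)"
    then have "J x (fst u) \<in> E x" by (simp add: J_in)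
    then show "fst u \<in> E x \<and> snd u \<in> E x \<and> J x (fst u) = - snd u \<and> J x (snd u) = fst u"
      using * by (simp add: lin_on_uminus[OF J_lin] J_J subspace_neg[OF E_subspace])
  qed auto
  finally show ?thesis .
qed

lemma L_fibre: "u \<in> L x \<Longrightarrow> u \<in> E x \<times> E x"
  by (simp add: holo_bundle_def)

lemma L_subspace: "cx.subspace (L x)"
proof (rule cx.subspaceI)
  note J = lin_on_add[OF J_lin] lin_on_diff[OF J_lin E_subspace] lin_on_scale[OF J_lin] J_in J_J
    lin_on_uminus[OF J_lin]
  note E = subspace_add[OF E_subspace] subspace_diff[OF E_subspace] subspace_scale[OF E_subspace]
    subspace_neg[OF E_subspace]
  show "0 \<in> L x"
    using lin_on_0[OF J_lin subspace_0[OF E_subspace]] subspace_0[OF E_subspace] by (simp add: L_iff)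
  show "u + v \<in> L x" if "u \<in> L x" "v \<in> L x" for u v
    using that by (simp add: L_iff J E)
  show "cscale c u \<in> L x" if "u \<in> L x" for c u
    using that by (simp add: L_iff J E cscale_def)
qed

lemma courant_extend:
  assumes "a \<in> E p" obtains s where "s \<in> courant_sections A G F" "s p = a"
proof -
  have a: "prT a \<in> tangent_space A p" "prF a \<in> dual_space (tangent_space A p)" "prG a \<in> G p"
    using assms by (auto simp: courant_fibre_def)
  obtain X where X: "X \<in> vector_fields A" "X p = prT a" by (rule tangent_extend[OF a(1)])
  obtain \<xi> where \<xi>: "\<xi> \<in> one_forms A" "\<xi> p = prF a" by (rule covector_extend[OF a(2)])
  obtain r where r: "r \<in> sections A G F" "r p = prG a" by (rule section_extend[OF a(3)])
  show thesis
    by (rule that[of "\<lambda>x. (X x, \<xi> x, r x)"]) (use X \<xi> r in \<open>auto simp: courant_sections_def\<close>)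
qed

lemma courant_section_fibre:
  assumes "s \<in> courant_sections A G F" shows "s x \<in> E x"
  using vector_field_tangent[OF courant_section_parts(1)[OF assms], of x]
    one_form_dual[OF courant_section_parts(2)[OF assms], of x]
    section_fibre[OF courant_section_parts(3)[OF assms], of x]
  by (simp add: courant_fibre_def mem_Times_iff)

lemma \<Gamma>L_iff: "u \<in> \<Gamma>L \<longleftrightarrow> u \<in> CE \<and> (\<forall>x. u x \<in> L x)"
  and \<Gamma>W_iff: "X \<in> \<Gamma>W \<longleftrightarrow> X \<in> CV \<and> (\<forall>x. X x \<in> W x)"
  and \<Gamma>D_iff: "r \<in> \<Gamma>D \<longleftrightarrow> r \<in> CS \<and> (\<forall>x. r x \<in> D x)"
  by (simp_all add: sub_sections_def)

lemma L_extend: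
  assumes "u \<in> L p" obtains s where "s \<in> \<Gamma>L" "s p = u"
proof -
  have u: "fst u \<in> E p" "snd u = - J p (fst u)" using assms by (auto simp: L_iff)
  obtain a where a: "a \<in> courant_sections A G F" "a p = fst u" by (rule courant_extend[OF u(1)])
  have "(\<lambda>x. - J x (a x)) \<in> courant_sections A G F"
    using courant_sections_scale[OF smooth_funs_const J_smooth[OF a(1)], of "-1"] by simp
  then show thesis
    using a u prod.collapse[of u] by (intro that[of "\<lambda>x. (a x, - J x (a x))"])
      (simp_all add: \<Gamma>L_iff L_iff cx_sections_iff courant_section_fibre)
qed

lemma \<Gamma>L_cscale:
  assumes "smoothC \<theta>" "u \<in> \<Gamma>L" shows "(\<lambda>x. cscale (\<theta> x) (u x)) \<in> \<Gamma>L"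
proof -
  have u: "(\<lambda>x. fst (u x)) \<in> courant_sections A G F" "(\<lambda>x. snd (u x)) \<in> courant_sections A G F"
    using assms(2) by (auto simp: \<Gamma>L_iff cx_sections_iff)
  have "(\<lambda>x. cscale (\<theta> x) (u x)) \<in> CE"
    using courant_sections_diff[OF courant_sections_scale[OF conjunct1[OF assms(1)] u(1)]
        courant_sections_scale[OF conjunct2[OF assms(1)] u(2)]]
      courant_sections_add[OF courant_sections_scale[OF conjunct1[OF assms(1)] u(2)]
        courant_sections_scale[OF conjunct2[OF assms(1)] u(1)]]
    by (simp add: cx_sections_iff cscale_def)
  then show ?thesis using assms(2) cx.subspace_scale[OF L_subspace] by (simp add: \<Gamma>L_iff)
qed

lemma \<Gamma>L_scale:
  assumes "f \<in> smooth_funs A" "u \<in> \<Gamma>L" shows "(\<lambda>x. f x *\<^sub>R u x) \<in> \<Gamma>L"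
  using \<Gamma>L_cscale[of "\<lambda>x. complex_of_real (f x)" u] assms by (simp add: cscale_of_real)

lemma \<Gamma>L_add:
  assumes "u \<in> \<Gamma>L" "v \<in> \<Gamma>L" shows "(\<lambda>x. u x + v x) \<in> \<Gamma>L"
  using assms courant_sections_add cx.subspace_add[OF L_subspace]
  by (simp add: \<Gamma>L_iff cx_sections_iff)

lemma \<Gamma>L_diff:
  assumes "u \<in> \<Gamma>L" "v \<in> \<Gamma>L" shows "(\<lambda>x. u x - v x) \<in> \<Gamma>L"
  using assms courant_sections_diff cx.subspace_diff[OF L_subspace]
  by (simp add: \<Gamma>L_iff cx_sections_iff)

lemma \<Gamma>L_zero: "(\<lambda>x. 0) \<in> \<Gamma>L"
proof -
  obtain s where "s \<in> \<Gamma>L" "s undefined = 0" by (rule L_extend[OF cx.subspace_0[OF L_subspace]])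
  then show ?thesis using \<Gamma>L_diff[of s s] by simp
qed

lemma \<Gamma>L_sum:
  assumes "finite I" "\<And>i. i \<in> I \<Longrightarrow> u i \<in> \<Gamma>L" shows "(\<lambda>x. \<Sum>i\<in>I. u i x) \<in> \<Gamma>L"
  using assms
proof (induction I)
  case empty
  show ?case using \<Gamma>L_zero by (simp only: sum.empty)
next
  case (insert j I)
  have "(\<lambda>x. u j x + (\<Sum>i\<in>I. u i x)) \<in> \<Gamma>L"
    by (rule \<Gamma>L_add) (use insert in auto)
  then show ?case by (simp only: sum.insert[OF insert(1,2)])
qed

lemma W_subspace: "cx.subspace (W x)"
proof (rule cx.subspaceI)
  show "0 \<in> W x" unfolding W_eq using cx.subspace_0[OF L_subspace] cx1_fst_linear(5) by (metis image_eqI)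
  show "v + w \<in> W x" if vw: "v \<in> W x" "w \<in> W x" for v w
  proof -
    obtain a b where "a \<in> L x" "b \<in> L x" "v = cx1 prT a" "w = cx1 prT b" using vw unfolding W_eq by blast
    then show ?thesis unfolding W_eq
      using cx.subspace_add[OF L_subspace] by (intro image_eqI[of _ _ "a + b"]) (auto simp: cx1_fst_linear)
  qed
  show "cscale c v \<in> W x" if v: "v \<in> W x" for c v
  proof -
    obtain a where "a \<in> L x" "v = cx1 prT a" using v unfolding W_eq by blast
    then show ?thesis unfolding W_eq
      using cx.subspace_scale[OF L_subspace] by (intro image_eqI[of _ _ "cscale c a"]) (auto simp: cx1_fst_linear)
  qed
qed

lemma W_tangent: "W x \<subseteq> TC x"
  using L_fibre unfolding W_eq courant_fibre_def by (fastforce simp: cx1_def)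

lemma \<Gamma>L_T: "u \<in> \<Gamma>L \<Longrightarrow> (\<lambda>x. cx1 prT (u x)) \<in> \<Gamma>W"
  by (auto simp: \<Gamma>L_iff \<Gamma>W_iff CE_iff W_eq)

lemma \<Gamma>L_T_CV: "u \<in> \<Gamma>L \<Longrightarrow> (\<lambda>x. cx1 prT (u x)) \<in> CV"
  by (auto simp: \<Gamma>L_iff CE_iff)

lemma W_extend:
  assumes "w \<in> W p" obtains u where "u \<in> \<Gamma>L" "cx1 prT (u p) = w"
proof -
  obtain a where a: "a \<in> L p" "w = cx1 prT a" using assms unfolding W_eq by blast
  obtain s where "s \<in> \<Gamma>L" "s p = a" by (rule L_extend[OF a(1)])
  then show thesis using a(2) by (intro that[of s]) simp_all
qed

subsection \<open>Frames of W\<close>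

text \<open>Gauss-Jordan elimination: \<open>\<theta>\<close> collects the pivots, so that no division is needed and all
  sections stay global.\<close>

lemma W_elimination:
  assumes k: "\<And>x. cx.dim (W x) = k" and "j \<le> k"
  shows "\<exists>u g \<theta>. (\<forall>i<j. u i \<in> \<Gamma>L) \<and> smoothC \<theta> \<and> \<theta> p \<noteq> 0 \<and>
    (\<forall>i<j. \<forall>l<j. \<forall>x. dC (cx1 prT (u i x)) (g l) = (if i = l then \<theta> x else 0))"
  using \<open>j \<le> k\<close>
proof (induction j)
  case 0
  show ?case by (rule exI, rule exI, rule exI[of _ "\<lambda>x. 1"]) simp
next
  case (Suc j)
  then obtain u g \<theta> where u: "\<And>i. i < j \<Longrightarrow> u i \<in> \<Gamma>L" and \<theta>: "smoothC \<theta>" "\<theta> p \<noteq> 0"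
    and dual: "\<And>i l x. i < j \<Longrightarrow> l < j \<Longrightarrow> dC (cx1 prT (u i x)) (g l) = (if i = l then \<theta> x else 0)"
    using Suc.IH Suc_leD[OF Suc.prems] by blast
  let ?B = "(\<lambda>i. cx1 prT (u i p)) ` {..<j}"
  \<comment> \<open>Fewer than \<open>k\<close> vectors cannot span. A new direction is needed only
    at \<open>p\<close>, whereas the duality relations are kept at every point.\<close>
  have "\<not> W p \<subseteq> cx.span ?B"
  proof
    assume "W p \<subseteq> cx.span ?B"
    then have "cx.dim (W p) \<le> card ?B" by (rule cx.dim_le_card) simp
    also have "\<dots> \<le> j" using card_image_le[of "{..<j}" "\<lambda>i. cx1 prT (u i p)"] by simp
    finally show False using k[of p] Suc.prems by simp
  qed
  then obtain w where w: "w \<in> W p" "w \<notin> cx.span ?B" by blast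
  obtain v where v: "v \<in> \<Gamma>L" "cx1 prT (v p) = w" by (rule W_extend[OF w(1)])
  let ?T = "\<lambda>v x. cx1 prT (v x)"
  \<comment> \<open>The usual reduction of \<open>v\<close> modulo the \<open>u i\<close>,
    multiplied through by \<open>\<theta>\<close>; its tangent part is annihilated by every
    \<open>g l\<close>.\<close>
  define z where "z = (\<lambda>x. cscale (\<theta> x) (v x) - (\<Sum>i<j. cscale (dC (?T v x) (g i)) (u i x)))"
  have z: "z \<in> \<Gamma>L"
    unfolding z_def
    by (rule \<Gamma>L_diff[OF \<Gamma>L_cscale[OF \<theta>(1) v(1)] \<Gamma>L_sum])
      (use \<Gamma>L_cscale[OF smoothC_dC[OF \<Gamma>L_T_CV[OF v(1)]] u] in auto)
  have Tz: "?T z x = cscale (\<theta> x) (?T v x) - (\<Sum>i<j. cscale (dC (?T v x) (g i)) (?T (u i) x))" for x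
    by (simp only: z_def cx1_fst_linear cx1_fst_sum)
  have zg: "dC (?T z x) (g l) = 0" if "l < j" for l x
  proof -
    have "(\<Sum>i<j. dC (?T v x) (g i) * dC (?T (u i) x) (g l)) = (\<Sum>i<j. if i = l then dC (?T v x) (g i) * \<theta> x else 0)"
      using that by (intro sum.cong) (auto simp: dual)
    then show ?thesis using that by (simp add: Tz dC_diff dC_sum dC_cscale)
  qed
  have "?T z p \<noteq> 0"
  proof
    assume "?T z p = 0"
    then have "cscale (\<theta> p) w = (\<Sum>i<j. cscale (dC w (g i)) (?T (u i) p))" by (simp add: Tz v(2))
    also have "\<dots> \<in> cx.span ?B" by (intro cx.span_sum cx.span_scale cx.span_base) auto
    finally have "cscale (inverse (\<theta> p)) (cscale (\<theta> p) w) \<in> cx.span ?B" by (rule cx.span_scale)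
    then show False using w(2) \<theta>(2) by simp
  qed
  then obtain f where f: "dC (?T z p) f \<noteq> 0" using dC_eqI[of "?T z p" 0] unfolding dC_zero by blast
  define \<rho> where "\<rho> = (\<lambda>x. dC (?T z x) f)"
  \<comment> \<open>The new pivot is \<rho>. Cross-multiplication makes \<open>f\<close> vanish on
    the old members and rescales their diagonal entries by \<rho>; the factor
    \<open>\<theta>\<close> on \<open>z\<close> gives the last entry the same value
    \<open>\<rho> \<theta>\<close>.\<close>
  define u' where "u' = (\<lambda>i x. if i < j then cscale (\<rho> x) (u i x) - cscale (dC (?T (u i) x) f) (z x)
    else cscale (\<theta> x) (z x))"
  have \<rho>: "smoothC \<rho>" unfolding \<rho>_def by (rule smoothC_dC[OF \<Gamma>L_T_CV[OF z]])
  have "u' i \<in> \<Gamma>L" for i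
  proof (cases "i < j")
    case True
    then show ?thesis
      using \<Gamma>L_diff[OF \<Gamma>L_cscale[OF \<rho> u] \<Gamma>L_cscale[OF smoothC_dC[OF \<Gamma>L_T_CV[OF u]] z], of i i f]
      by (simp add: u'_def)
  next
    case False
    then show ?thesis using \<Gamma>L_cscale[OF \<theta>(1) z] by (simp add: u'_def)
  qed
  moreover have "dC (?T (u' i) x) ((g(j := f)) l) = (if i = l then \<rho> x * \<theta> x else 0)"
    if "i < Suc j" "l < Suc j" for i l x
    using that by (auto simp: u'_def cx1_fst_linear dC_diff dC_cscale dual zg \<rho>_def less_Suc_eq mult.commute)
  moreover have "smoothC (\<lambda>x. \<rho> x * \<theta> x)" by (rule smoothC_mult[OF \<rho> \<theta>(1)])
  moreover have "\<rho> p * \<theta> p \<noteq> 0" using f \<theta>(2) by (simp add: \<rho>_def)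
  ultimately show ?case by (intro exI[of _ u'] exI[of _ "g(j := f)"] exI[of _ "\<lambda>x. \<rho> x * \<theta> x"]) blast
qed

text \<open>A family of \<open>k\<close> vectors with dual functionals is independent, and the
  functionals read off coefficients. A remainder \<open>Z\<close> outside its span would give
  \<open>k + 1\<close> independent vectors in a space of dimension \<open>k\<close>.\<close>

lemma dual_family_spans:
  assumes k: "cx.dim (W y) = k" and B: "finite B" "W y \<subseteq> cx.span B"
    and w: "\<And>i. i < k \<Longrightarrow> w i \<in> W y" and "t \<noteq> 0"
    and dual: "\<And>i l. i < k \<Longrightarrow> l < k \<Longrightarrow> dC (w i) (g l) = (if i = l then t else 0)"
    and v: "v \<in> W y"
  shows "cscale t v = (\<Sum>i<k. cscale (dC v (g i)) (w i))"
proof -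
  let ?S = "w ` {..<k}"
  define Z where "Z = cscale t v - (\<Sum>i<k. cscale (dC v (g i)) (w i))"
  have Z: "Z \<in> W y" unfolding Z_def
    by (intro cx.subspace_diff cx.subspace_sum cx.subspace_scale W_subspace v w) auto
  have Zg: "dC Z (g l) = 0" if "l < k" for l
  proof -
    have "(\<Sum>i<k. dC v (g i) * dC (w i) (g l)) = (\<Sum>i<k. if i = l then dC v (g i) * t else 0)"
      using that by (intro sum.cong) (auto simp: dual)
    then show ?thesis using that by (simp add: Z_def dC_diff dC_sum dC_cscale)
  qed
  have expand: "cscale t z = (\<Sum>i<k. cscale (dC z (g i)) (w i))" if "z \<in> cx.span ?S" for z
    using that
  proof (rule cx.span_induct[where P = "\<lambda>z. cscale t z = (\<Sum>i<k. cscale (dC z (g i)) (w i))"])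
    show "cx.subspace {z. cscale t z = (\<Sum>i<k. cscale (dC z (g i)) (w i))}"
    proof (rule cx.subspaceI)
      let ?V = "{z. cscale t z = (\<Sum>i<k. cscale (dC z (g i)) (w i))}"
      show "0 \<in> ?V" by (simp add: dC_zero)
      show "x + y \<in> ?V" if "x \<in> ?V" "y \<in> ?V" for x y
        using that by (simp add: dC_add cx.scale_right_distrib cx.scale_left_distrib sum.distrib)
      show "cscale c x \<in> ?V" if x: "x \<in> ?V" for c x
      proof -
        have "cscale t (cscale c x) = cscale c (cscale t x)" by (simp add: mult.commute)
        also have "\<dots> = cscale c (\<Sum>i<k. cscale (dC x (g i)) (w i))" using x by simp
        also have "\<dots> = (\<Sum>i<k. cscale (dC (cscale c x) (g i)) (w i))"
          by (simp add: cx.scale_sum_right dC_cscale)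
        finally show ?thesis by simp
      qed
    qed
    fix z assume "z \<in> ?S"
    then obtain l where l: "l < k" "z = w l" by blast
    have "(\<Sum>i<k. cscale (dC z (g i)) (w i)) = (\<Sum>i<k. if i = l then cscale t (w i) else 0)"
      using l by (intro sum.cong) (auto simp: dual)
    then show "cscale t z = (\<Sum>i<k. cscale (dC z (g i)) (w i))" using l by simp
  qed
  have "inj_on w {..<k}"
    using dual \<open>t \<noteq> 0\<close> by (intro inj_onI) (metis lessThan_iff)
  then have card: "card ?S = k" by (simp add: card_image)
  have indep: "cx.independent ?S"
    unfolding cx.dependent_def
  proof
    assume "\<exists>a\<in>?S. a \<in> cx.span (?S - {a})"
    then obtain i where i: "i < k" and span: "w i \<in> cx.span (?S - {w i})" by blast
    have "cx.subspace {z. dC z (g i) = 0}"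
      by (rule cx.subspaceI) (auto simp: dC_zero dC_add dC_cscale)
    then have "cx.span (?S - {w i}) \<subseteq> {z. dC z (g i) = 0}"
      by (rule cx.span_minimal[rotated]) (use dual i in auto)
    with span have "dC (w i) (g i) = 0" by blast
    then show False using dual[OF i i] \<open>t \<noteq> 0\<close> by simp
  qed
  have "Z = 0"
  proof (rule ccontr)
    assume "Z \<noteq> 0"
    have "Z \<notin> cx.span ?S" using expand[of Z] Zg \<open>t \<noteq> 0\<close> \<open>Z \<noteq> 0\<close> by auto
    then have ind: "cx.independent (insert Z ?S)" and "Z \<notin> ?S"
      using indep by (auto simp: cx.independent_insert intro: cx.span_base)
    obtain B' where B': "B' \<subseteq> W y" "cx.independent B'" "W y \<subseteq> cx.span B'" "card B' = cx.dim (W y)"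
      using cx.basis_exists[of "W y"] by auto
    have "finite B'" using cx.independent_span_bound[OF B(1) B'(2)] B'(1) B(2) by blast
    moreover have "insert Z ?S \<subseteq> cx.span B'" using Z w B'(3) by auto
    ultimately have "card (insert Z ?S) \<le> card B'" using cx.independent_span_bound ind by blast
    then show False using \<open>Z \<notin> ?S\<close> card B'(4) k by simp
  qed
  then show ?thesis by (simp add: Z_def)
qed

text \<open>One factor \<open>\<theta>\<close> comes from the duality relations and one is put into
  the coefficients, so \<open>v\<close> lies over \<open>\<theta> * \<theta>\<close> times
  \<open>X\<close>. Multiplying by the conjugate makes the factor real, namely the fourth power of
  the modulus. The last clause lets a section be corrected without changing its value at
  \<open>p\<close>.\<close>

lemma W_lift:
  assumes X: "X \<in> \<Gamma>W"
  obtains \<theta> u where "\<theta> \<in> smooth_funs A" "\<theta> p \<noteq> 0" "u \<in> \<Gamma>L" "\<And>x. cx1 prT (u x) = \<theta> x *\<^sub>R X x"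
    "X p = 0 \<Longrightarrow> u p = 0"
proof -
  obtain k where k: "\<And>x. cx.dim (W x) = k" using W_rank by blast
  obtain u g \<theta> where u: "\<And>i. i < k \<Longrightarrow> u i \<in> \<Gamma>L" and \<theta>: "smoothC \<theta>" "\<theta> p \<noteq> 0"
    and dual: "\<And>i l x. i < k \<Longrightarrow> l < k \<Longrightarrow> dC (cx1 prT (u i x)) (g l) = (if i = l then \<theta> x else 0)"
    using W_elimination[OF k order_refl, of p] by metis
  have XV: "X \<in> CV" and XW: "\<And>x. X x \<in> W x" using X by (auto simp: \<Gamma>W_iff)
  define v where "v = (\<lambda>x. \<Sum>i<k. cscale (\<theta> x * dC (X x) (g i)) (u i x))"
  have v: "v \<in> \<Gamma>L" unfolding v_def
    by (rule \<Gamma>L_sum) (use \<Gamma>L_cscale[OF smoothC_mult[OF \<theta>(1) smoothC_dC[OF XV]] u] in auto)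
  have Tv: "cx1 prT (v x) = cscale (\<theta> x * \<theta> x) (X x)" for x
  proof (cases "\<theta> x = 0")
    \<comment> \<open>At a zero of \<open>\<theta>\<close> there is no dual family, but both sides
      vanish because the coefficients contain \<open>\<theta>\<close>.\<close>
    case True
    then show ?thesis by (simp add: v_def cx1_fst_sum cx1_fst_linear)
  next
    case False
    obtain B where B: "finite B" "W x \<subseteq> cx.span B" using tangent_finite_span[of x] W_tangent[of x] by blast
    have "cscale (\<theta> x) (X x) = (\<Sum>i<k. cscale (dC (X x) (g i)) (cx1 prT (u i x)))"
      by (rule dual_family_spans[OF k B _ False _ XW])
        (use \<Gamma>L_T[OF u] dual in \<open>auto simp: \<Gamma>W_iff\<close>)
    then have "cscale (\<theta> x) (cscale (\<theta> x) (X x)) = (\<Sum>i<k. cscale (\<theta> x * dC (X x) (g i)) (cx1 prT (u i x)))"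
      by (simp only: cx.scale_sum_right cx.scale_scale)
    then show ?thesis by (simp add: v_def cx1_fst_sum cx1_fst_linear)
  qed
  define n where "n = (\<lambda>x. Re (\<theta> x) * Re (\<theta> x) + Im (\<theta> x) * Im (\<theta> x))"
  have n: "n \<in> smooth_funs A" unfolding n_def using \<theta>(1) by (intro smooth_funs_add smooth_funs_mult) auto
  have norm: "cnj (\<theta> x * \<theta> x) * (\<theta> x * \<theta> x) = complex_of_real (n x * n x)" for x
    by (simp add: n_def complex_eq_iff algebra_simps)
  show thesis
  proof (rule that)
    show "(\<lambda>x. n x * n x) \<in> smooth_funs A" by (rule smooth_funs_mult[OF n n])
    show "n p * n p \<noteq> 0" using \<theta>(2) by (auto simp: n_def complex_eq_iff sum_squares_eq_zero_iff)
    show "(\<lambda>x. cscale (cnj (\<theta> x * \<theta> x)) (v x)) \<in> \<Gamma>L"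
      by (rule \<Gamma>L_cscale[OF smoothC_cnj[OF smoothC_mult[OF \<theta>(1) \<theta>(1)]] v])
    show "cx1 prT (cscale (cnj (\<theta> x * \<theta> x)) (v x)) = (n x * n x) *\<^sub>R X x" for x
      by (simp only: cx1_fst_linear Tv cx.scale_scale norm cscale_of_real)
    show "cscale (cnj (\<theta> p * \<theta> p)) (v p) = 0" if "X p = 0" using that by (simp add: v_def dC_zero)
  qed
qed

lemma D_iff: "r \<in> D x \<longleftrightarrow> (\<exists>u\<in>L x. cx1 prT u = 0 \<and> cx1 prG u = r)"
  unfolding D_eq by auto

text \<open>An extension of the element to a section of \<open>L\<close> has zero tangent part at
  \<open>p\<close> only. A multiple of it minus a lift of its tangent part has zero tangent part
  everywhere, and the lift vanishes at \<open>p\<close>.\<close>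

lemma D_lift:
  assumes "r \<in> D p"
  obtains u where "u \<in> \<Gamma>L" "\<And>x. cx1 prT (u x) = 0" "cx1 prG (u p) = r"
proof -
  obtain a where a: "a \<in> L p" "cx1 prT a = 0" "cx1 prG a = r" using assms by (auto simp: D_iff)
  obtain s where s: "s \<in> \<Gamma>L" "s p = a" by (rule L_extend[OF a(1)])
  obtain \<theta> u where \<theta>: "\<theta> \<in> smooth_funs A" "\<theta> p \<noteq> 0" and u: "u \<in> \<Gamma>L"
    "\<And>x. cx1 prT (u x) = \<theta> x *\<^sub>R cx1 prT (s x)" "cx1 prT (s p) = 0 \<Longrightarrow> u p = 0"
    using W_lift[OF \<Gamma>L_T[OF s(1)], of p] by blast
  define v where "v = (\<lambda>x. \<theta> x *\<^sub>R s x - u x)"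
  have v: "v \<in> \<Gamma>L" unfolding v_def by (rule \<Gamma>L_diff[OF \<Gamma>L_scale[OF \<theta>(1) s(1)] u(1)])
  show thesis
  proof (rule that)
    show "(\<lambda>x. (1 / \<theta> p) *\<^sub>R v x) \<in> \<Gamma>L" by (rule \<Gamma>L_scale[OF smooth_funs_const v])
    show "cx1 prT ((1 / \<theta> p) *\<^sub>R v x) = 0" for x by (simp add: cx1_fst_linear v_def u(2))
    show "cx1 prG ((1 / \<theta> p) *\<^sub>R v p) = r"
      using \<theta>(2) a s u(3) by (simp add: cx1_snd_snd_linear v_def)
  qed
qed

subsection \<open>The bundle D is maximal isotropic\<close>

lemma ipE_bilinear: "bilin_on (E x) UNIV (ipE x)"
  unfolding bilin_on_def lin_on_def courant_fibre_def courant_ip_def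
  using lin_on_add[OF dual_space_lin[where V = "tangent_space A x"]]
    lin_on_scale[OF dual_space_lin[where V = "tangent_space A x"]]
  by (auto simp: ip_simps ip_scale algebra_simps add_divide_distrib)

text \<open>Testing against the three summands detects the three components. For the tangent
  component differentials of smooth functions suffice, since a tangent vector is determined by its
  action on functions.\<close>

lemma ipE_nondegenerate:
  assumes u: "u \<in> E x" and zero: "\<And>v. v \<in> E x \<Longrightarrow> ipE x u v = 0"
  shows "u = 0"
proof -
  have u': "prT u \<in> tangent_space A x" "prF u \<in> dual_space (tangent_space A x)" "prG u \<in> G x"
    using u by (auto simp: courant_fibre_def mem_Times_iff)
  have T0: "0 \<in> tangent_space A x" "0 \<in> dual_space (tangent_space A x)" "0 \<in> G x"
    using tangent_subspace dual_space_subspace fibre_subspace subspace_0 by blast+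
  have F0: "prF u 0 = 0" using lin_on_0[OF dual_space_lin[OF u'(2)] T0(1)] .
  have ip0: "ip x (prG u) 0 = 0" using ip_scale(2)[OF T0(3) u'(3), of 0] by simp
  have "ip x (prG u) s = 0" if "s \<in> G x" for s
    using zero[of "(0, 0, s)"] T0 that F0 by (simp add: courant_fibre_def courant_ip_def)
  then have "prG u = 0" using ip_nondegenerate[OF u'(3)] by blast
  moreover have "prT u f = 0" if f: "f \<in> smooth_funs A" for f
  proof -
    have "d_fun A f x \<in> dual_space (tangent_space A x)" using one_form_dual[OF d_fun_one_form[OF f]] .
    then show ?thesis
      using zero[of "(0, d_fun A f x, 0)"] T0 F0 ip0 u'(1) by (simp add: courant_fibre_def courant_ip_def d_fun_def)
  qed
  then have "prT u = 0" by (rule tangent_separated[OF u'(1)])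
  moreover have "prF u v = 0" for v
  proof (cases "v \<in> tangent_space A x")
    case True
    then show ?thesis using zero[of "(v, 0, 0)"] T0 ip0 by (simp add: courant_fibre_def courant_ip_def)
  next
    case False
    then show ?thesis using u'(2) by (simp add: dual_space_def)
  qed
  then have "prF u = 0" by auto
  ultimately show ?thesis by (simp add: prod_eq_iff)
qed

lemma ipE_uminus:
  assumes "u \<in> E x" "v \<in> E x"
  shows "ipE x u (- v) = - ipE x u v" "ipE x (- u) v = - ipE x u v"
  using lin_on_uminus[OF bilin_lin_right[OF ipE_bilinear assms(1)] assms(2)]
    lin_on_uminus[OF bilin_lin_left[OF ipE_bilinear assms(2)] assms(1)] by auto

lemma ipE_J: assumes "u \<in> E x" "v \<in> E x" shows "ipE x (J x u) (J x v) = ipE x u v"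
  using J_skew[OF assms(1) J_in[OF assms(2)]] J_J[OF assms(2)] ipE_uminus[OF assms] by simp

lemma L_isotropic:
  assumes "u \<in> L x" "v \<in> L x" shows "cx2 (ipE x) u v = 0"
proof -
  have E: "fst u \<in> E x" "fst v \<in> E x" "snd u = - J x (fst u)" "snd v = - J x (fst v)"
    using assms by (auto simp: L_iff)
  then show ?thesis
    using J_skew[OF E(1,2)] ipE_J[OF E(1,2)]
    by (simp add: cx2_def ipE_uminus J_in subspace_neg[OF E_subspace] zero_prod_def)
qed

text \<open>The imaginary part of the pairing with \<open>a - \<i> J a\<close> says, by skewness of
  \<open>J\<close>, that \<open>snd w + J x (fst w)\<close> is orthogonal to every \<open>a\<close>.
  This is the maximality of \<open>L\<close> in the form needed for \<open>D\<close>.\<close>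

lemma L_perp:
  assumes w: "w \<in> E x \<times> E x" and perp: "\<And>v. v \<in> L x \<Longrightarrow> cx2 (ipE x) w v = 0"
  shows "w \<in> L x"
proof -
  have E: "fst w \<in> E x" "snd w \<in> E x" using w by auto
  have "ipE x (snd w + J x (fst w)) a = 0" if a: "a \<in> E x" for a
  proof -
    have "(a, - J x a) \<in> L x" using a by (simp add: L_iff)
    from perp[OF this] have "ipE x (fst w) (- J x a) + ipE x (snd w) a = 0" by (simp add: cx2_def prod_eq_iff)
    then show ?thesis
      using J_skew[OF E(1) a] a E J_in[OF E(1)] J_in[OF a]
      by (simp add: ipE_uminus bilin_simps[OF ipE_bilinear E_subspace subspace_UNIV])
  qed
  then have "snd w + J x (fst w) = 0"
    using ipE_nondegenerate E J_in subspace_add[OF E_subspace] by blast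
  then show ?thesis using E by (simp add: L_iff eq_neg_iff_add_eq_0)
qed

lemma L_data:
  assumes "u \<in> L x"
  shows "cx1 prT u \<in> W x" "cx1 prG u - \<sigma> x (cx1 prT u) \<in> D x"
    "v \<in> W x \<Longrightarrow> evC (cx1 prF u) v = 2 *\<^sub>R \<epsilon> x (cx1 prT u) v
      - ipC x (\<sigma> x v) (\<sigma> x (cx1 prT u) + 2 *\<^sub>R (cx1 prG u - \<sigma> x (cx1 prT u)))"
  using assms unfolding L_eq L_bundle_def by auto

lemma LI:
  assumes "u \<in> E x \<times> E x" "cx1 prT u \<in> W x" "cx1 prG u - \<sigma> x (cx1 prT u) \<in> D x"
    "\<And>v. v \<in> W x \<Longrightarrow> evC (cx1 prF u) v = 2 *\<^sub>R \<epsilon> x (cx1 prT u) v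
      - ipC x (\<sigma> x v) (\<sigma> x (cx1 prT u) + 2 *\<^sub>R (cx1 prG u - \<sigma> x (cx1 prT u)))"
  shows "u \<in> L x"
  unfolding L_eq L_bundle_def using assms
  by (auto intro!: bexI[of _ "cx1 prG u - \<sigma> x (cx1 prT u)"])

lemma D_fibre: "D x \<subseteq> GC x"
  using L_fibre unfolding D_eq courant_fibre_def by (fastforce simp: cx1_def)

lemma D_subspace: "cx.subspace (D x)"
proof (rule cx.subspaceI)
  show "0 \<in> D x"
    unfolding D_iff using cx.subspace_0[OF L_subspace] cx1_fst_linear(5) cx1_snd_snd_linear(5) by blast
  show "r + s \<in> D x" if rs: "r \<in> D x" "s \<in> D x" for r s
  proof -
    obtain a b where "a \<in> L x" "b \<in> L x" "cx1 prT a = 0" "cx1 prT b = 0" "cx1 prG a = r" "cx1 prG b = s"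
      using rs unfolding D_iff by blast
    then show ?thesis unfolding D_iff
      using cx.subspace_add[OF L_subspace] by (intro bexI[of _ "a + b"]) (auto simp: cx1_fst_linear cx1_snd_snd_linear)
  qed
  show "cscale c r \<in> D x" if r: "r \<in> D x" for c r
  proof -
    obtain a where "a \<in> L x" "cx1 prT a = 0" "cx1 prG a = r" using r unfolding D_iff by blast
    then show ?thesis unfolding D_iff
      using cx.subspace_scale[OF L_subspace] by (intro bexI[of _ "cscale c a"]) (auto simp: cx1_fst_linear cx1_snd_snd_linear)
  qed
qed

lemma cx2_ipE:
  "cx2 (ipE x) u v = (1/2) *\<^sub>R (evC (cx1 prF u) (cx1 prT v) + evC (cx1 prF v) (cx1 prT u))
    + ipC x (cx1 prG u) (cx1 prG v)"
  by (simp add: cx2_def courant_ip_def cx1_def prod_eq_iff field_simps)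

lemma L_form_zero:
  assumes "u \<in> L x" shows "evC (cx1 prF u) 0 = 0"
proof -
  have u: "prF (fst u) \<in> dual_space (tangent_space A x)" "prF (snd u) \<in> dual_space (tangent_space A x)"
    using L_fibre[OF assms] by (simp_all add: courant_fibre_def mem_Times_iff)
  have "prF (fst u) 0 = 0" "prF (snd u) 0 = 0"
    by (rule lin_on_0[OF dual_space_lin[OF u(1)] subspace_0[OF tangent_subspace]],
      rule lin_on_0[OF dual_space_lin[OF u(2)] subspace_0[OF tangent_subspace]])
  then show ?thesis by (simp add: cx2_def cx1_def zero_prod_def)
qed

lemma D_isotropic:
  assumes "r \<in> D x" "s \<in> D x" shows "ipC x r s = 0"
proof -
  obtain a b where ab: "a \<in> L x" "b \<in> L x" "cx1 prT a = 0" "cx1 prT b = 0" "cx1 prG a = r" "cx1 prG b = s"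
    using assms unfolding D_iff by blast
  show ?thesis using L_isotropic[OF ab(1,2)] L_form_zero[OF ab(1)] L_form_zero[OF ab(2)] ab by (simp add: cx2_ipE)
qed

text \<open>The equations for \<open>L\<close> prescribe a form along \<open>W x\<close> only, so
  building an element of \<open>L\<close> requires an actual pair of covectors with given values
  there.\<close>

lemma functional_extend:
  assumes "clin_on (W x) UNIV f"
  obtains \<alpha> where "\<alpha> \<in> dual_space (tangent_space A x) \<times> dual_space (tangent_space A x)"
    "\<And>v. v \<in> W x \<Longrightarrow> evC \<alpha> v = f v"
proof -
  obtain B where B: "B \<subseteq> W x" "cx.independent B" "W x \<subseteq> cx.span B" "card B = cx.dim (W x)"
    by (rule cx.basis_exists)
  obtain g :: "'m tvec cx \<Rightarrow> real cx" where g: "Vector_Spaces.linear cscale cscale g" "\<And>b. b \<in> B \<Longrightarrow> g b = f b"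
    using vector_space_pair.linear_independent_extend[OF vector_space_pair.intro[OF
        cx.vector_space_axioms cx.vector_space_axioms] B(2), of f] by blast
  then have hom: "module_hom cscale cscale g" unfolding module_hom_iff_linear by blast
  note g_simps = module_hom.add[OF hom] module_hom.scale[OF hom]
  have g0: "g 0 = 0" using g_simps(1)[of 0 0] by simp
  have gW: "v \<in> W x \<and> g v = f v" if "v \<in> cx.span B" for v
    using that
  proof (rule cx.span_induct[where P = "\<lambda>v. v \<in> W x \<and> g v = f v"])
    have "f 0 = 0"
      using assms cx.subspace_0[OF W_subspace[of x]] unfolding clin_on_def
      by (metis cx.scale_zero_left)
    then show "cx.subspace {v. v \<in> W x \<and> g v = f v}"
      using assms cx.subspace_0[OF W_subspace[of x]] cx.subspace_add[OF W_subspace[of x]]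
        cx.subspace_scale[OF W_subspace[of x]] unfolding clin_on_def
      by (intro cx.subspaceI) (auto simp: g0 g_simps)
  qed (use B(1) g(2) in auto)
  \<comment> \<open>Real and imaginary parts of the extended functional on real tangent vectors, set
    to 0 elsewhere as \<open>dual_space\<close> demands.\<close>
  define \<alpha> where "\<alpha> = (\<lambda>v. if v \<in> tangent_space A x then fst (g (v, 0)) else 0,
     \<lambda>v. if v \<in> tangent_space A x then snd (g (v, 0)) else 0)"
  have add: "g (u + v, 0) = g (u, 0) + g (v, 0)" for u v using g_simps(1)[of "(u, 0)" "(v, 0)"] by simp
  have scale: "g (c *\<^sub>R v, 0) = c *\<^sub>R g (v, 0)" for c v
    using g_simps(2)[of "complex_of_real c" "(v, 0)"] by (simp add: cscale_of_real)
  show thesis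
  proof (rule that[of \<alpha>])
    show "\<alpha> \<in> dual_space (tangent_space A x) \<times> dual_space (tangent_space A x)"
      using subspace_add[OF tangent_subspace[of x]] subspace_scale[OF tangent_subspace[of x]]
      by (auto simp: \<alpha>_def dual_space_def lin_on_def add scale)
    fix v assume v: "v \<in> W x"
    have "g v = g ((fst v, 0) + cscale \<i> (snd v, 0))" by (simp add: cscale_def)
    also have "\<dots> = g (fst v, 0) + cscale \<i> (g (snd v, 0))" by (simp only: g_simps)
    also have "\<dots> = evC \<alpha> v" using v W_tangent[of x] by (auto simp: \<alpha>_def cx2_def cscale_def prod_eq_iff)
    finally show "evC \<alpha> v = f v" using gW[OF subsetD[OF B(3) v]] by simp
  qed
qed

lemma \<sigma>_in: "w \<in> W x \<Longrightarrow> \<sigma> x w \<in> GC x"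
  and \<sigma>_add: "v \<in> W x \<Longrightarrow> w \<in> W x \<Longrightarrow> \<sigma> x (v + w) = \<sigma> x v + \<sigma> x w"
  and \<sigma>_cscale: "w \<in> W x \<Longrightarrow> \<sigma> x (cscale c w) = cscale c (\<sigma> x w)"
  using \<sigma>_linear[of x] unfolding clin_on_def by blast+

text \<open>The candidate in \<open>L\<close> is \<open>\<alpha> + r\<close> with zero tangent part,
  where \<open>\<alpha>\<close> is -2 times the pairing of \<open>r\<close> with
  \<open>\<sigma>\<close>. The factor 2 offsets the half in the scalar product: paired with an
  element of \<open>L\<close>, the \<open>\<sigma>\<close>-contributions cancel and only
  \<open>r\<close> against a member of \<open>D\<close> is left.\<close>

lemma D_perp:
  assumes r: "r \<in> GC x" and perp: "\<And>s. s \<in> D x \<Longrightarrow> ipC x r s = 0"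
  shows "r \<in> D x"
proof -
  have "clin_on (W x) UNIV (\<lambda>v. (-2) *\<^sub>R ipC x r (\<sigma> x v))"
    unfolding clin_on_def using r
    by (auto simp: \<sigma>_add \<sigma>_cscale ipC_linear ipC_scale \<sigma>_in cscale_of_real[symmetric] mult.commute
        cx.scale_right_distrib simp del: of_real_numeral of_real_minus)
  then obtain \<alpha> where \<alpha>: "\<alpha> \<in> dual_space (tangent_space A x) \<times> dual_space (tangent_space A x)"
    "\<And>v. v \<in> W x \<Longrightarrow> evC \<alpha> v = (-2) *\<^sub>R ipC x r (\<sigma> x v)"
    by (rule functional_extend) blast
  define w where "w = ((0 :: 'm tvec, fst \<alpha>, fst r), (0 :: 'm tvec, snd \<alpha>, snd r))"
  have w: "cx1 prT w = 0" "cx1 prF w = \<alpha>" "cx1 prG w = r" by (simp_all add: w_def cx1_def prod_eq_iff)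
  have "w \<in> L x"
  proof (rule L_perp)
    show "w \<in> E x \<times> E x"
      using \<alpha>(1) r subspace_0[OF tangent_subspace] by (auto simp: w_def courant_fibre_def)
    fix v assume v: "v \<in> L x"
    note d = L_data[OF v]
    have "evC (cx1 prF v) 0 = 0" by (rule L_form_zero[OF v])
    moreover have "cx1 prG v \<in> GC x" using L_fibre[OF v] by (auto simp: courant_fibre_def cx1_def)
    then have "ipC x r (cx1 prG v) = ipC x r (\<sigma> x (cx1 prT v)) + ipC x r (cx1 prG v - \<sigma> x (cx1 prT v))"
      using ipC_linear(4)[OF _ \<sigma>_in[OF d(1)] r] by simp
    ultimately show "cx2 (ipE x) w v = 0"
      using perp[OF d(2)] \<alpha>(2)[OF d(1)] by (simp add: cx2_ipE w)
  qed
  then show ?thesis using w unfolding D_iff by blast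
qed

text \<open>An isotropic space containing \<open>D x\<close> is orthogonal to \<open>D x\<close>,
  hence contained in it.\<close>

lemma D_max_isotropic: "max_isotropic (G x) (ip x) (D x)"
  unfolding max_isotropic_def isotropic_def
proof (intro conjI allI impI)
  fix S assume S: "(cx.subspace S \<and> S \<subseteq> GC x \<and> (\<forall>u\<in>S. \<forall>v\<in>S. ipC x u v = 0)) \<and> D x \<subseteq> S"
  then show "S = D x" using D_perp[of _ x] by blast
qed (use D_subspace D_fibre D_isotropic in blast)+

end

section \<open>The integrability conditions\<close>

context courant_almost_complex
begin

abbreviation "s\<sigma> X \<equiv> (\<lambda>x. \<sigma> x (X x))"

text \<open>Along an involutive \<open>W\<close> its adjoint action is the curvature of the partial
  connection \<open>pcon\<close>.\<close>

definition curv where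
  "curv X Y x = RC x (X x) (Y x) + d_sigma nabla \<sigma> X Y x + brC x (\<sigma> x (X x)) (\<sigma> x (Y x))"

definition pcon where
  "pcon X r x = nabC X r x + brC x (\<sigma> x (X x)) (r x)"

text \<open>The summands with \<open>R\<close>, \<open>d_sigma\<close> and the triple bracket form
  the Chern-Simons transgression form for the change of the connection by
  \<open>\<sigma>\<close>.\<close>

definition E3 where
  "E3 X Y Z x = cx3 (H x) (X x) (Y x) (Z x) + 2 *\<^sub>R d_epsilon \<epsilon> X Y Z x
         + 2 *\<^sub>R wedge_ip ip (\<lambda>X Y x. RC x (X x) (Y x)) \<sigma> X Y Z x
         + wedge_ip ip (d_sigma nabla \<sigma>) \<sigma> X Y Z x
         + 2 *\<^sub>R ipC x (brC x (\<sigma> x (X x)) (\<sigma> x (Y x))) (\<sigma> x (Z x))"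

text \<open>The component \<open>r\<close> of a section \<open>X + \<xi> + \<sigma>(X) + r\<close>
  of \<open>L\<close>.\<close>

definition rest where
  "rest u = (\<lambda>x. cx1 prG (u x) - \<sigma> x (cx1 prT (u x)))"

lemma \<Gamma>W_CV: "X \<in> \<Gamma>W \<Longrightarrow> X \<in> CV" and \<Gamma>W_in: "X \<in> \<Gamma>W \<Longrightarrow> X x \<in> W x"
  by (auto simp: \<Gamma>W_iff)

lemma s\<sigma>_in: "X \<in> \<Gamma>W \<Longrightarrow> s\<sigma> X \<in> CS"
  by (rule \<sigma>_smooth)

lemma \<sigma>_scale: "w \<in> W x \<Longrightarrow> \<sigma> x (c *\<^sub>R w) = c *\<^sub>R \<sigma> x w"
  using \<sigma>_cscale[of w x "complex_of_real c"] by (simp add: cscale_of_real)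

lemma \<sigma>_uminus: "w \<in> W x \<Longrightarrow> \<sigma> x (- w) = - \<sigma> x w"
  using \<sigma>_scale[of w x "-1"] by simp

lemma \<sigma>_diff: "v \<in> W x \<Longrightarrow> w \<in> W x \<Longrightarrow> \<sigma> x (v - w) = \<sigma> x v - \<sigma> x w"
  using \<sigma>_add[of v x "- w"] \<sigma>_uminus[of w x] cx.subspace_neg[OF W_subspace, of w x] by simp

lemma \<epsilon>_right:
  assumes "u \<in> W x" "v \<in> W x" "w \<in> W x"
  shows "\<epsilon> x u (v + w) = \<epsilon> x u v + \<epsilon> x u w" "\<epsilon> x u (cscale c v) = cscale c (\<epsilon> x u v)"
  using \<epsilon>_linear[OF assms(1)] assms unfolding clin_on_def by blast+

text \<open>Linearity is assumed in the second slot and reaches the first through skewness. The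
  combination is the one produced by the Leibniz rule \<open>lieC_scale_left\<close>.\<close>

lemma \<epsilon>_scale_diff_left:
  assumes u: "u \<in> W x" and v: "v \<in> W x" and w: "w \<in> W x"
  shows "\<epsilon> x (r *\<^sub>R u - cscale c v) w = r *\<^sub>R \<epsilon> x u w - cscale c (\<epsilon> x v w)"
proof -
  have m: "r *\<^sub>R u \<in> W x" "cscale (- c) v \<in> W x" "cscale (complex_of_real r) u \<in> W x"
    using u v W_subspace cx_subspace_scaleR cx.subspace_scale by blast+
  have "r *\<^sub>R u - cscale c v = cscale (complex_of_real r) u + cscale (- c) v" by (simp add: cscale_of_real)
  then have "\<epsilon> x (r *\<^sub>R u - cscale c v) w = - \<epsilon> x w (cscale (complex_of_real r) u + cscale (- c) v)"
    using \<epsilon>_skew[OF _ w] cx.subspace_add[OF W_subspace m(3,2)] by simp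
  also have "\<dots> = - (cscale (complex_of_real r) (\<epsilon> x w u) + cscale (- c) (\<epsilon> x w v))"
    by (simp only: \<epsilon>_right(1)[OF w m(3,2)] \<epsilon>_right(2)[OF w u u] \<epsilon>_right(2)[OF w v v])
  also have "\<dots> = r *\<^sub>R \<epsilon> x u w - cscale c (\<epsilon> x v w)"
    by (simp add: \<epsilon>_skew[OF w u] \<epsilon>_skew[OF w v] cscale_of_real)
  finally show ?thesis .
qed

lemma \<epsilon>_scale_left: "u \<in> W x \<Longrightarrow> w \<in> W x \<Longrightarrow> \<epsilon> x (r *\<^sub>R u) w = r *\<^sub>R \<epsilon> x u w"
  using \<epsilon>_scale_diff_left[of u x u w r 0] by simp

lemma \<epsilon>_uminus_left: "u \<in> W x \<Longrightarrow> w \<in> W x \<Longrightarrow> \<epsilon> x (- u) w = - \<epsilon> x u w"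
  using \<epsilon>_scale_left[of u x w "-1"] by simp

lemmas GC_closed = cx.subspace_add[OF cx_subspace_Times[OF fibre_subspace]]
  cx.subspace_diff[OF cx_subspace_Times[OF fibre_subspace]]
  cx_subspace_scaleR[OF cx_subspace_Times[OF fibre_subspace]]
  cx.subspace_scale[OF cx_subspace_Times[OF fibre_subspace]]
  cx.subspace_neg[OF cx_subspace_Times[OF fibre_subspace]]

lemmas D_closed = cx.subspace_add[OF D_subspace] cx.subspace_diff[OF D_subspace] cx_subspace_scaleR[OF D_subspace]

lemma D_GC: "r \<in> D x \<Longrightarrow> r \<in> GC x"
  using D_fibre by blast

lemma \<Gamma>L_G: "u \<in> \<Gamma>L \<Longrightarrow> (\<lambda>x. cx1 prG (u x)) \<in> CS"
  by (auto simp: \<Gamma>L_iff CE_iff)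

lemma rest_in: "u \<in> \<Gamma>L \<Longrightarrow> rest u \<in> \<Gamma>D"
  using CS_diff[OF \<Gamma>L_G s\<sigma>_in[OF \<Gamma>L_T]] L_data(2) by (simp add: \<Gamma>D_iff rest_def \<Gamma>L_iff)

lemma \<Gamma>D_CS: "r \<in> \<Gamma>D \<Longrightarrow> r \<in> CS" and \<Gamma>D_in: "r \<in> \<Gamma>D \<Longrightarrow> r x \<in> D x"
  by (auto simp: \<Gamma>D_iff)

lemma \<Gamma>W_scale: "f \<in> smooth_funs A \<Longrightarrow> X \<in> \<Gamma>W \<Longrightarrow> (\<lambda>x. f x *\<^sub>R X x) \<in> \<Gamma>W"
  using CV_scale cx_subspace_scaleR[OF W_subspace] by (simp add: \<Gamma>W_iff)

text \<open>With both \<open>G\<close>-parts split into a value of \<open>\<sigma>\<close> and a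
  part in \<open>D\<close>, the pure \<open>\<sigma>\<close>-terms and \<open>R\<close> make up
  \<open>curv\<close>, while the mixed brackets complete the covariant derivatives to
  \<open>pcon\<close>. The minus sign before the second \<open>pcon\<close> also absorbs the
  exchange of \<open>rest u\<close> and \<open>\<sigma> x (Y x)\<close>.\<close>

lemma G_decomposition:
  assumes u: "u \<in> \<Gamma>L" and v: "v \<in> \<Gamma>L"
  defines "X \<equiv> \<lambda>x. cx1 prT (u x)" and "Y \<equiv> \<lambda>x. cx1 prT (v x)"
  shows "cx1 prG (dorfmanC u v x) - \<sigma> x (lieC X Y x) =
    curv X Y x + pcon X (rest v) x - pcon Y (rest u) x + brC x (rest u x) (rest v x)"
proof -
  have X: "X \<in> \<Gamma>W" "X \<in> CV" and Y: "Y \<in> \<Gamma>W" "Y \<in> CV"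
    unfolding X_def Y_def using \<Gamma>L_T u v \<Gamma>W_CV by blast+
  have r: "rest u \<in> CS" and s: "rest v \<in> CS" using rest_in u v \<Gamma>D_CS by blast+
  have a: "(\<lambda>x. cx1 prG (u x)) = (\<lambda>x. s\<sigma> X x + rest u x)" and b: "(\<lambda>x. cx1 prG (v x)) = (\<lambda>x. s\<sigma> Y x + rest v x)"
    by (simp_all add: rest_def X_def Y_def)
  note m = CS_fibre[OF r, of x] CS_fibre[OF s, of x] CS_fibre[OF s\<sigma>_in[OF X(1)], of x] CS_fibre[OF s\<sigma>_in[OF Y(1)], of x]
  have T: "\<And>y. cx1 prT (u y) = X y" "\<And>y. cx1 prT (v y) = Y y" by (simp_all add: X_def Y_def)
  have "brC x (rest u x) (\<sigma> x (Y x)) = - brC x (\<sigma> x (Y x)) (rest u x)"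
    by (rule brC_skew[OF m(1,4)])
  then show ?thesis
    using fun_cong[OF a, of x] fun_cong[OF b, of x]
    by (simp add: dorfmanC_G a b T nabC_add[OF X(2) s\<sigma>_in[OF Y(1)] s]
        nabC_add[OF Y(2) s\<sigma>_in[OF X(1)] r] brC_linear m GC_closed curv_def pcon_def d_sigma_def)
qed

text \<open>An equality of functions, not of values at one point, because the Dorfman bracket
  differentiates these evaluations.\<close>

lemma form_section:
  assumes "u \<in> \<Gamma>L" "Z \<in> \<Gamma>W"
  shows "(\<lambda>x. evC (cx1 prF (u x)) (Z x)) = (\<lambda>x. 2 *\<^sub>R \<epsilon> x (cx1 prT (u x)) (Z x)
    - (ipC x (\<sigma> x (Z x)) (\<sigma> x (cx1 prT (u x))) + 2 *\<^sub>R ipC x (\<sigma> x (Z x)) (rest u x)))"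
proof
  fix x
  have L: "u x \<in> L x" using assms(1) by (simp add: \<Gamma>L_iff)
  have m: "\<sigma> x (Z x) \<in> GC x" "\<sigma> x (cx1 prT (u x)) \<in> GC x" "rest u x \<in> GC x"
    using \<sigma>_in \<Gamma>W_in[OF assms(2)] \<Gamma>W_in[OF \<Gamma>L_T[OF assms(1)]] D_GC[OF \<Gamma>D_in[OF rest_in[OF assms(1)]]] by blast+
  show "evC (cx1 prF (u x)) (Z x) = 2 *\<^sub>R \<epsilon> x (cx1 prT (u x)) (Z x)
    - (ipC x (\<sigma> x (Z x)) (\<sigma> x (cx1 prT (u x))) + 2 *\<^sub>R ipC x (\<sigma> x (Z x)) (rest u x))"
    using L_data(3)[OF L \<Gamma>W_in[OF assms(2), of x]] m
    by (simp add: rest_def[symmetric] ipC_linear ipC_scale GC_closed) (simp add: rest_def ipC_linear ipC_scale GC_closed)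
qed

lemma derC_form:
  assumes "X \<in> CV" "f \<in> CF" "g \<in> CF" "h \<in> CF"
  shows "derC X (\<lambda>y. 2 *\<^sub>R f y - (g y + 2 *\<^sub>R h y)) x
    = 2 *\<^sub>R derC X f x - (derC X g x + 2 *\<^sub>R derC X h x)"
proof -
  note c = CF_scale[OF smooth_funs_const, of _ 2]
  show ?thesis
    by (simp only: derC_diff[OF assms(1) c[OF assms(2)] CF_add[OF assms(3) c[OF assms(4)]]]
      derC_add[OF assms(1,3) c[OF assms(4)]] derC_const_scale[OF assms(1,2)] derC_const_scale[OF assms(1,4)])
qed

text \<open>Substituting the equations of \<open>L\<close> leaves derivatives of
  \<open>\<epsilon>\<close>, which assemble to twice \<open>d_epsilon\<close>, and derivatives of
  scalar products, which the metric connection distributes over the factors. Invariance under the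
  adjoint action matches the remaining brackets with \<open>curv\<close> and \<open>pcon\<close>.
  Involutivity is what allows \<open>\<sigma>\<close> and \<open>\<epsilon>\<close> to be applied to
  the three Lie brackets.\<close>

lemma form_identity:
  assumes u: "u \<in> \<Gamma>L" and v: "v \<in> \<Gamma>L" and Z: "Z \<in> \<Gamma>W"
    and inv: "\<And>X Y. X \<in> \<Gamma>W \<Longrightarrow> Y \<in> \<Gamma>W \<Longrightarrow> lieC X Y \<in> \<Gamma>W"
  defines "X \<equiv> \<lambda>x. cx1 prT (u x)" and "Y \<equiv> \<lambda>x. cx1 prT (v x)"
  shows "evC (cx1 prF (dorfmanC u v x)) (Z x) - (2 *\<^sub>R \<epsilon> x (lieC X Y x) (Z x)
      - ipC x (\<sigma> x (Z x)) (\<sigma> x (lieC X Y x) + 2 *\<^sub>R (cx1 prG (dorfmanC u v x) - \<sigma> x (lieC X Y x))))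
    = E3 X Y Z x - 2 *\<^sub>R ipC x (curv X Z x) (rest v x) + 2 *\<^sub>R ipC x (curv Y Z x) (rest u x)
      + 2 *\<^sub>R ipC x (pcon Z (rest u) x) (rest v x)"
proof -
  have X: "X \<in> \<Gamma>W" "X \<in> CV" and Y: "Y \<in> \<Gamma>W" "Y \<in> CV" and ZV: "Z \<in> CV"
    unfolding X_def Y_def using \<Gamma>L_T u v Z \<Gamma>W_CV by blast+
  have T: "\<And>y. cx1 prT (u y) = X y" "\<And>y. cx1 prT (v y) = Y y" by (simp_all add: X_def Y_def)
  define r where "r = rest u"
  define s where "s = rest v"
  have r: "r \<in> CS" and s: "s \<in> CS" using rest_in u v \<Gamma>D_CS unfolding r_def s_def by blast+
  define a b c where "a = s\<sigma> X" and "b = s\<sigma> Y" and "c = s\<sigma> Z"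
  have abc: "a \<in> CS" "b \<in> CS" "c \<in> CS" using s\<sigma>_in X Y Z by (auto simp: a_def b_def c_def)
  have \<sigma>abc: "\<And>y. \<sigma> y (X y) = a y" "\<And>y. \<sigma> y (Y y) = b y" "\<And>y. \<sigma> y (Z y) = c y"
    by (simp_all add: a_def b_def c_def)
  have Gu: "(\<lambda>x. cx1 prG (u x)) = (\<lambda>x. a x + r x)" and Gv: "(\<lambda>x. cx1 prG (v x)) = (\<lambda>x. b x + s x)"
    by (simp_all add: rest_def X_def Y_def a_def b_def r_def s_def)
  have Gu': "cx1 prG (u x) = a x + r x" and Gv': "cx1 prG (v x) = b x + s x"
    using fun_cong[OF Gu, of x] fun_cong[OF Gv, of x] .
  have \<xi>: "(\<lambda>x. evC (cx1 prF (u x)) (V x)) = (\<lambda>x. 2 *\<^sub>R \<epsilon> x (X x) (V x)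
      - (ipC x (\<sigma> x (V x)) (a x) + 2 *\<^sub>R ipC x (\<sigma> x (V x)) (r x)))"
    and \<eta>: "(\<lambda>x. evC (cx1 prF (v x)) (V x)) = (\<lambda>x. 2 *\<^sub>R \<epsilon> x (Y x) (V x)
      - (ipC x (\<sigma> x (V x)) (b x) + 2 *\<^sub>R ipC x (\<sigma> x (V x)) (s x)))" if "V \<in> \<Gamma>W" for V
    using form_section[OF u that] form_section[OF v that] by (simp_all add: X_def Y_def a_def b_def r_def s_def)
  have lie: "lieC X Y \<in> \<Gamma>W" "lieC X Z \<in> \<Gamma>W" "lieC Y Z \<in> \<Gamma>W" using inv X Y Z by auto
  define p q t where "p = \<sigma> x (lieC X Y x)" and "q = \<sigma> x (lieC X Z x)" and "t = \<sigma> x (lieC Y Z x)"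
  have pqt: "p \<in> GC x" "q \<in> GC x" "t \<in> GC x"
    using \<sigma>_in[OF \<Gamma>W_in[OF lie(1)]] \<sigma>_in[OF \<Gamma>W_in[OF lie(2)]] \<sigma>_in[OF \<Gamma>W_in[OF lie(3)]]
    by (simp_all add: p_def q_def t_def)
  note m = pqt CS_fibre[OF r, of x] CS_fibre[OF s, of x] CS_fibre[OF abc(1), of x] CS_fibre[OF abc(2), of x]
    CS_fibre[OF abc(3), of x]
  have nab: "nabC V w x \<in> GC x" if "V \<in> CV" "w \<in> CS" for V w
    using CS_fibre[OF nabC_smooth[OF that]] .
  note n = nab[OF X(2) abc(2)] nab[OF X(2) abc(3)] nab[OF X(2) s] nab[OF Y(2) abc(1)] nab[OF Y(2) abc(3)]
    nab[OF Y(2) r] nab[OF ZV abc(1)] nab[OF ZV abc(2)] nab[OF ZV r]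
  have Rm: "RC x (X x) (Y x) \<in> GC x" "RC x (X x) (Z x) \<in> GC x" "RC x (Y x) (Z x) \<in> GC x"
    by (rule RC_in[OF CV_tangent[OF X(2)] CV_tangent[OF Y(2)]], rule RC_in[OF CV_tangent[OF X(2)] CV_tangent[OF ZV]],
      rule RC_in[OF CV_tangent[OF Y(2)] CV_tangent[OF ZV]])
  have RZX: "RC x (Z x) (X x) = - RC x (X x) (Z x)"
    by (rule RC_skew[OF CV_tangent[OF ZV] CV_tangent[OF X(2)]])
  have brm: "brC x (a x) (b x) \<in> GC x" "brC x (a x) (s x) \<in> GC x" "brC x (r x) (b x) \<in> GC x"
    "brC x (r x) (s x) \<in> GC x" "brC x (a x) (c x) \<in> GC x" "brC x (b x) (c x) \<in> GC x" "brC x (c x) (r x) \<in> GC x"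
    using brC_in[OF m(6,7)] brC_in[OF m(6,5)] brC_in[OF m(4,7)] brC_in[OF m(4,5)] brC_in[OF m(6,8)]
      brC_in[OF m(7,8)] brC_in[OF m(8,4)] by simp_all
  have lieZX: "lieC Z X x = - lieC X Z x" by (rule lieC_antisym)
  have qZX: "\<sigma> x (lieC Z X x) = - q" unfolding lieZX q_def by (rule \<sigma>_uminus[OF \<Gamma>W_in[OF lie(2)]])
  have \<epsilon>CF: "(\<lambda>y. \<epsilon> y (Y y) (Z y)) \<in> CF" "(\<lambda>y. \<epsilon> y (X y) (Y y)) \<in> CF" "(\<lambda>y. \<epsilon> y (X y) (Z y)) \<in> CF"
    using \<epsilon>_smooth[OF Y(1) Z] \<epsilon>_smooth[OF X(1) Y(1)] \<epsilon>_smooth[OF X(1) Z] by simp_all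
  have \<epsilon>s: "\<epsilon> x (Y x) (lieC X Z x) = - \<epsilon> x (lieC X Z x) (Y x)" "\<epsilon> x (X x) (lieC Y Z x) = - \<epsilon> x (lieC Y Z x) (X x)"
    by (rule \<epsilon>_skew[OF \<Gamma>W_in[OF Y(1)] \<Gamma>W_in[OF lie(2)]], rule \<epsilon>_skew[OF \<Gamma>W_in[OF X(1)] \<Gamma>W_in[OF lie(3)]])
  have G: "cx1 prG (dorfmanC u v x) = RC x (X x) (Y x) + (nabC X b x + nabC X s x) - (nabC Y a x + nabC Y r x)
     + (brC x (a x) (b x) + brC x (a x) (s x) + (brC x (r x) (b x) + brC x (r x) (s x)))"
    by (simp add: dorfmanC_G Gu Gv Gu' Gv' T nabC_add[OF X(2) abc(2) s]
        nabC_add[OF Y(2) abc(1) r] brC_linear m GC_closed)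
  have "evC (cx1 prF (dorfmanC u v x)) (Z x) =
    2 *\<^sub>R derC X (\<lambda>y. \<epsilon> y (Y y) (Z y)) x
      - ((ipC x (nabC X c x) (b x) + ipC x (c x) (nabC X b x)) + 2 *\<^sub>R (ipC x (nabC X c x) (s x) + ipC x (c x) (nabC X s x)))
    - (2 *\<^sub>R \<epsilon> x (Y x) (lieC X Z x) - (ipC x q (b x) + 2 *\<^sub>R ipC x q (s x)))
    + (2 *\<^sub>R derC Z (\<lambda>y. \<epsilon> y (X y) (Y y)) x
      - ((ipC x (nabC Z b x) (a x) + ipC x (b x) (nabC Z a x)) + 2 *\<^sub>R (ipC x (nabC Z b x) (r x) + ipC x (b x) (nabC Z r x))))
    - (2 *\<^sub>R derC Y (\<lambda>y. \<epsilon> y (X y) (Z y)) x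
      - ((ipC x (nabC Y c x) (a x) + ipC x (c x) (nabC Y a x)) + 2 *\<^sub>R (ipC x (nabC Y c x) (r x) + ipC x (c x) (nabC Y r x))))
    + (2 *\<^sub>R \<epsilon> x (X x) (lieC Y Z x) - (ipC x t (a x) + 2 *\<^sub>R ipC x t (r x)))
    + cx3 (H x) (X x) (Y x) (Z x) - 2 *\<^sub>R ipC x (RC x (X x) (Z x)) (b x + s x)
    + 2 *\<^sub>R ipC x (RC x (Y x) (Z x)) (a x + r x) + 2 *\<^sub>R ipC x (nabC Z a x + nabC Z r x) (b x + s x)"
  proof -
    have uE: "u \<in> CE" "v \<in> CE" using u v by (auto simp: \<Gamma>L_iff)
    show ?thesis
      unfolding dorfmanC_F[OF uE ZV] T \<xi>[OF Z] \<eta>[OF Z] \<xi>[OF Y(1)]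
        fun_cong[OF \<xi>[OF lie(3)]] fun_cong[OF \<eta>[OF lie(2)]] Gu Gv Gu' Gv' \<sigma>abc
        q_def[symmetric] t_def[symmetric]
        derC_form[OF X(2) \<epsilon>CF(1) ipC_smooth[OF abc(3,2)] ipC_smooth[OF abc(3) s]]
        derC_form[OF ZV \<epsilon>CF(2) ipC_smooth[OF abc(2,1)] ipC_smooth[OF abc(2) r]]
        derC_form[OF Y(2) \<epsilon>CF(3) ipC_smooth[OF abc(3,1)] ipC_smooth[OF abc(3) r]]
        derC_ipC[OF X(2) abc(3,2)] derC_ipC[OF X(2) abc(3) s] derC_ipC[OF ZV abc(2,1)] derC_ipC[OF ZV abc(2) r]
        derC_ipC[OF Y(2) abc(3,1)] derC_ipC[OF Y(2) abc(3) r] nabC_add[OF ZV abc(1) r] ..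
  qed
  note F = this
  have E: "E3 X Y Z x = cx3 (H x) (X x) (Y x) (Z x)
    + 2 *\<^sub>R (derC X (\<lambda>y. \<epsilon> y (Y y) (Z y)) x - derC Y (\<lambda>y. \<epsilon> y (X y) (Z y)) x + derC Z (\<lambda>y. \<epsilon> y (X y) (Y y)) x
        - \<epsilon> x (lieC X Y x) (Z x) + \<epsilon> x (lieC X Z x) (Y x) - \<epsilon> x (lieC Y Z x) (X x))
    + 2 *\<^sub>R (ipC x (RC x (X x) (Y x)) (c x) + ipC x (RC x (Y x) (Z x)) (a x) + ipC x (- RC x (X x) (Z x)) (b x))
    + (ipC x (nabC X b x - nabC Y a x - p) (c x) + ipC x (nabC Y c x - nabC Z b x - t) (a x)
      + ipC x (nabC Z a x - nabC X c x + q) (b x))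
    + 2 *\<^sub>R ipC x (brC x (a x) (b x)) (c x)"
    unfolding E3_def d_epsilon_def wedge_ip_def d_sigma_def \<sigma>abc RZX qZX p_def[symmetric] t_def[symmetric] by simp
  have C: "curv X Z x = RC x (X x) (Z x) + (nabC X c x - nabC Z a x - q) + brC x (a x) (c x)"
    "curv Y Z x = RC x (Y x) (Z x) + (nabC Y c x - nabC Z b x - t) + brC x (b x) (c x)"
    "pcon Z r x = nabC Z r x + brC x (c x) (r x)"
    unfolding curv_def pcon_def d_sigma_def \<sigma>abc q_def t_def by simp_all
  \<comment> \<open>The three relations rewrite the cubic terms as \<open>c x\<close> paired with a
    bracket, as they occur in the subtracted term. With these and symmetry of the pairing, the final
    comparison is linear.\<close>
  have inv1: "ipC x (brC x (a x) (c x)) (s x) = - ipC x (c x) (brC x (a x) (s x))"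
    by (rule ipC_invariant) (use m in auto)
  have inv2: "ipC x (brC x (b x) (c x)) (r x) = ipC x (c x) (brC x (r x) (b x))"
  proof -
    have "ipC x (brC x (b x) (c x)) (r x) = - ipC x (brC x (c x) (b x)) (r x)"
      using brC_skew[OF m(7,8)] brC_in[OF m(8,7)] m ipC_linear(3)[of 0 x "brC x (c x) (b x)" "r x"] 
        ipC_scale(1)[OF brC_in[OF m(8,7)] m(4), of "-1"] by simp
    also have "\<dots> = ipC x (b x) (brC x (c x) (r x))" using ipC_invariant[OF m(8,7,4)] by simp
    also have "\<dots> = ipC x (brC x (c x) (r x)) (b x)" by (rule ipC_sym) (use m brm in auto)
    also have "\<dots> = - ipC x (brC x (r x) (c x)) (b x)"
      using brC_skew[OF m(8,4)] ipC_scale(1)[OF brC_in[OF m(4,8)] m(7), of "-1"] by simp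
    also have "\<dots> = ipC x (c x) (brC x (r x) (b x))" using ipC_invariant[OF m(4,8,7)] by simp
    finally show ?thesis .
  qed
  have inv3: "ipC x (brC x (c x) (r x)) (s x) = ipC x (c x) (brC x (r x) (s x))"
  proof -
    have "ipC x (brC x (c x) (r x)) (s x) = - ipC x (brC x (r x) (c x)) (s x)"
      using brC_skew[OF m(8,4)] ipC_scale(1)[OF brC_in[OF m(4,8)] m(5), of "-1"] by simp
    also have "\<dots> = ipC x (c x) (brC x (r x) (s x))" using ipC_invariant[OF m(4,8,5)] by simp
    finally show ?thesis .
  qed
  have neg: "ipC x (- w) z = - ipC x w z" if "w \<in> GC x" "z \<in> GC x" for w z
    using ipC_scale(1)[OF that, of "-1"] by simp
  have sym: "ipC x (RC x (X x) (Y x)) (c x) = ipC x (c x) (RC x (X x) (Y x))"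
    "ipC x (nabC X b x) (c x) = ipC x (c x) (nabC X b x)" "ipC x (nabC Y a x) (c x) = ipC x (c x) (nabC Y a x)"
    "ipC x p (c x) = ipC x (c x) p" "ipC x (brC x (a x) (b x)) (c x) = ipC x (c x) (brC x (a x) (b x))"
    "ipC x (b x) (nabC Z a x) = ipC x (nabC Z a x) (b x)" "ipC x (b x) (nabC Z r x) = ipC x (nabC Z r x) (b x)"
    using ipC_sym[OF Rm(1) m(8)] ipC_sym[OF n(1) m(8)] ipC_sym[OF n(4) m(8)] ipC_sym[OF m(1,8)]
      ipC_sym[OF brm(1) m(8)] ipC_sym[OF m(7) n(7)] ipC_sym[OF m(7) n(9)] by simp_all
  note mem = m n Rm brm GC_closed
  show ?thesis
    unfolding F E G r_def[symmetric] s_def[symmetric] C \<sigma>abc p_def[symmetric]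
    by (simp only: ipC_linear mem ipC_scale neg inv1 inv2 inv3 sym \<epsilon>s)
      (simp add: prod_eq_iff algebra_simps)
qed

subsection \<open>Tensoriality\<close>

text \<open>The Leibniz correction is a multiple of \<open>X x\<close>, which already lies in
  \<open>W x\<close>.\<close>

lemma lieC_W_cancel:
  assumes f: "f \<in> smooth_funs A" "f x \<noteq> 0" and X: "X \<in> \<Gamma>W" and Y: "Y \<in> \<Gamma>W"
    and W: "lieC (\<lambda>x. f x *\<^sub>R X x) Y x \<in> W x"
  shows "lieC X Y x \<in> W x"
proof -
  have "f x *\<^sub>R lieC X Y x - cscale (dC (Y x) f) (X x) \<in> W x"
    using W lieC_scale_left[OF f(1) \<Gamma>W_CV[OF X] \<Gamma>W_CV[OF Y]] by simp
  then have "(f x *\<^sub>R lieC X Y x - cscale (dC (Y x) f) (X x)) + cscale (dC (Y x) f) (X x) \<in> W x"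
    using cx.subspace_add[OF W_subspace] cx.subspace_scale[OF W_subspace \<Gamma>W_in[OF X]] by blast
  then have "(1 / f x) *\<^sub>R (f x *\<^sub>R lieC X Y x) \<in> W x" by (intro cx_subspace_scaleR[OF W_subspace, where c = "1 / f x"]) simp
  then show ?thesis using f(2) by simp
qed

context
  assumes inv: "\<And>X Y. X \<in> \<Gamma>W \<Longrightarrow> Y \<in> \<Gamma>W \<Longrightarrow> lieC X Y \<in> \<Gamma>W"
begin

lemma d_sigma_skew:
  assumes "X \<in> \<Gamma>W" "Y \<in> \<Gamma>W" shows "d_sigma nabla \<sigma> X Y x = - d_sigma nabla \<sigma> Y X x"
  unfolding d_sigma_def lieC_antisym[of X Y] by (simp add: \<sigma>_uminus[OF \<Gamma>W_in[OF inv[OF assms(2,1)]]])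

text \<open>The term \<open>\<sigma>(X)\<close> times the derivative of \<open>f\<close> along
  \<open>Y\<close> arises from the covariant derivative and from the Lie bracket, with opposite
  signs.\<close>

lemma d_sigma_scale:
  assumes f: "f \<in> smooth_funs A" and X: "X \<in> \<Gamma>W" and Y: "Y \<in> \<Gamma>W"
  shows "d_sigma nabla \<sigma> (\<lambda>x. f x *\<^sub>R X x) Y x = f x *\<^sub>R d_sigma nabla \<sigma> X Y x"
proof -
  have s: "(\<lambda>y. \<sigma> y (f y *\<^sub>R X y)) = (\<lambda>y. f y *\<^sub>R \<sigma> y (X y))" by (simp add: \<sigma>_scale \<Gamma>W_in[OF X])
  have W: "f x *\<^sub>R lieC X Y x \<in> W x" "cscale (dC (Y x) f) (X x) \<in> W x"
    using cx_subspace_scaleR[OF W_subspace \<Gamma>W_in[OF inv[OF X Y]]] cx.subspace_scale[OF W_subspace \<Gamma>W_in[OF X]] by blast+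
  show ?thesis
    unfolding d_sigma_def s nabC_scale_field[OF \<Gamma>W_CV[OF X] s\<sigma>_in[OF Y]] nabC_mult[OF \<Gamma>W_CV[OF Y] s\<sigma>_in[OF X] f]
      lieC_scale_left[OF f \<Gamma>W_CV[OF X] \<Gamma>W_CV[OF Y]] \<sigma>_diff[OF W] \<sigma>_scale[OF \<Gamma>W_in[OF inv[OF X Y]]] \<sigma>_cscale[OF \<Gamma>W_in[OF X]]
    by (simp add: scaleR_diff_right)
qed

lemma curv_skew:
  assumes X: "X \<in> \<Gamma>W" and Y: "Y \<in> \<Gamma>W" shows "curv X Y x = - curv Y X x"
  using d_sigma_skew[OF assms, of x] RC_skew[OF CV_tangent[OF \<Gamma>W_CV[OF X]] CV_tangent[OF \<Gamma>W_CV[OF Y]], of x]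
    brC_skew[OF \<sigma>_in[OF \<Gamma>W_in[OF X]] \<sigma>_in[OF \<Gamma>W_in[OF Y]], of x]
  by (simp add: curv_def)

lemma curv_scale:
  assumes f: "f \<in> smooth_funs A" and X: "X \<in> \<Gamma>W" and Y: "Y \<in> \<Gamma>W"
  shows "curv (\<lambda>x. f x *\<^sub>R X x) Y x = f x *\<^sub>R curv X Y x"
  using d_sigma_scale[OF assms, of x] CV_tangent[OF \<Gamma>W_CV[OF X], of x] CV_tangent[OF \<Gamma>W_CV[OF Y], of x]
  by (simp add: curv_def \<sigma>_scale \<Gamma>W_in X Y RC_scale brC_scale \<sigma>_in scaleR_add_right)

text \<open>\<open>H_linear\<close> speaks of the last two slots; the first slot is reached by
  skewness.\<close>

lemma cx3_H:
  assumes "u \<in> TC x" "v \<in> TC x" "w \<in> TC x"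
  shows "cx3 (H x) (c *\<^sub>R u) v w = c *\<^sub>R cx3 (H x) u v w" "cx3 (H x) u v w = - cx3 (H x) v u w"
proof -
  have skew: "H x u v w = - H x v u w" if "u \<in> tangent_space A x" "v \<in> tangent_space A x" "w \<in> tangent_space A x"
    for u v w using H_skew[OF that] by blast
  have scale: "H x (c *\<^sub>R u) v w = c * H x u v w"
    if "u \<in> tangent_space A x" "v \<in> tangent_space A x" "w \<in> tangent_space A x" for c u v w
  proof -
    have "H x (c *\<^sub>R u) v w = - H x v (c *\<^sub>R u) w"
      using skew subspace_scale[OF tangent_subspace] that by blast
    also have "\<dots> = c * - H x v u w"
      using lin_on_scale[OF bilin_lin_left[OF H_linear[OF that(2)] that(3)] that(1)] by simp
    also have "\<dots> = c * H x u v w" using skew[OF that] by simp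
    finally show ?thesis .
  qed
  show "cx3 (H x) (c *\<^sub>R u) v w = c *\<^sub>R cx3 (H x) u v w"
    using assms by (auto simp: cx3_def scale algebra_simps)
  have t: "fst u \<in> tangent_space A x" "snd u \<in> tangent_space A x" "fst v \<in> tangent_space A x"
    "snd v \<in> tangent_space A x" "fst w \<in> tangent_space A x" "snd w \<in> tangent_space A x" using assms by auto
  show "cx3 (H x) u v w = - cx3 (H x) v u w"
    unfolding cx3_def
      skew[OF t(1,3,5)] skew[OF t(1,4,6)] skew[OF t(2,3,6)] skew[OF t(2,4,5)]
      skew[OF t(1,3,6)] skew[OF t(1,4,5)] skew[OF t(2,3,5)] skew[OF t(2,4,6)] by simp
qed

text \<open>The derivatives of \<open>f\<close> along \<open>Y\<close> and along \<open>Z\<close>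
  each occur twice, once from differentiating a value of \<open>\<epsilon>\<close> and once from a
  Lie bracket, and cancel.\<close>

lemma d_epsilon_scale:
  assumes f: "f \<in> smooth_funs A" and X: "X \<in> \<Gamma>W" and Y: "Y \<in> \<Gamma>W" and Z: "Z \<in> \<Gamma>W"
  shows "d_epsilon \<epsilon> (\<lambda>x. f x *\<^sub>R X x) Y Z x = f x *\<^sub>R d_epsilon \<epsilon> X Y Z x"
proof -
  note V = \<Gamma>W_CV[OF X] \<Gamma>W_CV[OF Y] \<Gamma>W_CV[OF Z] and Wx = \<Gamma>W_in[OF X] \<Gamma>W_in[OF Y] \<Gamma>W_in[OF Z]
  note lie = \<Gamma>W_in[OF inv[OF X Y]] \<Gamma>W_in[OF inv[OF X Z]] \<Gamma>W_in[OF inv[OF Y Z]]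
  have e: "(\<lambda>y. \<epsilon> y (f y *\<^sub>R X y) (Y y)) = (\<lambda>y. f y *\<^sub>R \<epsilon> y (X y) (Y y))"
    "(\<lambda>y. \<epsilon> y (f y *\<^sub>R X y) (Z y)) = (\<lambda>y. f y *\<^sub>R \<epsilon> y (X y) (Z y))"
    by (simp_all add: \<epsilon>_scale_left Wx)
  have "\<epsilon> x (lieC Y Z x) (f x *\<^sub>R X x) = f x *\<^sub>R \<epsilon> x (lieC Y Z x) (X x)"
    using \<epsilon>_right(2)[OF lie(3) Wx(1) Wx(1), of x "complex_of_real (f x)"] by (simp add: cscale_of_real)
  then show ?thesis
    unfolding d_epsilon_def e derC_scale_field derC_mult[OF V(2) \<epsilon>_smooth[OF X Z] f] derC_mult[OF V(3) \<epsilon>_smooth[OF X Y] f]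
      lieC_scale_left[OF f V(1,2)] lieC_scale_left[OF f V(1,3)] \<epsilon>_scale_diff_left[OF lie(1) Wx(1) Wx(3)]
      \<epsilon>_scale_diff_left[OF lie(2) Wx(1) Wx(2)]
    by (simp add: scaleR_diff_right scaleR_add_right)
qed

lemma d_epsilon_skew:
  assumes X: "X \<in> \<Gamma>W" and Y: "Y \<in> \<Gamma>W" and Z: "Z \<in> \<Gamma>W"
  shows "d_epsilon \<epsilon> X Y Z x = - d_epsilon \<epsilon> Y X Z x"
proof -
  have e: "(\<lambda>y. \<epsilon> y (X y) (Y y)) = (\<lambda>y. - \<epsilon> y (Y y) (X y))"
    using \<epsilon>_skew[OF \<Gamma>W_in[OF X] \<Gamma>W_in[OF Y]] by blast
  show ?thesis
    unfolding d_epsilon_def e derC_uminus[OF \<Gamma>W_CV[OF Z] \<epsilon>_smooth[OF Y X]] lieC_antisym[of X Y]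
      \<epsilon>_uminus_left[OF \<Gamma>W_in[OF inv[OF Y X]] \<Gamma>W_in[OF Z]] by simp
qed

lemma E3_scale:
  assumes f: "f \<in> smooth_funs A" and X: "X \<in> \<Gamma>W" and Y: "Y \<in> \<Gamma>W" and Z: "Z \<in> \<Gamma>W"
  shows "E3 (\<lambda>x. f x *\<^sub>R X x) Y Z x = f x *\<^sub>R E3 X Y Z x"
proof -
  note T = CV_tangent[OF \<Gamma>W_CV[OF X], of x] CV_tangent[OF \<Gamma>W_CV[OF Y], of x] CV_tangent[OF \<Gamma>W_CV[OF Z], of x]
  note s = \<sigma>_in[OF \<Gamma>W_in[OF X]] \<sigma>_in[OF \<Gamma>W_in[OF Y]] \<sigma>_in[OF \<Gamma>W_in[OF Z]]
  have dm: "d_sigma nabla \<sigma> V V' x \<in> GC x" if "V \<in> \<Gamma>W" "V' \<in> \<Gamma>W" for V V'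
    unfolding d_sigma_def
    by (intro GC_closed CS_fibre[OF nabC_smooth] s\<sigma>_in \<Gamma>W_CV \<sigma>_in[OF \<Gamma>W_in] inv that)
  \<comment> \<open>The cyclic sum in \<open>wedge_ip\<close> has \<open>X\<close> in the second
    slot here, so scaling is transported by skewness.\<close>
  have ZX: "d_sigma nabla \<sigma> Z (\<lambda>x. f x *\<^sub>R X x) x = f x *\<^sub>R d_sigma nabla \<sigma> Z X x"
    using d_sigma_skew[OF Z \<Gamma>W_scale[OF f X], of x] d_sigma_skew[OF Z X, of x] d_sigma_scale[OF f X Z, of x] by simp
  have *: "wedge_ip ip (\<lambda>X Y x. RC x (X x) (Y x)) \<sigma> (\<lambda>x. f x *\<^sub>R X x) Y Z x
      = f x *\<^sub>R wedge_ip ip (\<lambda>X Y x. RC x (X x) (Y x)) \<sigma> X Y Z x"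
    "wedge_ip ip (d_sigma nabla \<sigma>) \<sigma> (\<lambda>x. f x *\<^sub>R X x) Y Z x = f x *\<^sub>R wedge_ip ip (d_sigma nabla \<sigma>) \<sigma> X Y Z x"
    using T s dm[OF X Y] dm[OF Y Z] dm[OF Z X]
    by (simp_all add: wedge_ip_def RC_scale ipC_scale \<sigma>_scale \<Gamma>W_in[OF X] RC_in ZX d_sigma_scale[OF f X Y] scaleR_add_right)
  have b: "ipC x (brC x (\<sigma> x (f x *\<^sub>R X x)) (\<sigma> x (Y x))) (\<sigma> x (Z x))
      = f x *\<^sub>R ipC x (brC x (\<sigma> x (X x)) (\<sigma> x (Y x))) (\<sigma> x (Z x))"
    using s by (simp add: \<sigma>_scale \<Gamma>W_in[OF X] brC_scale ipC_scale brC_in)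
  show ?thesis
    unfolding E3_def * b cx3_H(1)[OF T] d_epsilon_scale[OF assms]
    by (simp add: scaleR_add_right mult.commute)
qed

text \<open>Only \<open>X\<close> and \<open>Y\<close> are replaced by liftable multiples later,
  while \<open>Z\<close> is left as it is. Scaling in the first slot and exchange of the first two
  slots are therefore all the tensoriality required.\<close>

lemma E3_skew:
  assumes X: "X \<in> \<Gamma>W" and Y: "Y \<in> \<Gamma>W" and Z: "Z \<in> \<Gamma>W"
  shows "E3 X Y Z x = - E3 Y X Z x"
proof -
  note T = CV_tangent[OF \<Gamma>W_CV[OF X], of x] CV_tangent[OF \<Gamma>W_CV[OF Y], of x] CV_tangent[OF \<Gamma>W_CV[OF Z], of x]
  note s = \<sigma>_in[OF \<Gamma>W_in[OF X], of x] \<sigma>_in[OF \<Gamma>W_in[OF Y], of x] \<sigma>_in[OF \<Gamma>W_in[OF Z], of x]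
  have neg: "ipC x (- w) z = - ipC x w z" if "w \<in> GC x" "z \<in> GC x" for w z
    using ipC_scale(1)[OF that, of "-1"] by simp
  have dm: "d_sigma nabla \<sigma> V V' x \<in> GC x" if "V \<in> \<Gamma>W" "V' \<in> \<Gamma>W" for V V'
    unfolding d_sigma_def
    by (intro GC_closed CS_fibre[OF nabC_smooth] s\<sigma>_in \<Gamma>W_CV \<sigma>_in[OF \<Gamma>W_in] inv that)
  have 1: "wedge_ip ip (\<lambda>X Y x. RC x (X x) (Y x)) \<sigma> X Y Z x = - wedge_ip ip (\<lambda>X Y x. RC x (X x) (Y x)) \<sigma> Y X Z x"
    unfolding wedge_ip_def RC_skew[OF T(1,2)] RC_skew[OF T(2,3)] RC_skew[OF T(3,1)]
      neg[OF RC_in[OF T(2,1)] s(3)] neg[OF RC_in[OF T(3,2)] s(1)] neg[OF RC_in[OF T(1,3)] s(2)] by simp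
  have 2: "wedge_ip ip (d_sigma nabla \<sigma>) \<sigma> X Y Z x = - wedge_ip ip (d_sigma nabla \<sigma>) \<sigma> Y X Z x"
    unfolding wedge_ip_def d_sigma_skew[OF X Y] d_sigma_skew[OF Y Z] d_sigma_skew[OF Z X]
      neg[OF dm[OF Y X] s(3)] neg[OF dm[OF Z Y] s(1)] neg[OF dm[OF X Z] s(2)] by simp
  show ?thesis
    unfolding E3_def 1 2 cx3_H(2)[OF T] d_epsilon_skew[OF assms] brC_skew[OF s(1,2)] neg[OF brC_in[OF s(2,1)] s(3)]
    by simp
qed

end

end

section \<open>Integrability and the five conditions, in both directions\<close>

context courant_almost_complex
begin

lemma lieC_zero: "lieC (\<lambda>x. 0) X x = 0" if "X \<in> CV"
proof -
  have "lieC (\<lambda>x. 0 *\<^sub>R X x) X x = 0 *\<^sub>R lieC X X x - cscale (dC (X x) (\<lambda>x. 0)) (X x)"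
    by (rule lieC_scale_left[OF smooth_funs_const that that])
  moreover have "dC (X x) (\<lambda>x. 0) = 0"
    using tangent_const[OF CV_parts(3)[OF that]] tangent_const[OF CV_parts(4)[OF that]]
    by (simp add: dC_def complex_eq_iff)
  ultimately show ?thesis by (simp only: scaleR_zero_left cx.scale_zero_left diff_zero)
qed

lemma CV_zero: "(\<lambda>x. 0) \<in> CV"
  using \<Gamma>L_T_CV[OF \<Gamma>L_zero] by (simp only: cx1_fst_linear)

lemma nabC_zero: "s \<in> CS \<Longrightarrow> nabC (\<lambda>x. 0) s x = 0"
  using nabC_scale_field[OF CV_zero, of s "\<lambda>x. 0" x] by (simp only: scaleR_zero_left)

lemma RC_zero: assumes "w \<in> TC x" shows "RC x 0 w = 0" "RC x w 0 = 0"
  using RC_scale[OF assms assms, of 0] by simp_all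

lemma \<Gamma>L_closed_iff:
  assumes "u \<in> \<Gamma>L" "v \<in> \<Gamma>L"
  shows "dorfmanC u v \<in> \<Gamma>L \<longleftrightarrow> (\<forall>x. dorfmanC u v x \<in> L x)"
  using dorfmanC_in assms by (simp add: \<Gamma>L_iff)

lemma integrable_iff:
  "courant_integrable A G F br ip nabla R H J \<longleftrightarrow> (\<forall>u\<in>\<Gamma>L. \<forall>v\<in>\<Gamma>L. \<forall>x. dorfmanC u v x \<in> L x)"
  unfolding courant_integrable_def Let_def using \<Gamma>L_closed_iff by blast

lemma pcon_smooth: "X \<in> \<Gamma>W \<Longrightarrow> r \<in> CS \<Longrightarrow> pcon X r \<in> CS"
  unfolding pcon_def[abs_def] by (intro CS_add nabC_smooth brC_smooth s\<sigma>_in \<Gamma>W_CV)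

text \<open>When one section has zero tangent part everywhere, so has the bracket. Its
  \<open>G\<close>-part then lies in \<open>D x\<close> by the definition of \<open>D\<close>,
  without any reference to \<open>\<sigma>\<close>.\<close>

lemma kernel_bracket:
  assumes u: "u \<in> \<Gamma>L" and w: "w \<in> \<Gamma>L" "\<And>x. cx1 prT (w x) = 0" and L: "dorfmanC u w x \<in> L x"
  shows "nabC (\<lambda>x. cx1 prT (u x)) (\<lambda>x. cx1 prG (w x)) x + brC x (cx1 prG (u x)) (cx1 prG (w x)) \<in> D x"
proof -
  have T: "cx1 prT (dorfmanC u w x) = 0"
    using lieC_antisym[of "\<lambda>x. cx1 prT (u x)" "\<lambda>x. 0" x] lieC_zero[OF \<Gamma>L_T_CV[OF u]]
    by (simp only: dorfmanC_T w(2) minus_zero)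
  have "cx1 prG (dorfmanC u w x) = nabC (\<lambda>x. cx1 prT (u x)) (\<lambda>x. cx1 prG (w x)) x + brC x (cx1 prG (u x)) (cx1 prG (w x))"
    by (simp only: dorfmanC_G w(2) RC_zero[OF CV_tangent[OF \<Gamma>L_T_CV[OF u]]] nabC_zero[OF \<Gamma>L_G[OF u]]
        add_0_left diff_zero)
  then show ?thesis using T L unfolding D_iff by metis
qed

text \<open>The bracket of liftable multiples is the tangent part of a bracket in \<open>L\<close>.
  The multipliers are cancelled one after the other in the left slot, with antisymmetry exchanging
  the slots in between.\<close>

lemma integrable_W:
  assumes int: "\<And>u v x. u \<in> \<Gamma>L \<Longrightarrow> v \<in> \<Gamma>L \<Longrightarrow> dorfmanC u v x \<in> L x"
    and X: "X \<in> \<Gamma>W" and Y: "Y \<in> \<Gamma>W"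
  shows "lieC X Y \<in> \<Gamma>W"
proof -
  have "lieC X Y x \<in> W x" for x
  proof -
    obtain \<theta> u where u: "\<theta> \<in> smooth_funs A" "\<theta> x \<noteq> 0" "u \<in> \<Gamma>L" "\<And>y. cx1 prT (u y) = \<theta> y *\<^sub>R X y"
      by (rule W_lift[OF X, of x], rule that)
    obtain \<rho> v where v: "\<rho> \<in> smooth_funs A" "\<rho> x \<noteq> 0" "v \<in> \<Gamma>L" "\<And>y. cx1 prT (v y) = \<rho> y *\<^sub>R Y y"
      by (rule W_lift[OF Y, of x], rule that)
    have "lieC (\<lambda>y. \<theta> y *\<^sub>R X y) (\<lambda>y. \<rho> y *\<^sub>R Y y) x \<in> W x"
      using L_data(1)[OF int[OF u(3) v(3)], of x] by (simp only: dorfmanC_T u(4) v(4))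
    then have "lieC X (\<lambda>y. \<rho> y *\<^sub>R Y y) x \<in> W x"
      by (rule lieC_W_cancel[OF u(1,2) X \<Gamma>W_scale[OF v(1) Y]])
    then have "lieC (\<lambda>y. \<rho> y *\<^sub>R Y y) X x \<in> W x"
      unfolding lieC_antisym[of "\<lambda>y. \<rho> y *\<^sub>R Y y"] by (rule cx.subspace_neg[OF W_subspace])
    then have "lieC Y X x \<in> W x" by (rule lieC_W_cancel[OF v(1,2) Y X])
    then show ?thesis unfolding lieC_antisym[of X] by (rule cx.subspace_neg[OF W_subspace])
  qed
  then show ?thesis using lieC_in[OF \<Gamma>W_CV[OF X] \<Gamma>W_CV[OF Y]] by (simp add: \<Gamma>W_iff)
qed

lemma integrable_D:
  assumes int: "\<And>u v x. u \<in> \<Gamma>L \<Longrightarrow> v \<in> \<Gamma>L \<Longrightarrow> dorfmanC u v x \<in> L x"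
    and "r \<in> D x" "s \<in> D x"
  shows "brC x r s \<in> D x"
proof -
  obtain u where u: "u \<in> \<Gamma>L" "\<And>y. cx1 prT (u y) = 0" "cx1 prG (u x) = r" using D_lift[OF assms(2)] by blast
  obtain v where v: "v \<in> \<Gamma>L" "\<And>y. cx1 prT (v y) = 0" "cx1 prG (v x) = s" using D_lift[OF assms(3)] by blast
  show ?thesis
    using kernel_bracket[OF u(1) v(1,2) int[OF u(1) v(1)], of x]
    by (simp only: u(2) nabC_zero[OF \<Gamma>L_G[OF v(1)]] u(3) v(3) add_0_left)
qed

text \<open>Since \<open>D\<close> is its own orthogonal complement, preserving it is tensorial in the section of \<open>D\<close>,
  so it suffices to test on sections that come from the kernel of \<open>L \<rightarrow> W\<close>.\<close>

lemma integrable_pcon: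
  assumes int: "\<And>u v x. u \<in> \<Gamma>L \<Longrightarrow> v \<in> \<Gamma>L \<Longrightarrow> dorfmanC u v x \<in> L x"
    and X: "X \<in> \<Gamma>W" and r: "r \<in> \<Gamma>D"
  shows "pcon X r x \<in> D x"
proof (rule D_perp)
  note rS = \<Gamma>D_CS[OF r]
  show "pcon X r x \<in> GC x" by (rule CS_fibre[OF pcon_smooth[OF X rS]])
  obtain w where w: "w \<in> \<Gamma>L" "\<And>y. cx1 prT (w y) = 0" "cx1 prG (w x) = r x" using D_lift[OF \<Gamma>D_in[OF r]] by blast
  obtain \<theta> u where u: "\<theta> \<in> smooth_funs A" "\<theta> x \<noteq> 0" "u \<in> \<Gamma>L" "\<And>y. cx1 prT (u y) = \<theta> y *\<^sub>R X y"
    by (rule W_lift[OF X, of x], rule that)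
  have kernel_D: "(\<lambda>y. cx1 prG (w y)) \<in> \<Gamma>D" if "w \<in> \<Gamma>L" "\<And>y. cx1 prT (w y) = 0" for w
    unfolding \<Gamma>D_iff D_iff using that \<Gamma>L_G by (auto simp: \<Gamma>L_iff CE_iff)
  define r' where "r' = (\<lambda>y. cx1 prG (w y))"
  have r': "r' \<in> \<Gamma>D" "r' \<in> CS" "r' x = r x"
    using kernel_D[OF w(1,2)] \<Gamma>D_CS w(3) by (auto simp: r'_def)
  have m: "nabC X r' x \<in> GC x" "\<sigma> x (X x) \<in> GC x" "r x \<in> GC x" "rest u x \<in> GC x" "rest u x \<in> D x" "r x \<in> D x"
    using CS_fibre[OF nabC_smooth[OF \<Gamma>W_CV[OF X] r'(2)]] \<sigma>_in[OF \<Gamma>W_in[OF X]] CS_fibre[OF rS]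
      CS_fibre[OF \<Gamma>D_CS[OF rest_in[OF u(3)]]] \<Gamma>D_in[OF rest_in[OF u(3)]] \<Gamma>D_in[OF r] by blast+
  have Gu: "cx1 prG (u x) = \<theta> x *\<^sub>R \<sigma> x (X x) + rest u x"
    by (simp add: rest_def u(4) \<sigma>_scale \<Gamma>W_in[OF X])
  have "nabC (\<lambda>y. \<theta> y *\<^sub>R X y) r' x + brC x (\<theta> x *\<^sub>R \<sigma> x (X x) + rest u x) (r x) \<in> D x"
    using kernel_bracket[OF u(3) w(1,2) int[OF u(3) w(1)], of x]
    by (simp only: u(4) r'_def[symmetric] w(3) Gu)
  also have "nabC (\<lambda>y. \<theta> y *\<^sub>R X y) r' x + brC x (\<theta> x *\<^sub>R \<sigma> x (X x) + rest u x) (r x)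
      = \<theta> x *\<^sub>R (nabC X r' x + brC x (\<sigma> x (X x)) (r x)) + brC x (rest u x) (r x)"
    using m by (simp add: nabC_scale_field[OF \<Gamma>W_CV[OF X] r'(2)] brC_linear brC_scale GC_closed scaleR_add_right add.assoc)
  \<comment> \<open>The lift of a multiple of \<open>X\<close> carries an uncontrolled part
    \<open>rest u x\<close> in \<open>D\<close>; its bracket with \<open>r x\<close> stays in
    \<open>D\<close> by condition B and can be subtracted.\<close>
  finally have "(\<theta> x *\<^sub>R (nabC X r' x + brC x (\<sigma> x (X x)) (r x)) + brC x (rest u x) (r x)) - brC x (rest u x) (r x) \<in> D x"
    by (rule D_closed(2)[OF _ integrable_D[OF int m(5,6)]])
  then have "(1 / \<theta> x) *\<^sub>R (\<theta> x *\<^sub>R (nabC X r' x + brC x (\<sigma> x (X x)) (r x))) \<in> D x"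
    by (intro D_closed(3)[where c = "1 / \<theta> x"]) (simp only: add_diff_cancel_right')
  then have D': "nabC X r' x + brC x (\<sigma> x (X x)) (r x) \<in> D x" using u(2) by simp
  fix s assume s: "s \<in> D x"
  obtain z where z: "z \<in> \<Gamma>L" "\<And>y. cx1 prT (z y) = 0" "cx1 prG (z x) = s" using D_lift[OF s] by blast
  define s' where "s' = (\<lambda>y. cx1 prG (z y))"
  have s': "s' \<in> \<Gamma>D" "s' \<in> CS" "s' x = s"
    using kernel_D[OF z(1,2)] \<Gamma>D_CS z(3) by (auto simp: s'_def)
  \<comment> \<open>Differentiating the vanishing pairing of two sections of \<open>D\<close> shows
    that the covariant derivative of \<open>t\<close>, paired with \<open>s\<close>, depends on
    \<open>t\<close> only through its value at \<open>x\<close>. This permits exchanging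
    \<open>r\<close> for \<open>r'\<close>.\<close>
  have skew: "ipC x (nabC X t x) s = - ipC x (t x) (nabC X s' x)" if t: "t \<in> \<Gamma>D" for t
  proof -
    have "(\<lambda>y. ipC y (t y) (s' y)) = (\<lambda>y. 0)" using D_isotropic[OF \<Gamma>D_in[OF t] \<Gamma>D_in[OF s'(1)]] by blast
    moreover have "derC X (\<lambda>y. 0) x = 0"
      using derC_const_scale[OF \<Gamma>W_CV[OF X] ipC_smooth[OF \<Gamma>D_CS[OF t] s'(2)], of 0 x] by (simp only: scaleR_zero_left)
    ultimately have "ipC x (nabC X t x) (s' x) + ipC x (t x) (nabC X s' x) = 0"
      using derC_ipC[OF \<Gamma>W_CV[OF X] \<Gamma>D_CS[OF t] s'(2), of x] by simp
    then show ?thesis by (simp add: s'(3) eq_neg_iff_add_eq_0)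
  qed
  have sG: "s \<in> GC x" and b: "brC x (\<sigma> x (X x)) (r x) \<in> GC x" and n: "nabC X r x \<in> GC x"
    using D_GC[OF s] brC_in[OF m(2,3)] CS_fibre[OF nabC_smooth[OF \<Gamma>W_CV[OF X] rS]] by blast+
  have "ipC x (pcon X r x) s = ipC x (nabC X r x) s + ipC x (brC x (\<sigma> x (X x)) (r x)) s"
    unfolding pcon_def by (rule ipC_linear(1)[OF n b sG])
  also have "\<dots> = ipC x (nabC X r' x) s + ipC x (brC x (\<sigma> x (X x)) (r x)) s"
    using skew[OF r] skew[OF r'(1)] r'(3) by simp
  also have "\<dots> = ipC x (nabC X r' x + brC x (\<sigma> x (X x)) (r x)) s"
    by (rule ipC_linear(1)[OF m(1) b sG, symmetric])
  also have "\<dots> = 0" by (rule D_isotropic[OF D' s])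
  finally show "ipC x (pcon X r x) s = 0" .
qed

text \<open>For sections lifting multiples of \<open>X\<close> and \<open>Y\<close>, every term of
  the decomposition of the \<open>G\<close>-part other than \<open>curv\<close> lies in
  \<open>D x\<close> by conditions B and C.\<close>

lemma integrable_curv:
  assumes int: "\<And>u v x. u \<in> \<Gamma>L \<Longrightarrow> v \<in> \<Gamma>L \<Longrightarrow> dorfmanC u v x \<in> L x"
    and X: "X \<in> \<Gamma>W" and Y: "Y \<in> \<Gamma>W"
  shows "curv X Y x \<in> D x"
proof -
  note inv = integrable_W[OF int]
  obtain \<theta> u where u: "\<theta> \<in> smooth_funs A" "\<theta> x \<noteq> 0" "u \<in> \<Gamma>L" "\<And>y. cx1 prT (u y) = \<theta> y *\<^sub>R X y"
    by (rule W_lift[OF X, of x], rule that)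
  obtain \<rho> v where v: "\<rho> \<in> smooth_funs A" "\<rho> x \<noteq> 0" "v \<in> \<Gamma>L" "\<And>y. cx1 prT (v y) = \<rho> y *\<^sub>R Y y"
    by (rule W_lift[OF Y, of x], rule that)
  let ?X = "\<lambda>y. \<theta> y *\<^sub>R X y" and ?Y = "\<lambda>y. \<rho> y *\<^sub>R Y y"
  have X': "?X \<in> \<Gamma>W" by (rule \<Gamma>W_scale[OF u(1) X])
  have Y': "?Y \<in> \<Gamma>W" by (rule \<Gamma>W_scale[OF v(1) Y])
  have d: "curv ?X ?Y x + pcon ?X (rest v) x - pcon ?Y (rest u) x + brC x (rest u x) (rest v x) \<in> D x"
    using L_data(2)[OF int[OF u(3) v(3)], of x] G_decomposition[OF u(3) v(3), of x]
    by (simp only: dorfmanC_T u(4) v(4))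
  have e: "pcon ?X (rest v) x \<in> D x" "pcon ?Y (rest u) x \<in> D x" "brC x (rest u x) (rest v x) \<in> D x"
    using integrable_pcon[OF int X' rest_in[OF v(3)]] integrable_pcon[OF int Y' rest_in[OF u(3)]]
      integrable_D[OF int \<Gamma>D_in[OF rest_in[OF u(3)]] \<Gamma>D_in[OF rest_in[OF v(3)]]] by blast+
  have "curv ?X ?Y x \<in> D x"
    using D_closed(2)[OF D_closed(1)[OF D_closed(2)[OF d e(3)] e(2)] e(1)] by simp
  moreover have "curv ?X ?Y x = (\<theta> x * \<rho> x) *\<^sub>R curv X Y x"
    \<comment> \<open>Scaling is available in the first slot only; two exchanges bring the second
      multiplier out.\<close>
    using curv_scale[OF inv u(1) X Y', of x] curv_skew[OF inv X Y', of x] curv_scale[OF inv v(1) Y X, of x]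
      curv_skew[OF inv X Y, of x] by simp
  ultimately have "(1 / (\<theta> x * \<rho> x)) *\<^sub>R ((\<theta> x * \<rho> x) *\<^sub>R curv X Y x) \<in> D x"
    by (intro D_closed(3)[where c = "1 / (\<theta> x * \<rho> x)"]) simp
  then show ?thesis using u(2) v(2) by simp
qed

text \<open>For lifted multiples the defect of the cotangent part is 0. Its terms other than
  \<open>E3\<close> pair \<open>curv\<close> or \<open>pcon\<close> values with \<open>rest\<close>
  values, all in \<open>D x\<close>, and so vanish by isotropy.\<close>

lemma integrable_E3:
  assumes int: "\<And>u v x. u \<in> \<Gamma>L \<Longrightarrow> v \<in> \<Gamma>L \<Longrightarrow> dorfmanC u v x \<in> L x"
    and X: "X \<in> \<Gamma>W" and Y: "Y \<in> \<Gamma>W" and Z: "Z \<in> \<Gamma>W"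
  shows "E3 X Y Z x = 0"
proof -
  note inv = integrable_W[OF int]
  obtain \<theta> u where u: "\<theta> \<in> smooth_funs A" "\<theta> x \<noteq> 0" "u \<in> \<Gamma>L" "\<And>y. cx1 prT (u y) = \<theta> y *\<^sub>R X y"
    by (rule W_lift[OF X, of x], rule that)
  obtain \<rho> v where v: "\<rho> \<in> smooth_funs A" "\<rho> x \<noteq> 0" "v \<in> \<Gamma>L" "\<And>y. cx1 prT (v y) = \<rho> y *\<^sub>R Y y"
    by (rule W_lift[OF Y, of x], rule that)
  let ?X = "\<lambda>y. \<theta> y *\<^sub>R X y" and ?Y = "\<lambda>y. \<rho> y *\<^sub>R Y y"
  have X': "?X \<in> \<Gamma>W" by (rule \<Gamma>W_scale[OF u(1) X])
  have Y': "?Y \<in> \<Gamma>W" by (rule \<Gamma>W_scale[OF v(1) Y])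
  note r = \<Gamma>D_in[OF rest_in[OF u(3)], of x] and s = \<Gamma>D_in[OF rest_in[OF v(3)], of x]
  have "E3 ?X ?Y Z x - 2 *\<^sub>R ipC x (curv ?X Z x) (rest v x) + 2 *\<^sub>R ipC x (curv ?Y Z x) (rest u x)
      + 2 *\<^sub>R ipC x (pcon Z (rest u) x) (rest v x) = 0"
    using form_identity[OF u(3) v(3) Z inv, of x] L_data(3)[OF int[OF u(3) v(3)] \<Gamma>W_in[OF Z], of x]
    by (simp only: dorfmanC_T u(4) v(4) diff_self)
  then have "E3 ?X ?Y Z x = 0"
    using D_isotropic[OF integrable_curv[OF int X' Z] s] D_isotropic[OF integrable_curv[OF int Y' Z] r]
      D_isotropic[OF integrable_pcon[OF int Z rest_in[OF u(3)]] s] by simp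
  moreover have "E3 ?X ?Y Z x = (\<theta> x * \<rho> x) *\<^sub>R E3 X Y Z x"
    using E3_scale[OF inv u(1) X Y' Z, of x] E3_skew[OF inv X Y' Z, of x] E3_scale[OF inv v(1) Y X Z, of x]
      E3_skew[OF inv X Y Z, of x] by simp
  ultimately show ?thesis using u(2) v(2) by simp
qed

text \<open>No multipliers are required in this direction, because \<open>X\<close> and
  \<open>Y\<close> are the tangent parts of given sections of \<open>L\<close>.\<close>

lemma conditions_integrable:
  assumes inv: "\<And>X Y. X \<in> \<Gamma>W \<Longrightarrow> Y \<in> \<Gamma>W \<Longrightarrow> lieC X Y \<in> \<Gamma>W"
    and alg: "\<And>x r s. r \<in> D x \<Longrightarrow> s \<in> D x \<Longrightarrow> brC x r s \<in> D x"
    and pcon: "\<And>X r x. X \<in> \<Gamma>W \<Longrightarrow> r \<in> \<Gamma>D \<Longrightarrow> pcon X r x \<in> D x"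
    and curv: "\<And>X Y x. X \<in> \<Gamma>W \<Longrightarrow> Y \<in> \<Gamma>W \<Longrightarrow> curv X Y x \<in> D x"
    and E3: "\<And>X Y Z x. X \<in> \<Gamma>W \<Longrightarrow> Y \<in> \<Gamma>W \<Longrightarrow> Z \<in> \<Gamma>W \<Longrightarrow> E3 X Y Z x = 0"
    and u: "u \<in> \<Gamma>L" and v: "v \<in> \<Gamma>L"
  shows "dorfmanC u v x \<in> L x"
proof -
  define X where "X = (\<lambda>x. cx1 prT (u x))"
  define Y where "Y = (\<lambda>x. cx1 prT (v x))"
  have X: "X \<in> \<Gamma>W" and Y: "Y \<in> \<Gamma>W" using \<Gamma>L_T u v by (auto simp: X_def Y_def)
  note r = \<Gamma>D_in[OF rest_in[OF u], of x] and s = \<Gamma>D_in[OF rest_in[OF v], of x]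
  have T: "cx1 prT (dorfmanC u v x) = lieC X Y x" by (simp add: dorfmanC_T X_def Y_def)
  show ?thesis
  proof (rule LI, unfold T)
    have "dorfmanC u v \<in> CE" using dorfmanC_in u v by (simp add: \<Gamma>L_iff)
    then show "dorfmanC u v x \<in> E x \<times> E x"
      using courant_section_fibre[of "\<lambda>x. fst (dorfmanC u v x)" x] courant_section_fibre[of "\<lambda>x. snd (dorfmanC u v x)" x]
      by (auto simp: cx_sections_iff mem_Times_iff)
    show "lieC X Y x \<in> W x" by (rule \<Gamma>W_in[OF inv[OF X Y]])
    show "cx1 prG (dorfmanC u v x) - \<sigma> x (lieC X Y x) \<in> D x"
      using G_decomposition[OF u v, of x] D_closed(1)[OF D_closed(2)[OF D_closed(1)[OF curv[OF X Y] pcon[OF X rest_in[OF v]]]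
          pcon[OF Y rest_in[OF u]]] alg[OF r s]]
      by (simp add: X_def Y_def)
    fix w assume "w \<in> W x"
    \<comment> \<open>The defect identity concerns sections, so \<open>w\<close> is extended to the
      tangent part of a section of \<open>L\<close>; only its value at \<open>x\<close> enters the
      conclusion.\<close>
    then obtain z where z: "z \<in> \<Gamma>L" "cx1 prT (z x) = w" by (rule W_extend)
    define Z where "Z = (\<lambda>x. cx1 prT (z x))"
    have Z: "Z \<in> \<Gamma>W" "Z x = w" using \<Gamma>L_T[OF z(1)] z(2) by (auto simp: Z_def)
    have "evC (cx1 prF (dorfmanC u v x)) (Z x) - (2 *\<^sub>R \<epsilon> x (lieC X Y x) (Z x)
      - ipC x (\<sigma> x (Z x)) (\<sigma> x (lieC X Y x) + 2 *\<^sub>R (cx1 prG (dorfmanC u v x) - \<sigma> x (lieC X Y x)))) = 0"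
      using form_identity[OF u v Z(1) inv, of x, folded X_def Y_def]
      by (simp add: E3[OF X Y Z(1)] D_isotropic[OF curv[OF X Z(1)] s] D_isotropic[OF curv[OF Y Z(1)] r]
          D_isotropic[OF pcon[OF Z(1) rest_in[OF u]] s])
    then show "evC (cx1 prF (dorfmanC u v x)) w = 2 *\<^sub>R \<epsilon> x (lieC X Y x) w
      - ipC x (\<sigma> x w) (\<sigma> x (lieC X Y x) + 2 *\<^sub>R (cx1 prG (dorfmanC u v x) - \<sigma> x (lieC X Y x)))"
      unfolding Z(2) by simp
  qed
qed

lemma lagrangian_iff:
  "lagrangian_subalgebra (G x) (br x) (ip x) (D x) \<longleftrightarrow> (\<forall>r\<in>D x. \<forall>s\<in>D x. brC x r s \<in> D x)"
  by (simp add: lagrangian_subalgebra_def D_max_isotropic)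

theorem integrability:
  "courant_integrable A G F br ip nabla R H J \<longleftrightarrow>
    (\<forall>X\<in>\<Gamma>W. \<forall>Y\<in>\<Gamma>W. lieC X Y \<in> \<Gamma>W) \<and>
    (\<forall>x. lagrangian_subalgebra (G x) (br x) (ip x) (D x)) \<and>
    (\<forall>X\<in>\<Gamma>W. \<forall>r\<in>\<Gamma>D. pcon X r \<in> \<Gamma>D) \<and>
    (\<forall>X\<in>\<Gamma>W. \<forall>Y\<in>\<Gamma>W. \<forall>x. curv X Y x \<in> D x) \<and>
    (\<forall>X\<in>\<Gamma>W. \<forall>Y\<in>\<Gamma>W. \<forall>Z\<in>\<Gamma>W. \<forall>x. E3 X Y Z x = 0)"
proof -
  \<comment> \<open>Smoothness of \<open>pcon X r\<close> is automatic, so preserving sections of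
    \<open>D\<close> is a pointwise condition.\<close>
  have pcon: "(\<forall>X\<in>\<Gamma>W. \<forall>r\<in>\<Gamma>D. pcon X r \<in> \<Gamma>D) \<longleftrightarrow> (\<forall>X\<in>\<Gamma>W. \<forall>r\<in>\<Gamma>D. \<forall>x. pcon X r x \<in> D x)"
    using pcon_smooth \<Gamma>D_CS \<Gamma>D_iff by blast
  show ?thesis
    unfolding integrable_iff lagrangian_iff pcon
  proof (intro iffI conjI ballI allI)
    assume "\<forall>u\<in>\<Gamma>L. \<forall>v\<in>\<Gamma>L. \<forall>x. dorfmanC u v x \<in> L x"
    then have int: "\<And>u v x. u \<in> \<Gamma>L \<Longrightarrow> v \<in> \<Gamma>L \<Longrightarrow> dorfmanC u v x \<in> L x" by blast
    show "lieC X Y \<in> \<Gamma>W" if "X \<in> \<Gamma>W" "Y \<in> \<Gamma>W" for X Y by (rule integrable_W[OF int that])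
    show "brC x r s \<in> D x" if "r \<in> D x" "s \<in> D x" for x r s by (rule integrable_D[OF int that])
    show "pcon X r x \<in> D x" if "X \<in> \<Gamma>W" "r \<in> \<Gamma>D" for X r x by (rule integrable_pcon[OF int that])
    show "curv X Y x \<in> D x" if "X \<in> \<Gamma>W" "Y \<in> \<Gamma>W" for X Y x by (rule integrable_curv[OF int that])
    show "E3 X Y Z x = 0" if "X \<in> \<Gamma>W" "Y \<in> \<Gamma>W" "Z \<in> \<Gamma>W" for X Y Z x by (rule integrable_E3[OF int that])
  next
    fix u v x
    assume c: "(\<forall>X\<in>\<Gamma>W. \<forall>Y\<in>\<Gamma>W. lieC X Y \<in> \<Gamma>W) \<and> (\<forall>x. \<forall>r\<in>D x. \<forall>s\<in>D x. brC x r s \<in> D x) \<and>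
      (\<forall>X\<in>\<Gamma>W. \<forall>r\<in>\<Gamma>D. \<forall>x. pcon X r x \<in> D x) \<and> (\<forall>X\<in>\<Gamma>W. \<forall>Y\<in>\<Gamma>W. \<forall>x. curv X Y x \<in> D x) \<and>
      (\<forall>X\<in>\<Gamma>W. \<forall>Y\<in>\<Gamma>W. \<forall>Z\<in>\<Gamma>W. \<forall>x. E3 X Y Z x = 0)"
      and uv: "u \<in> \<Gamma>L" "v \<in> \<Gamma>L"
    show "dorfmanC u v x \<in> L x"
      by (rule conditions_integrable[OF _ _ _ _ _ uv]) (use c in blast)+
  qed
qed

end

theorem proposition20:
  fixes A :: "('m::{t2_space,second_countable_topology}, 'e::real_inner) atlas"
    and G :: "'m \<Rightarrow> 'v::real_vector set"
    and F :: "('m, 'v) trivs"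
    and br :: "'m \<Rightarrow> 'v \<Rightarrow> 'v \<Rightarrow> 'v"
    and ip :: "'m \<Rightarrow> 'v \<Rightarrow> 'v \<Rightarrow> real"
    and nabla :: "'m \<Rightarrow> 'm tvec \<Rightarrow> ('m \<Rightarrow> 'v) \<Rightarrow> 'v"
    and R :: "'m \<Rightarrow> 'm tvec \<Rightarrow> 'm tvec \<Rightarrow> 'v"
    and H :: "'m \<Rightarrow> 'm tvec \<Rightarrow> 'm tvec \<Rightarrow> 'm tvec \<Rightarrow> real"
    and J :: "'m \<Rightarrow> ('m, 'v) courant \<Rightarrow> ('m, 'v) courant"
    and W :: "'m \<Rightarrow> 'm tvec cx set"
    and D :: "'m \<Rightarrow> 'v cx set"
    and \<sigma> :: "'m \<Rightarrow> 'm tvec cx \<Rightarrow> 'v cx"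
    and \<epsilon> :: "'m \<Rightarrow> 'm tvec cx \<Rightarrow> 'm tvec cx \<Rightarrow> real cx"
  defines "\<Gamma>W \<equiv> sub_sections (cx_sections (vector_fields A)) W"
    and "\<Gamma>D \<equiv> sub_sections (cx_sections (sections A G F)) D"
  assumes "standard_courant_algebroid A G F br ip nabla R H"
    and "\<And>x. neutral (courant_fibre A G x) (courant_ip ip x)"
    and "\<And>x. bij_betw (\<lambda>r. restrict (br x r) (G x)) (G x) (skew_derivations (G x) (br x) (ip x))"
    and "generalized_almost_complex A G F ip J"
    and "\<And>x. W x = cx1 prT ` holo_bundle A G J x"
    and "\<And>x. D x = cx1 prG ` {u \<in> holo_bundle A G J x. cx1 prT u = 0}"
    and "\<exists>k. \<forall>x. cx.dim (W x) = k"
    and "\<And>x. clin_on (W x) (G x \<times> G x) (\<sigma> x)"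
    and "\<And>X. X \<in> \<Gamma>W \<Longrightarrow> (\<lambda>x. \<sigma> x (X x)) \<in> cx_sections (sections A G F)"
    and "\<And>x X. X \<in> W x \<Longrightarrow> clin_on (W x) UNIV (\<epsilon> x X)"
    and "\<And>x X Y. X \<in> W x \<Longrightarrow> Y \<in> W x \<Longrightarrow> \<epsilon> x X Y = - \<epsilon> x Y X"
    and "\<And>X Y. X \<in> \<Gamma>W \<Longrightarrow> Y \<in> \<Gamma>W \<Longrightarrow> (\<lambda>x. \<epsilon> x (X x) (Y x)) \<in> cx_sections (smooth_funs A)"
    and "\<And>x. holo_bundle A G J x = L_bundle A G ip W D \<sigma> \<epsilon> x"
  shows "courant_integrable A G F br ip nabla R H J \<longleftrightarrow>
    (\<forall>X\<in>\<Gamma>W. \<forall>Y\<in>\<Gamma>W. cx2_sec lie_bracket X Y \<in> \<Gamma>W) \<and>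
    (\<forall>x. lagrangian_subalgebra (G x) (br x) (ip x) (D x)) \<and>
    (\<forall>X\<in>\<Gamma>W. \<forall>r\<in>\<Gamma>D.
       (\<lambda>x. cx2_sec (cov nabla) X r x + cx2 (br x) (\<sigma> x (X x)) (r x)) \<in> \<Gamma>D) \<and>
    (\<forall>X\<in>\<Gamma>W. \<forall>Y\<in>\<Gamma>W. \<forall>x.
       cx2 (R x) (X x) (Y x) + d_sigma nabla \<sigma> X Y x
         + cx2 (br x) (\<sigma> x (X x)) (\<sigma> x (Y x)) \<in> D x) \<and>
    (\<forall>X\<in>\<Gamma>W. \<forall>Y\<in>\<Gamma>W. \<forall>Z\<in>\<Gamma>W. \<forall>x.
       cx3 (H x) (X x) (Y x) (Z x) + 2 *\<^sub>R d_epsilon \<epsilon> X Y Z x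
         + 2 *\<^sub>R wedge_ip ip (\<lambda>X Y x. cx2 (R x) (X x) (Y x)) \<sigma> X Y Z x
         + wedge_ip ip (d_sigma nabla \<sigma>) \<sigma> X Y Z x
         + 2 *\<^sub>R cx2 (ip x) (cx2 (br x) (\<sigma> x (X x)) (\<sigma> x (Y x))) (\<sigma> x (Z x)) = 0)"
proof -
  interpret courant_almost_complex A G F br ip nabla R H J W D \<sigma> \<epsilon>
    using assms(6-15) unfolding \<Gamma>W_def
    by (intro courant_almost_complex.intro[OF assms(3)] courant_almost_complex_axioms.intro) assumption+
  show ?thesis
    unfolding integrability \<Gamma>W_def \<Gamma>D_def pcon_def[abs_def] curv_def E3_def ..
qed

end
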